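(* Let $c_1,c_2\in\mathbb{R}$ be two given constants and let $\rho\in(-1,1)$. (i) If $a\in(\rho,1]$, then, as $u\to\infty$, $$\psi(u,au)\sim C_{a,\rho}\,u^{-2}\,\varphi_\rho(u+c_1,\,au+c_2),$$ where the constant $C_{a,\rho}\in(0,\infty)$ is given by $$C_{a,\rho}=\int_{\mathbb{R}^2}\mathbb{P}\left\{\exists\, t\ge 0:\ W_1(t)-t>x,\ W_2(t)-at>y\right\}e^{\lambda_1x+\lambda_2y}\,dx\,dy,$$ with $$\lambda_1=\frac{1-a\rho}{1-\rho^2}>0,\qquad \lambda_2=\frac{a-\rho}{1-\rho^2}>0.$$ (ii) If $a\le\rho$, then, as $u\to\infty$, $$\psi(u,au)\sim 2\sqrt{2\pi(1-\rho^2)}\;\Phi^*(c_1\rho-c_2)\;e^{\frac{(c_2-\rho c_1)^2}{2(1-\rho^2)}}\;u^{-1}\,\varphi_\rho(u+c_1,\,\rho u+c_2),$$ where $\Phi^*(c_1\rho-c_2)=1$ if $a<\rho$, and, when $a=\rho$, $\Phi^*$ is the distribution function of $\sqrt{1-\rho^2}\,W_1(1)$.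
   Context: $B_1,B_2$ are two independent standard Brownian motions and $(W_1(t),W_2(t))_{t\ge0}$ has the same law as $(B_1(t),\ \rho B_1(t)+\sqrt{1-\rho^2}\,B_2(t))_{t\ge0}$. For real $u,v$, $$\psi(u,v)=\mathbb{P}\left\{\exists\, t\in[0,1]:\ W_1(t)-c_1t>u,\ W_2(t)-c_2t>v\right\}.$$ $\varphi_\rho$ is the joint probability density function of $(W_1(1),W_2(1))$. The notation $f(u)\sim g(u)$ as $u\to\infty$ means $f(u)/g(u)\to1$. *)

theory Defs
  imports "HOL-Probability.Probability"
begin

(* Processes are indexed by real, but only times t >= 0 are meaningful.  All paths (not merely
   almost all) are continuous, so that the events "there exists t with ..." below are measurable. *)
locale standard_brownian_motion = prob_space M for M :: "'a measure" +
  fixes B :: "real \<Rightarrow> 'a \<Rightarrow> real"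
  assumes random_variable: "t \<ge> 0 \<Longrightarrow> B t \<in> borel_measurable M"
    and start: "AE \<omega> in M. B 0 \<omega> = 0"
    and continuous_paths: "\<omega> \<in> space M \<Longrightarrow> continuous_on {0..} (\<lambda>t. B t \<omega>)"
    and normal_increments: "0 \<le> s \<Longrightarrow> s < t \<Longrightarrow>
      distributed M lborel (\<lambda>\<omega>. B t \<omega> - B s \<omega>) (normal_density 0 (sqrt (t - s)))"
    and indep_increments: "0 \<le> \<tau> 0 \<Longrightarrow> mono \<tau> \<Longrightarrow>
      indep_vars (\<lambda>_. borel) (\<lambda>i \<omega>. B (\<tau> (Suc i)) \<omega> - B (\<tau> i) \<omega>) {..<n::nat}"

definition path_space :: "(real \<Rightarrow> 'b::topological_space) measure" where
  "path_space = PiM {0..} (\<lambda>_. borel)"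

definition path :: "(real \<Rightarrow> 'a \<Rightarrow> 'b) \<Rightarrow> 'a \<Rightarrow> real \<Rightarrow> 'b" where
  "path X \<omega> = (\<lambda>t\<in>{0..}. X t \<omega>)"

definition independent_processes ::
    "'a measure \<Rightarrow> (real \<Rightarrow> 'a \<Rightarrow> real) \<Rightarrow> (real \<Rightarrow> 'a \<Rightarrow> real) \<Rightarrow> bool" where
  "independent_processes M X Y \<longleftrightarrow>
     prob_space.indep_var M path_space (path X) path_space (path Y)"

(* The law of a process is its distribution on the product sigma-algebra, i.e. it is determined by
   the finite-dimensional distributions.  Only meaningful for X t Borel measurable for all t >= 0. *)
definition process_law ::
    "'a measure \<Rightarrow> (real \<Rightarrow> 'a \<Rightarrow> 'b::topological_space) \<Rightarrow> (real \<Rightarrow> 'b) measure" where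
  "process_law M X = distr M path_space (path X)"

definition joint_pdf ::
    "'a measure \<Rightarrow> ('a \<Rightarrow> real) \<Rightarrow> ('a \<Rightarrow> real) \<Rightarrow> (real \<times> real \<Rightarrow> real) \<Rightarrow> bool" where
  "joint_pdf M X Y f \<longleftrightarrow>
     (\<forall>z. 0 \<le> f z) \<and> distributed M (lborel \<Otimes>\<^sub>M lborel) (\<lambda>\<omega>. (X \<omega>, Y \<omega>)) (\<lambda>z. ennreal (f z))"

definition psi ::
    "'a measure \<Rightarrow> (real \<Rightarrow> 'a \<Rightarrow> real) \<Rightarrow> (real \<Rightarrow> 'a \<Rightarrow> real) \<Rightarrow>
     real \<Rightarrow> real \<Rightarrow> real \<Rightarrow> real \<Rightarrow> real" where
  "psi M W1 W2 c1 c2 u v =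
     measure M {\<omega> \<in> space M. \<exists>t\<in>{0..1}. W1 t \<omega> - c1 * t > u \<and> W2 t \<omega> - c2 * t > v}"

definition lambda1 :: "real \<Rightarrow> real \<Rightarrow> real" where
  "lambda1 a \<rho> = (1 - a * \<rho>) / (1 - \<rho>\<^sup>2)"

definition lambda2 :: "real \<Rightarrow> real \<Rightarrow> real" where
  "lambda2 a \<rho> = (a - \<rho>) / (1 - \<rho>\<^sup>2)"

definition C_integrand ::
    "'a measure \<Rightarrow> (real \<Rightarrow> 'a \<Rightarrow> real) \<Rightarrow> (real \<Rightarrow> 'a \<Rightarrow> real) \<Rightarrow>
     real \<Rightarrow> real \<Rightarrow> real \<times> real \<Rightarrow> real" where
  "C_integrand M W1 W2 a \<rho> = (\<lambda>(x, y).
     measure M {\<omega> \<in> space M. \<exists>t\<ge>0. W1 t \<omega> - t > x \<and> W2 t \<omega> - a * t > y}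
       * exp (lambda1 a \<rho> * x + lambda2 a \<rho> * y))"

(* Bochner integral: its value is 0 if the integrand is not integrable, so finiteness of the
   constant has to be expressed by integrability of the integrand. *)
definition C_const ::
    "'a measure \<Rightarrow> (real \<Rightarrow> 'a \<Rightarrow> real) \<Rightarrow> (real \<Rightarrow> 'a \<Rightarrow> real) \<Rightarrow> real \<Rightarrow> real \<Rightarrow> real" where
  "C_const M W1 W2 a \<rho> = (\<integral>z. C_integrand M W1 W2 a \<rho> z \<partial>(lborel \<Otimes>\<^sub>M lborel))"

definition Phi_star ::
    "'a measure \<Rightarrow> (real \<Rightarrow> 'a \<Rightarrow> real) \<Rightarrow> real \<Rightarrow> real \<Rightarrow> real \<Rightarrow> real" where
  "Phi_star M W1 a \<rho> x =
     (if a < \<rho> then 1 else cdf (distr M borel (\<lambda>\<omega>. sqrt (1 - \<rho>\<^sup>2) * W1 1 \<omega>)) x)"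

end

theory Submission
  imports Defs "HOL-Real_Asymp.Real_Asymp"
begin

text \<open>
Write the pair as a linear image of a planar Brownian motion $B$ with independent components, so that
the exit event becomes the event that $B(t) - t\gamma$ enters a shifted cone $u m + K$.

If $a > \rho$, both constraints matter. An exit at time $1 - s/u^2$ is
examined by reversing time at $1$, rescaling time by $u^2$ and tilting with Girsanov: the probability of an exit during
$[1 - 1/u, 1]$ is exactly the Gaussian density at the corner times $u^{-2}$ times an integral,
over the rescaled endpoint $w$, of $e^{m \cdot w}$ times a damped probability that a drifted Brownian motion
enters $K$ from $w$. An exponential maximal inequality bounds this integrand by $e^{-\epsilon |w|}$, so dominated
convergence gives the constant, and the same inequality makes exits before $1 - 1/u$ negligible.

If $a \le \rho$, the first constraint decides: by the reflection principle the first component exits with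
asymptotically twice the probability that it lies above its barrier at time $1$, and the exit happens close to time $1$.
At that time the first component is near $u$, hence the second constraint only
concerns the independent part of the second component, trivially satisfied in the limit if $a < \rho$ and a
half-line event for a Gaussian variable if $a = \rho$.
\<close>

section \<open>Planar Gaussian kernels\<close>

text \<open>The law of the pair is known only on the product sigma-algebra, so every exit event must
  be reduced to countably many times before it can be transferred. Hence open targets and rational
  times; the predicate \<open>wiener\<close> asks for no path regularity. The tilt uses the corner
  \<theta> = u m + \<gamma>, the position of the moving barrier at time 1. This choice cancels the
  drift \<gamma> in the rescaled path exactly and leaves the drift m that appears in the constant; u
  survives only in the prefactor, in exp(\<theta> . w / u), in the time horizon and in a Gaussian
  damping factor. A window of length 1/u has rescaled length u: it grows, so the limit sees all
  times s >= 0, while E|B(u)|^2 = 2u is small against u^2, so the damping tends to 1. The range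
  \<rho> < a <= 1 enters as positivity of both \<lambda>'s, i.e. m lies inside the dual cone of K,
  which yields the integrable majorant. For a <= \<rho> this position is lost. There two windows are
  needed: u^(-3/2), short enough to freeze a linear barrier yet long enough to make earlier exits
  negligible, and u^(-1/2) for the overshoot and for the second component.\<close>

definition planar_density :: "real \<Rightarrow> real \<times> real \<Rightarrow> real" where
  "planar_density h x = exp (- (norm x)\<^sup>2 / (2 * h)) / (2 * pi * h)"

lemma planar_density_nonneg: "h \<ge> 0 \<Longrightarrow> planar_density h x \<ge> 0"
  by (simp add: planar_density_def)

lemma measurable_planar_density [measurable]: "planar_density h \<in> borel_measurable borel"
  unfolding planar_density_def by measurable

text \<open>The point mass at \<open>h = 0\<close> permits grids with steps of length zero, so
  repeated time points and a reversed stretch that reaches back to time 0 need no separate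
  treatment.\<close>

definition planar_gauss :: "real \<Rightarrow> (real \<times> real) measure" where
  "planar_gauss h = (if h = 0 then return borel 0
     else density lborel (\<lambda>x. ennreal (planar_density h x)))"

lemma sets_planar_gauss [simp, measurable_cong]: "sets (planar_gauss h) = sets borel"
  by (simp add: planar_gauss_def)

lemma space_planar_gauss [simp]: "space (planar_gauss h) = UNIV"
  by (simp add: planar_gauss_def)

lemma normal_density_mult:
  assumes "h > 0"
  shows "normal_density 0 (sqrt h) x * normal_density 0 (sqrt h) y
    = planar_density h (x, y)"
proof -
  have "sqrt (2 * pi * h) * sqrt (2 * pi * h) = 2 * pi * h"
    using assms by simp
  moreover have "exp (- x\<^sup>2 / (2 * h)) * exp (- y\<^sup>2 / (2 * h)) = exp (- (x\<^sup>2 + y\<^sup>2) / (2 * h))"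
    by (simp add: exp_add[symmetric] add_divide_distrib[symmetric] diff_divide_distrib)
  ultimately show ?thesis
    using assms by (simp add: normal_density_def planar_density_def norm_Pair)
qed

lemma planar_gauss_eq_pair:
  assumes "h > 0"
  shows "planar_gauss h = density lborel (normal_density 0 (sqrt h)) \<Otimes>\<^sub>M density lborel (normal_density 0 (sqrt h))"
proof -
  interpret D: prob_space "density lborel (\<lambda>x. ennreal (normal_density 0 (sqrt h) x))"
    using assms by (intro prob_space_normal_density) auto
  show ?thesis
    using assms
    by (subst pair_measure_density)
      (auto simp: planar_gauss_def lborel_prod lborel.sigma_finite_measure_axioms D.sigma_finite_measure_axioms
         ennreal_mult[symmetric] normal_density_mult case_prod_beta')
qed

lemma prob_space_planar_gauss:
  assumes "h \<ge> 0"
  shows "prob_space (planar_gauss h)"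
proof (cases "h = 0")
  case True
  then show ?thesis by (simp add: planar_gauss_def prob_space_return)
next
  case False
  then have h: "h > 0" using assms by simp
  interpret D: prob_space "density lborel (\<lambda>x. ennreal (normal_density 0 (sqrt h) x))"
    using h by (intro prob_space_normal_density) auto
  interpret DD: pair_prob_space "density lborel (\<lambda>x. ennreal (normal_density 0 (sqrt h) x))"
    "density lborel (\<lambda>x. ennreal (normal_density 0 (sqrt h) x))" ..
  show ?thesis unfolding planar_gauss_eq_pair[OF h] by (rule DD.prob_space_axioms)
qed

text \<open>The Jacobian of a homothety of the plane is c^2 for either sign of c; negative factors
  occur below, both for the reflection in the tilt and for the change of endpoint variable.\<close>

lemma nn_integral_lborel_affine:
  fixes f :: "real \<times> real \<Rightarrow> ennreal"
  assumes [measurable]: "f \<in> borel_measurable borel" and "c \<noteq> 0"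
  shows "(\<integral>\<^sup>+x. f x \<partial>lborel) = ennreal (c\<^sup>2) * (\<integral>\<^sup>+x. f (t + c *\<^sub>R x) \<partial>lborel)"
  apply (subst lborel_affine[OF \<open>c \<noteq> 0\<close>, of t])
  apply (subst nn_integral_density)
  apply (auto simp: nn_integral_distr nn_integral_cmult power2_eq_square)
  done

lemma nn_integral_planar_gauss:
  assumes "h > 0" and [measurable]: "f \<in> borel_measurable borel"
  shows "(\<integral>\<^sup>+x. f x \<partial>planar_gauss h) =
    (\<integral>\<^sup>+x. ennreal (planar_density h x) * f x \<partial>lborel)"
  using assms by (simp add: planar_gauss_def nn_integral_density)

text \<open>Completing the square: the weight times the density at x is the density at h v - x. The
  reflected point h v - x, instead of x - h v, gives the sign that time reversal will need.\<close>

lemma nn_integral_planar_gauss_tilt: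
  fixes f :: "real \<times> real \<Rightarrow> ennreal"
  assumes "h \<ge> 0" and [measurable]: "f \<in> borel_measurable borel"
  shows "(\<integral>\<^sup>+x. ennreal (exp (v \<bullet> x - (norm v)\<^sup>2 * h / 2)) * f (h *\<^sub>R v - x) \<partial>planar_gauss h)
    = (\<integral>\<^sup>+x. f x \<partial>planar_gauss h)"
proof (cases "h = 0")
  case True
  then show ?thesis by (simp add: planar_gauss_def nn_integral_return)
next
  case False
  then have h: "h > 0" using assms by simp
  have eq: "planar_density h x * exp (v \<bullet> x - (norm v)\<^sup>2 * h / 2)
     = planar_density h (h *\<^sub>R v - x)" for x
  proof -
    have "(norm (h *\<^sub>R v - x))\<^sup>2 = h\<^sup>2 * (norm v)\<^sup>2 - 2 * h * (v \<bullet> x) + (norm x)\<^sup>2"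
      using dot_norm_neg[of "h *\<^sub>R v" x] by (simp add: power_mult_distrib)
    then have "- (norm x)\<^sup>2 / (2 * h) + (v \<bullet> x - (norm v)\<^sup>2 * h / 2) = - (norm (h *\<^sub>R v - x))\<^sup>2 / (2 * h)"
      unfolding \<open>(norm (h *\<^sub>R v - x))\<^sup>2 = _\<close> using h
      by (simp add: add_divide_distrib diff_divide_distrib) (simp add: power2_eq_square)
    then show ?thesis by (simp add: planar_density_def exp_add[symmetric])
  qed
  have "(\<integral>\<^sup>+x. ennreal (exp (v \<bullet> x - (norm v)\<^sup>2 * h / 2)) * f (h *\<^sub>R v - x) \<partial>planar_gauss h)
     = (\<integral>\<^sup>+x. ennreal (planar_density h (h *\<^sub>R v - x)) * f (h *\<^sub>R v - x) \<partial>lborel)"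
    using h by (subst nn_integral_planar_gauss)
      (simp_all add: mult.assoc[symmetric] ennreal_mult[symmetric] planar_density_nonneg eq)
  also have "\<dots> = (\<integral>\<^sup>+x. ennreal (planar_density h x) * f x \<partial>lborel)"
    by (subst (2) nn_integral_lborel_affine[where c = "-1" and t = "h *\<^sub>R v"]) auto
  finally show ?thesis using h by (simp add: nn_integral_planar_gauss)
qed

lemma nn_integral_planar_gauss_exp:
  assumes "h \<ge> 0"
  shows "(\<integral>\<^sup>+x. ennreal (exp (v \<bullet> x - (norm v)\<^sup>2 * h / 2)) \<partial>planar_gauss h) = 1"
proof -
  interpret prob_space "planar_gauss h" by (rule prob_space_planar_gauss[OF assms])
  show ?thesis using nn_integral_planar_gauss_tilt[OF assms, of "\<lambda>_. 1" v] emeasure_space_1 by simp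
qed

text \<open>Brownian scaling for one step; it converts the short steps of the original motion near
  time 1 into unit-scale steps of the rescaled path.\<close>

lemma emeasure_planar_gauss_scale:
  assumes "h \<ge> 0" "u > 0" and [measurable]: "A \<in> sets borel"
  shows "emeasure (planar_gauss (h / u\<^sup>2)) {x. u *\<^sub>R x \<in> A} = emeasure (planar_gauss h) A"
proof (cases "h = 0")
  case True
  have "{x. u *\<^sub>R x \<in> A} \<in> sets borel" by measurable
  with True show ?thesis by (simp add: planar_gauss_def indicator_def)
next
  case False
  then have h: "h > 0" using assms by simp
  have 1: "{x. u *\<^sub>R x \<in> A} \<in> sets borel" by measurable
  have eq: "u\<^sup>2 * planar_density h (u *\<^sub>R x)
    = planar_density (h / u\<^sup>2) x" for x :: "real \<times> real"
    using assms h by (simp add: planar_density_def power_mult_distrib mult.commute)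
  have "emeasure (planar_gauss h) A = (\<integral>\<^sup>+x. indicator A x \<partial>planar_gauss h)" by simp
  also have "\<dots> = (\<integral>\<^sup>+x. ennreal (planar_density h x) * indicator A x \<partial>lborel)"
    using h by (intro nn_integral_planar_gauss) auto
  also have "\<dots> = ennreal (u\<^sup>2) * (\<integral>\<^sup>+x. ennreal (planar_density h (u *\<^sub>R x)) * indicator A (u *\<^sub>R x) \<partial>lborel)"
    using assms by (subst nn_integral_lborel_affine[where c = u and t = 0]) auto
  also have "\<dots> = (\<integral>\<^sup>+x. ennreal (planar_density (h / u\<^sup>2) x) * indicator {x. u *\<^sub>R x \<in> A} x \<partial>lborel)"
    using assms h
    by (subst nn_integral_cmult[symmetric])
       (simp_all add: eq[symmetric] ennreal_mult' mult.assoc indicator_def)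
  also have "\<dots> = (\<integral>\<^sup>+x. indicator {x. u *\<^sub>R x \<in> A} x \<partial>planar_gauss (h / u\<^sup>2))"
    using h assms 1 by (intro nn_integral_planar_gauss[symmetric]) auto
  also have "\<dots> = emeasure (planar_gauss (h / u\<^sup>2)) {x. u *\<^sub>R x \<in> A}"
    using 1 by simp
  finally show ?thesis by simp
qed

lemma nn_integral_product_planar_gauss:
  fixes n :: nat
  assumes "\<And>i. i < n \<Longrightarrow> f i \<in> borel_measurable borel" "\<And>i. i < n \<Longrightarrow> h i \<ge> 0"
  shows "(\<integral>\<^sup>+x. (\<Prod>i<n. f i (x i)) \<partial>PiM {..<n} (\<lambda>i. planar_gauss (h i))) = (\<Prod>i<n. \<integral>\<^sup>+x. f i x \<partial>planar_gauss (h i))"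
proof -
  \<comment> \<open>The product locale asks for a probability measure at every index, so indices
    beyond n are padded with the point mass.\<close>
  interpret product_prob_space "\<lambda>i. planar_gauss (if i < n then h i else 0)" "{..<n}"
    using assms(2) by (intro product_prob_spaceI prob_space_planar_gauss) auto
  have "PiM {..<n} (\<lambda>i. planar_gauss (h i)) = PiM {..<n} (\<lambda>i. planar_gauss (if i < n then h i else 0))"
    by (intro PiM_cong) auto
  moreover have "(\<Prod>i<n. integral\<^sup>N (planar_gauss (if i < n then h i else 0)) (f i)) = (\<Prod>i<n. integral\<^sup>N (planar_gauss (h i)) (f i))"
    by (intro prod.cong) auto
  moreover have "(\<integral>\<^sup>+x. (\<Prod>i<n. f i (x i)) \<partial>PiM {..<n} (\<lambda>i. planar_gauss (if i < n then h i else 0)))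
      = (\<Prod>i<n. integral\<^sup>N (planar_gauss (if i < n then h i else 0)) (f i))"
    using assms(1) by (intro product_nn_integral_prod) (auto simp: measurable_cong_sets[OF sets_planar_gauss refl])
  ultimately show ?thesis by simp
qed

section \<open>Wiener paths and exponential tilting\<close>

text \<open>A process on [0,T] with independent planar Gaussian increments, stated through rectangle
  probabilities on every grid from 0 to T. This form can be checked directly both after a change of
  measure and after conditioning on an earlier position, the two operations to which it is
  applied.\<close>

definition wiener :: "'a measure \<Rightarrow> real \<Rightarrow> (real \<Rightarrow> 'a \<Rightarrow> real \<times> real) \<Rightarrow> bool" where
  "wiener M T X \<longleftrightarrow> prob_space M \<and> 0 \<le> T \<and> (\<forall>t\<in>{0..T}. X t \<in> borel_measurable M) \<and>
     (AE \<omega> in M. X 0 \<omega> = 0) \<and>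
     (\<forall>n \<tau> A. \<tau> 0 = 0 \<longrightarrow> \<tau> n = T \<longrightarrow> (\<forall>i<n. \<tau> i \<le> \<tau> (Suc i)) \<longrightarrow> (\<forall>i<n. A i \<in> sets borel) \<longrightarrow>
        emeasure M {\<omega>\<in>space M. \<forall>i<n. X (\<tau> (Suc i)) \<omega> - X (\<tau> i) \<omega> \<in> A i}
          = (\<Prod>i<n. emeasure (planar_gauss (\<tau> (Suc i) - \<tau> i)) (A i)))"

definition path_upto :: "real \<Rightarrow> (real \<Rightarrow> 'a \<Rightarrow> 'b) \<Rightarrow> 'a \<Rightarrow> real \<Rightarrow> 'b" where
  "path_upto T X \<omega> = (\<lambda>t\<in>{0..T}. X t \<omega>)"

lemma
  assumes "wiener M T X"
  shows wiener_prob_space: "prob_space M" and wiener_nonneg: "0 \<le> T"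
    and wiener_measurable: "t \<in> {0..T} \<Longrightarrow> X t \<in> borel_measurable M"
    and wiener_start: "AE \<omega> in M. X 0 \<omega> = 0"
proof -
  note D = assms[unfolded wiener_def]
  show "prob_space M" by (rule D[THEN conjunct1])
  show "0 \<le> T" by (rule D[THEN conjunct2, THEN conjunct1])
  show "t \<in> {0..T} \<Longrightarrow> X t \<in> borel_measurable M"
    by (rule D[THEN conjunct2, THEN conjunct2, THEN conjunct1, THEN bspec])
  show "AE \<omega> in M. X 0 \<omega> = 0" by (rule D[THEN conjunct2, THEN conjunct2, THEN conjunct2, THEN conjunct1])
qed

lemma wiener_emeasure:
  assumes "wiener M T X" "\<tau> 0 = 0" "\<tau> n = T" "\<And>i. i < n \<Longrightarrow> \<tau> i \<le> \<tau> (Suc i)" "\<And>i. i < n \<Longrightarrow> A i \<in> sets borel"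
  shows "emeasure M {\<omega>\<in>space M. \<forall>i<n. X (\<tau> (Suc i)) \<omega> - X (\<tau> i) \<omega> \<in> A i}
          = (\<Prod>i<n. emeasure (planar_gauss (\<tau> (Suc i) - \<tau> i)) (A i))"
  by (rule assms(1)[unfolded wiener_def, THEN conjunct2, THEN conjunct2, THEN conjunct2, THEN conjunct2,
      rule_format, of \<tau> n A]) (fact assms)+

lemma grid_mono:
  fixes \<tau> :: "nat \<Rightarrow> real"
  assumes "\<And>i. i < n \<Longrightarrow> \<tau> i \<le> \<tau> (Suc i)" "i \<le> j" "j \<le> n"
  shows "\<tau> i \<le> \<tau> j"
  using assms(2,3)
proof (induction j rule: dec_induct)
  case (step j)
  then show ?case using assms(1)[of j] by simp
qed simp

text \<open>Cylinder events refer to a finite set of times, \<open>wiener\<close> to grids that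
  begin at 0 and end at T; adding the two end points and sorting links them.\<close>

lemma ex_grid:
  assumes "finite J" "J \<subseteq> {0..T}" "0 \<le> (T::real)"
  shows "\<exists>(n::nat) (\<tau> :: nat \<Rightarrow> real). \<tau> 0 = 0 \<and> \<tau> n = T \<and> (\<forall>i<n. \<tau> i \<le> \<tau> (Suc i)) \<and> J \<subseteq> \<tau> ` {..n}"
proof -
  define xs where "xs = sorted_list_of_set (J \<union> {0, T})"
  have set: "set xs = J \<union> {0, T}" and sorted: "sorted xs"
    using assms by (simp_all add: xs_def del: Un_insert_right)
  define n where "n = length xs - 1"
  have len: "length xs = Suc n" using set by (cases xs) (auto simp: n_def)
  have nth: "xs ! i \<in> {0..T}" if "i \<le> n" for i
    using nth_mem[of i xs] that len set assms by auto
  obtain k where k: "k \<le> n" "xs ! k = 0" using set len by (metis UnI2 in_set_conv_nth insertI1 less_Suc_eq_le)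
  obtain l where l: "l \<le> n" "xs ! l = T" using set len by (metis UnI2 in_set_conv_nth insertI1 insertI2 less_Suc_eq_le)
  show ?thesis
  proof (intro exI conjI allI impI)
    have "xs ! 0 \<le> xs ! k" using sorted_nth_mono[OF sorted, of 0 k] k len by simp
    then show "xs ! 0 = 0" using nth[of 0] k by auto
    have "xs ! l \<le> xs ! n" using sorted_nth_mono[OF sorted, of l n] l len by simp
    then show "xs ! n = T" using nth[of n] l by auto
    show "xs ! i \<le> xs ! Suc i" if "i < n" for i using sorted len that by (simp add: sorted_nth_mono)
    show "J \<subseteq> (!) xs ` {..n}"
    proof
      fix t assume "t \<in> J"
      then have "t \<in> set xs" using set by simp
      then show "t \<in> (!) xs ` {..n}" using len by (auto simp: in_set_conv_nth less_Suc_eq_le)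
    qed
  qed
qed

section \<open>The increment vector on a fixed grid\<close>

locale wiener_grid =
  fixes M :: "'a measure" and T X n and \<tau> :: "nat \<Rightarrow> real"
  assumes W: "wiener M T X"
    and grid_start: "\<tau> 0 = 0" and grid_end: "\<tau> n = T" and grid_step: "\<And>i. i < n \<Longrightarrow> \<tau> i \<le> \<tau> (Suc i)"
begin

sublocale prob_space M using W by (rule wiener_prob_space)

definition "incr \<omega> = (\<lambda>i\<in>{..<n}. X (\<tau> (Suc i)) \<omega> - X (\<tau> i) \<omega>)"

abbreviation "law \<equiv> PiM {..<n} (\<lambda>i. planar_gauss (\<tau> (Suc i) - \<tau> i))"

lemma grid_in: "i \<le> n \<Longrightarrow> 0 \<le> \<tau> i \<and> \<tau> i \<le> T"
  using grid_mono[of n \<tau>, OF grid_step, of 0 i] grid_mono[of n \<tau>, OF grid_step, of i n] grid_start grid_end by simp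

lemma measurable_X: "i \<le> n \<Longrightarrow> X (\<tau> i) \<in> borel_measurable M"
  using wiener_measurable[OF W] grid_in[of i] by simp

lemma measurable_incr [measurable]: "incr \<in> M \<rightarrow>\<^sub>M law"
  unfolding incr_def using measurable_X
  by (intro measurable_restrict) (auto simp: measurable_cong_sets[OF refl sets_planar_gauss])

lemma distr_incr: "distr M law incr = law"
proof -
  interpret product_prob_space "\<lambda>i. planar_gauss (if i < n then \<tau> (Suc i) - \<tau> i else 0)" "{..<n}"
    using grid_step by (intro product_prob_spaceI prob_space_planar_gauss) auto
  have eq: "law = PiM {..<n} (\<lambda>i. planar_gauss (if i < n then \<tau> (Suc i) - \<tau> i else 0))"
    by (intro PiM_cong) auto
  show ?thesis
    unfolding eq
  proof (rule PiM_eqI)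
    fix A :: "nat \<Rightarrow> (real \<times> real) set"
    assume "\<And>i. i \<in> {..<n} \<Longrightarrow> A i \<in> sets (planar_gauss (if i < n then \<tau> (Suc i) - \<tau> i else 0))"
    then have A: "\<And>i. i < n \<Longrightarrow> A i \<in> sets borel" by simp
    have "emeasure (distr M law incr) (Pi\<^sub>E {..<n} A) = emeasure M (incr -` (Pi\<^sub>E {..<n} A) \<inter> space M)"
      using A by (intro emeasure_distr sets_PiM_I_finite) auto
    also have "incr -` (Pi\<^sub>E {..<n} A) \<inter> space M = {\<omega>\<in>space M. \<forall>i<n. X (\<tau> (Suc i)) \<omega> - X (\<tau> i) \<omega> \<in> A i}"
      by (rule set_eqI) (simp only: incr_def restrict_PiE_iff vimage_eq Int_iff mem_Collect_eq lessThan_iff Ball_def conj_commute)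
    also have "emeasure M \<dots> = (\<Prod>i<n. emeasure (planar_gauss (\<tau> (Suc i) - \<tau> i)) (A i))"
      using A by (intro wiener_emeasure[OF W grid_start grid_end grid_step])
    finally show "emeasure (distr M (PiM {..<n} (\<lambda>i. planar_gauss (if i < n then \<tau> (Suc i) - \<tau> i else 0))) incr) (Pi\<^sub>E {..<n} A)
       = (\<Prod>i<n. emeasure (planar_gauss (if i < n then \<tau> (Suc i) - \<tau> i else 0)) (A i))"
      unfolding eq using prod.cong[of "{..<n}" "{..<n}" "\<lambda>i. emeasure (planar_gauss (\<tau> (Suc i) - \<tau> i)) (A i)"
        "\<lambda>i. emeasure (planar_gauss (if i < n then \<tau> (Suc i) - \<tau> i else 0)) (A i)"] by simp
  qed auto
qed

lemma nn_integral_incr: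
  assumes "f \<in> borel_measurable law"
  shows "(\<integral>\<^sup>+\<omega>. f (incr \<omega>) \<partial>M) = (\<integral>\<^sup>+x. f x \<partial>law)"
  using nn_integral_distr[OF measurable_incr, of f] assms by (simp add: distr_incr)

text \<open>Almost everywhere only, because the process starts at 0 only almost everywhere.\<close>

lemma X_eq_sum_incr: "AE \<omega> in M. \<forall>k\<le>n. X (\<tau> k) \<omega> = (\<Sum>i<k. incr \<omega> i)"
proof -
  show ?thesis
    using wiener_start[OF W]
  proof eventually_elim
    case (elim \<omega>)
    have "(\<Sum>i<k. incr \<omega> i) = (\<Sum>i<k. X (\<tau> (Suc i)) \<omega> - X (\<tau> i) \<omega>)" if "k \<le> n" for k
      using that by (intro sum.cong) (auto simp: incr_def)
    then show ?case using elim by (simp add: sum_lessThan_telescope[of "\<lambda>i. X (\<tau> i) \<omega>"] grid_start)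
  qed
qed

end

section \<open>Uniqueness of the path law\<close>

lemma measurable_path_upto:
  assumes "\<And>t. t \<in> {0..T} \<Longrightarrow> X t \<in> M \<rightarrow>\<^sub>M N"
  shows "path_upto T X \<in> M \<rightarrow>\<^sub>M PiM {0..T} (\<lambda>_. N)"
  unfolding path_upto_def using assms by (intro measurable_restrict)

lemma wiener_measurable_path:
  "wiener M T X \<Longrightarrow> path_upto T X \<in> M \<rightarrow>\<^sub>M PiM {0..T} (\<lambda>_. borel)"
  by (intro measurable_path_upto wiener_measurable)

text \<open>The point is that the right-hand side mentions neither the measure nor the process: a
  position is a partial sum of increments, and the increment vector has a prescribed product
  law.\<close>

lemma wiener_fdd:
  assumes W: "wiener M T X" and J: "finite J" "J \<subseteq> {0..T}" and n: "\<tau> 0 = 0" "\<tau> n = T" "\<And>i. i < n \<Longrightarrow> \<tau> i \<le> \<tau> (Suc i)"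
    and k: "\<And>t. t \<in> J \<Longrightarrow> k t \<le> n \<and> \<tau> (k t) = t" and A: "\<And>t. t \<in> J \<Longrightarrow> A t \<in> sets borel"
  shows "emeasure (distr M (PiM {0..T} (\<lambda>_. borel)) (path_upto T X)) (prod_emb {0..T} (\<lambda>_. borel) J (Pi\<^sub>E J A))
    = emeasure (PiM {..<n} (\<lambda>i. planar_gauss (\<tau> (Suc i) - \<tau> i)))
       {x\<in>space (PiM {..<n} (\<lambda>i. planar_gauss (\<tau> (Suc i) - \<tau> i))). \<forall>t\<in>J. (\<Sum>i<k t. x i) \<in> A t}"
proof -
  interpret wiener_grid M T X n \<tau> using W n by unfold_locales
  let ?S = "{x\<in>space law. \<forall>t\<in>J. (\<Sum>i<k t. x i) \<in> A t}"
  have [measurable]: "(\<lambda>x. \<Sum>i<k t. x i) \<in> borel_measurable law" if "t \<in> J" for t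
  proof (rule borel_measurable_sum)
    fix i assume "i \<in> {..<k t}"
    then have "i \<in> {..<n}" using k[OF that] by auto
    then show "(\<lambda>x. x i) \<in> borel_measurable law"
      using measurable_component_singleton[of i "{..<n}" "\<lambda>i. planar_gauss (\<tau> (Suc i) - \<tau> i)"]
      by (simp add: measurable_cong_sets[OF refl sets_planar_gauss])
  qed
  have S: "?S \<in> sets law"
    using J A by (intro sets.sets_Collect_finite_All' predE pred_sets2) auto
  have "emeasure (distr M (PiM {0..T} (\<lambda>_. borel)) (path_upto T X)) (prod_emb {0..T} (\<lambda>_. borel) J (Pi\<^sub>E J A))
     = emeasure M (path_upto T X -` prod_emb {0..T} (\<lambda>_. borel) J (Pi\<^sub>E J A) \<inter> space M)"
    using A J wiener_measurable_path[OF W] by (intro emeasure_distr sets_PiM_I) auto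
  also have "path_upto T X -` prod_emb {0..T} (\<lambda>_. borel) J (Pi\<^sub>E J A) \<inter> space M
     = {\<omega>\<in>space M. \<forall>t\<in>J. X t \<omega> \<in> A t}"
    using J(2) by (intro set_eqI) (simp only: vimage_eq Int_iff prod_emb_def path_upto_def restrict_restrict
      Int_absorb1 restrict_PiE_iff mem_Collect_eq space_borel UNIV_I Ball_def simp_thms conj_commute)
  also have "emeasure M \<dots> = emeasure M (incr -` ?S \<inter> space M)"
  proof (rule emeasure_eq_AE)
    show "AE \<omega> in M. (\<omega> \<in> {\<omega>\<in>space M. \<forall>t\<in>J. X t \<omega> \<in> A t}) = (\<omega> \<in> incr -` ?S \<inter> space M)"
      using X_eq_sum_incr
    proof (eventually_elim, goal_cases)
      case (1 \<omega>)
      have "X t \<omega> = (\<Sum>i<k t. incr \<omega> i)" if "t \<in> J" for t using 1 k[OF that] by auto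
      then have "(\<forall>t\<in>J. X t \<omega> \<in> A t) = (\<forall>t\<in>J. (\<Sum>i<k t. incr \<omega> i) \<in> A t)" by (intro ball_cong) simp_all
      then show ?case using measurable_space[OF measurable_incr, of \<omega>] by (simp only: mem_Collect_eq vimage_eq Int_iff) blast
    qed
    show "incr -` ?S \<inter> space M \<in> sets M" using S by measurable
    have "X t \<in> borel_measurable M" if "t \<in> J" for t using that J wiener_measurable[OF W] by auto
    then show "{\<omega>\<in>space M. \<forall>t\<in>J. X t \<omega> \<in> A t} \<in> sets M"
      using J A by (intro sets.sets_Collect_finite_All' predE pred_sets2) auto
  qed
  also have "\<dots> = emeasure (distr M law incr) ?S"
    using S by (simp add: emeasure_distr)
  finally show ?thesis unfolding distr_incr .
qed

text \<open>Cylinder sets generate the product sigma-algebra and \<open>wiener_fdd\<close> fixes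
  their probabilities. This allows a reversed Brownian path to be replaced, inside any event on
  [0,T], by a tilted path living on a different probability space.\<close>

lemma wiener_unique:
  assumes "wiener M T X" "wiener N T Y"
  shows "distr M (PiM {0..T} (\<lambda>_. borel)) (path_upto T X) = distr N (PiM {0..T} (\<lambda>_. borel)) (path_upto T Y)"
proof (rule measure_eqI_PiM_infinite)
  interpret prob_space M using assms(1) by (rule wiener_prob_space)
  show "finite_measure (distr M (PiM {0..T} (\<lambda>_. borel)) (path_upto T X))"
    using wiener_measurable_path[OF assms(1)] by (rule finite_measure_distr)
next
  fix A :: "real \<Rightarrow> (real \<times> real) set" and J
  assume J: "finite J" "J \<subseteq> {0..T}" and A: "\<And>i. i \<in> J \<Longrightarrow> A i \<in> sets borel"
  have T: "0 \<le> T" using wiener_nonneg assms(1) .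
  obtain n and \<tau> :: "nat \<Rightarrow> real" where n: "\<tau> 0 = 0" "\<tau> n = T" "\<forall>i<n. \<tau> i \<le> \<tau> (Suc i)" "J \<subseteq> \<tau> ` {..n}"
    using ex_grid[OF J T] by (elim exE conjE)
  have "\<forall>t\<in>J. \<exists>k. k \<le> n \<and> \<tau> k = t" using n(4) by auto
  then obtain k where k: "\<And>t. t \<in> J \<Longrightarrow> k t \<le> n \<and> \<tau> (k t) = t" by metis
  show "emeasure (distr M (PiM {0..T} (\<lambda>_. borel)) (path_upto T X)) (prod_emb {0..T} (\<lambda>_. borel) J (Pi\<^sub>E J A)) =
      emeasure (distr N (PiM {0..T} (\<lambda>_. borel)) (path_upto T Y)) (prod_emb {0..T} (\<lambda>_. borel) J (Pi\<^sub>E J A))"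
    using wiener_fdd[OF assms(1) J n(1,2) n(3)[rule_format] k A] wiener_fdd[OF assms(2) J n(1,2) n(3)[rule_format] k A] by simp
qed simp_all

lemma sets_Collect_all_less:
  fixes n :: nat
  assumes "\<And>i. i < n \<Longrightarrow> Z i \<in> borel_measurable M" "\<And>i. i < n \<Longrightarrow> A i \<in> sets borel"
  shows "{\<omega>\<in>space M. \<forall>i<n. Z i \<omega> \<in> A i} \<in> sets M"
proof -
  have 1: "{\<omega>\<in>space M. Z i \<omega> \<in> A i} \<in> sets M" if "i < n" for i
    using measurable_sets[OF assms(1)[OF that] assms(2)[OF that]] by (simp add: vimage_def Int_def conj_commute)
  have "{\<omega>\<in>space M. \<forall>i<k. Z i \<omega> \<in> A i} \<in> sets M" if "k \<le> n" for k
    using that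
  proof (induction k)
    case (Suc k)
    have "{\<omega>\<in>space M. \<forall>i<Suc k. Z i \<omega> \<in> A i}
      = {\<omega>\<in>space M. \<forall>i<k. Z i \<omega> \<in> A i} \<inter> {\<omega>\<in>space M. Z k \<omega> \<in> A k}"
      unfolding set_eq_iff mem_Collect_eq Int_iff All_less_Suc by iprover
    moreover have "\<dots> \<in> sets M" using Suc.prems by (intro sets.Int Suc.IH 1) simp_all
    ultimately show ?case by (simp only:)
  qed simp
  then show ?thesis by blast
qed

text \<open>Both v . X(T) and T are sums over the steps of any grid, so the exponential density
  splits into one factor per step, and each factor is absorbed by
  \<open>nn_integral_planar_gauss_tilt\<close>. The sign of X is flipped on purpose: reversal
  contributes a second sign, and the two together restore the untilted motion.\<close>

lemma wiener_girsanov: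
  assumes W: "wiener M T X"
  shows "wiener (density M (\<lambda>\<omega>. ennreal (exp (v \<bullet> X T \<omega> - (norm v)\<^sup>2 * T / 2)))) T (\<lambda>t \<omega>. t *\<^sub>R v - X t \<omega>)"
    (is "wiener (density M ?D) T ?Y")
proof -
  have T: "0 \<le> T" and X: "\<And>t. t \<in> {0..T} \<Longrightarrow> X t \<in> borel_measurable M" and X0: "AE \<omega> in M. X 0 \<omega> = 0"
    using wiener_nonneg[OF W] wiener_measurable[OF W] wiener_start[OF W] by simp_all
  have [measurable]: "X T \<in> borel_measurable M" using X T by simp
  have main: "emeasure (density M ?D) {\<omega>\<in>space M. \<forall>i<n. ?Y (\<tau> (Suc i)) \<omega> - ?Y (\<tau> i) \<omega> \<in> A i}
          = (\<Prod>i<n. emeasure (planar_gauss (\<tau> (Suc i) - \<tau> i)) (A i))"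
    if \<tau>: "\<tau> 0 = 0" "\<tau> n = T" "\<And>i. i < n \<Longrightarrow> \<tau> i \<le> \<tau> (Suc i)" and A: "\<And>i. i < n \<Longrightarrow> A i \<in> sets borel"
    for n and \<tau> :: "nat \<Rightarrow> real" and A :: "nat \<Rightarrow> (real \<times> real) set"
  proof -
    interpret wiener_grid M T X n \<tau> using W \<tau> by unfold_locales
    define h where "h i = \<tau> (Suc i) - \<tau> i" for i
    have h: "i < n \<Longrightarrow> h i \<ge> 0" for i using \<tau> by (simp add: h_def)
    have sumh: "(\<Sum>i<n. h i) = T" using \<tau> by (simp add: h_def sum_lessThan_telescope)
    \<comment> \<open>One factor per step: its share of the density times the indicator of the event
      for the tilted increment.\<close>
    define f where "f i x = ennreal (exp (v \<bullet> x - (norm v)\<^sup>2 * h i / 2)) * indicator (A i) (h i *\<^sub>R v - x)" for i x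
    have f[measurable]: "f i \<in> borel_measurable borel" if "i < n" for i
      using A[OF that] unfolding f_def by measurable
    have set: "{\<omega>\<in>space M. \<forall>i<n. ?Y (\<tau> (Suc i)) \<omega> - ?Y (\<tau> i) \<omega> \<in> A i} \<in> sets M"
      using A by (intro sets_Collect_all_less borel_measurable_diff borel_measurable_scaleR measurable_X) auto
    have "emeasure (density M ?D) {\<omega>\<in>space M. \<forall>i<n. ?Y (\<tau> (Suc i)) \<omega> - ?Y (\<tau> i) \<omega> \<in> A i}
       = (\<integral>\<^sup>+\<omega>. ?D \<omega> * indicator {\<omega>\<in>space M. \<forall>i<n. ?Y (\<tau> (Suc i)) \<omega> - ?Y (\<tau> i) \<omega> \<in> A i} \<omega> \<partial>M)"
      by (intro emeasure_density set) simp
    also have "\<dots> = (\<integral>\<^sup>+\<omega>. (\<Prod>i<n. f i (incr \<omega> i)) \<partial>M)"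
    proof (rule nn_integral_cong_AE)
      show "AE \<omega> in M. ?D \<omega> * indicator {\<omega>\<in>space M. \<forall>i<n. ?Y (\<tau> (Suc i)) \<omega> - ?Y (\<tau> i) \<omega> \<in> A i} \<omega>
         = (\<Prod>i<n. f i (incr \<omega> i))"
        using X_eq_sum_incr AE_space
      proof (eventually_elim, goal_cases)
        case (1 \<omega>)
        have inc: "h i *\<^sub>R v - incr \<omega> i = ?Y (\<tau> (Suc i)) \<omega> - ?Y (\<tau> i) \<omega>" if "i < n" for i
          using that by (simp add: incr_def h_def scaleR_left_diff_distrib)
        have "X T \<omega> = (\<Sum>i<n. incr \<omega> i)" using 1 \<tau> by auto
        then have "v \<bullet> X T \<omega> - (norm v)\<^sup>2 * T / 2 = (\<Sum>i<n. v \<bullet> incr \<omega> i - (norm v)\<^sup>2 * h i / 2)"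
          by (simp add: inner_sum_right sum_subtractf sum_divide_distrib[symmetric] sum_distrib_left[symmetric] sumh)
        then have "?D \<omega> = (\<Prod>i<n. ennreal (exp (v \<bullet> incr \<omega> i - (norm v)\<^sup>2 * h i / 2)))"
          by (simp add: exp_sum prod_ennreal)
        moreover have "indicator {\<omega>\<in>space M. \<forall>i<n. ?Y (\<tau> (Suc i)) \<omega> - ?Y (\<tau> i) \<omega> \<in> A i} \<omega>
            = (\<Prod>i<n. indicator (A i) (h i *\<^sub>R v - incr \<omega> i) :: ennreal)"
        proof (cases "\<forall>i<n. ?Y (\<tau> (Suc i)) \<omega> - ?Y (\<tau> i) \<omega> \<in> A i")
          case True
          then have "(\<Prod>i<n. indicator (A i) (h i *\<^sub>R v - incr \<omega> i) :: ennreal) = 1"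
            using inc by (intro prod.neutral) auto
          then show ?thesis using True 1 by (auto simp: indicator_def)
        next
          case False
          then obtain i where "i < n" "?Y (\<tau> (Suc i)) \<omega> - ?Y (\<tau> i) \<omega> \<notin> A i" by auto
          then have "(\<Prod>i<n. indicator (A i) (h i *\<^sub>R v - incr \<omega> i) :: ennreal) = 0"
            using inc by (intro prod_zero) (auto intro!: bexI[of _ i])
          then show ?thesis using False by (auto simp: indicator_def)
        qed
        ultimately show ?case by (simp add: f_def prod.distrib)
      qed
    qed
    also have "\<dots> = (\<integral>\<^sup>+x. (\<Prod>i<n. f i (x i)) \<partial>law)"
    proof (rule nn_integral_incr)
      have "(\<lambda>x. f i (x i)) \<in> borel_measurable law" if "i \<in> {..<n}" for i
        using measurable_component_singleton[of i "{..<n}" "\<lambda>i. planar_gauss (\<tau> (Suc i) - \<tau> i)"] that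
        by (intro measurable_compose[OF _ f]) (auto simp: measurable_cong_sets[OF refl sets_planar_gauss])
      then show "(\<lambda>x. \<Prod>i<n. f i (x i)) \<in> borel_measurable law" by (rule borel_measurable_prod_ennreal)
    qed
    also have "\<dots> = (\<Prod>i<n. \<integral>\<^sup>+x. f i x \<partial>planar_gauss (\<tau> (Suc i) - \<tau> i))"
      using \<tau> by (intro nn_integral_product_planar_gauss) auto
    also have "\<dots> = (\<Prod>i<n. emeasure (planar_gauss (\<tau> (Suc i) - \<tau> i)) (A i))"
    proof (rule prod.cong)
      fix i assume "i \<in> {..<n}"
      then have i: "i < n" by simp
      have "(\<integral>\<^sup>+x. f i x \<partial>planar_gauss (h i)) = (\<integral>\<^sup>+x. indicator (A i) x \<partial>planar_gauss (h i))"
        unfolding f_def using A[OF i] h[OF i] by (intro nn_integral_planar_gauss_tilt) auto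
      then show "(\<integral>\<^sup>+x. f i x \<partial>planar_gauss (\<tau> (Suc i) - \<tau> i)) = emeasure (planar_gauss (\<tau> (Suc i) - \<tau> i)) (A i)"
        using A[OF i] by (simp add: h_def)
    qed simp
    finally show ?thesis .
  qed
  show ?thesis
    unfolding wiener_def
  proof (intro conjI allI impI ballI)
    show "prob_space (density M ?D)"
    proof
      interpret G: prob_space "planar_gauss T" using T by (rule prob_space_planar_gauss)
      show "emeasure (density M ?D) (space (density M ?D)) = 1"
        \<comment> \<open>Total mass from the one-step grid with the trivial event; for T = 0 this
          is a step of length zero.\<close>
        using main[of "\<lambda>i. if i = 0 then 0 else T" 1 "\<lambda>_. UNIV"] T G.emeasure_space_1 by simp
    qed
    show "AE \<omega> in density M ?D. 0 *\<^sub>R v - X 0 \<omega> = 0"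
      using X0 by (subst AE_density) auto
    show "?Y t \<in> borel_measurable (density M ?D)" if "t \<in> {0..T}" for t
      using X[OF that] by simp
    show "0 \<le> T" by fact
    show "emeasure (density M ?D) {\<omega>\<in>space (density M ?D). \<forall>i<n. ?Y (\<tau> (Suc i)) \<omega> - ?Y (\<tau> i) \<omega> \<in> A i}
          = (\<Prod>i<n. emeasure (planar_gauss (\<tau> (Suc i) - \<tau> i)) (A i))"
      if "\<tau> 0 = 0" "\<tau> n = T" "\<forall>i<n. \<tau> i \<le> \<tau> (Suc i)" and "\<forall>i<n. A i \<in> sets borel"
      for n and \<tau> :: "nat \<Rightarrow> real" and A :: "nat \<Rightarrow> (real \<times> real) set"
      using main[of \<tau> n A] that by simp
  qed
qed

section \<open>An exponential maximal inequality\<close>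

text \<open>The running product of the \<xi> i, frozen at the first index where it reaches c. The
  final value alone then records whether the level was ever reached, which turns a maximum into a
  single expectation.\<close>

primrec stopped_prod :: "real \<Rightarrow> (nat \<Rightarrow> real) \<Rightarrow> nat \<Rightarrow> real" where
  "stopped_prod c \<xi> 0 = 1"
| "stopped_prod c \<xi> (Suc n) = (if stopped_prod c \<xi> n \<ge> c then stopped_prod c \<xi> n else stopped_prod c \<xi> n * \<xi> n)"

text \<open>The induction shows a dichotomy: either the stopped product already stands at a value of
  at least c, or it is still the plain product and no partial product so far has reached c.\<close>

lemma stopped_prod_ge:
  assumes "k \<le> n" "(\<Prod>i<k. \<xi> i) \<ge> c"
  shows "stopped_prod c \<xi> n \<ge> c"
proof -
  have "stopped_prod c \<xi> n \<ge> c \<or> (stopped_prod c \<xi> n = (\<Prod>i<n. \<xi> i) \<and> (\<forall>k\<le>n. (\<Prod>i<k. \<xi> i) < c))"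
    by (induction n) (auto simp: le_Suc_eq)
  then show ?thesis using assms by force
qed

lemma stopped_prod_nonneg: "(\<And>i. i < n \<Longrightarrow> \<xi> i \<ge> 0) \<Longrightarrow> stopped_prod c \<xi> n \<ge> 0"
  by (induction n) auto

lemma stopped_prod_cong: "(\<And>i. i < n \<Longrightarrow> \<xi> i = \<xi>' i) \<Longrightarrow> stopped_prod c \<xi> n = stopped_prod c \<xi>' n"
  by (induction n) auto

lemma measurable_stopped_prod:
  assumes g: "\<And>i. i < m \<Longrightarrow> g i \<in> borel_measurable (N i)" and "n \<le> m"
  shows "(\<lambda>x. stopped_prod c (\<lambda>i. g i (x i)) n) \<in> borel_measurable (PiM {..<m} N)"
  using \<open>n \<le> m\<close>
proof (induction n)
  case (Suc n)
  have [measurable]: "(\<lambda>x. stopped_prod c (\<lambda>i. g i (x i)) n) \<in> borel_measurable (PiM {..<m} N)"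
    using Suc by simp
  have [measurable]: "(\<lambda>x. g n (x n)) \<in> borel_measurable (PiM {..<m} N)"
    using Suc.prems by (intro measurable_compose[of "\<lambda>x. x n" _ "N n" "g n"] measurable_component_singleton g) auto
  show ?case unfolding stopped_prod.simps by measurable
qed simp

text \<open>The supermartingale property, with the last coordinate integrated out first. Given the
  earlier coordinates, either the product is frozen and the last one does not enter, or it
  multiplies by a factor of mean at most 1.\<close>

lemma nn_integral_stopped_prod:
  assumes N: "\<And>i. prob_space (N i)" and g: "\<And>i. i < n \<Longrightarrow> g i \<in> borel_measurable (N i)"
    and g0: "\<And>i x. g i x \<ge> 0" and int: "\<And>i. i < n \<Longrightarrow> (\<integral>\<^sup>+x. ennreal (g i x) \<partial>N i) \<le> 1"
  shows "(\<integral>\<^sup>+x. ennreal (stopped_prod c (\<lambda>i. g i (x i)) n) \<partial>PiM {..<n} N) \<le> 1"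
  using g int
proof (induction n)
  case 0
  interpret prob_space "PiM {..<0::nat} N" by (rule prob_space_PiM) (rule N)
  show ?case by (simp add: emeasure_space_1 del: lessThan_0)
next
  case (Suc n)
  interpret product_prob_space N UNIV using N by (intro product_prob_spaceI)
  let ?S = "\<lambda>x. stopped_prod c (\<lambda>i. g i (x i)) n"
  have S0: "?S x \<ge> 0" for x by (rule stopped_prod_nonneg) (rule g0)
  have m: "(\<lambda>x. ennreal (stopped_prod c (\<lambda>i. g i (x i)) (Suc n))) \<in> borel_measurable (PiM (insert n {..<n}) N)"
    using measurable_stopped_prod[of "Suc n" g N "Suc n" c] Suc.prems(1) by (simp add: lessThan_Suc)
  have "(\<integral>\<^sup>+x. ennreal (stopped_prod c (\<lambda>i. g i (x i)) (Suc n)) \<partial>PiM {..<Suc n} N)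
     = (\<integral>\<^sup>+x. (\<integral>\<^sup>+y. ennreal (stopped_prod c (\<lambda>i. g i ((x(n := y)) i)) (Suc n)) \<partial>N n) \<partial>PiM {..<n} N)"
    unfolding lessThan_Suc by (rule product_nn_integral_insert[OF _ _ m]) auto
  also have "\<dots> \<le> (\<integral>\<^sup>+x. ennreal (?S x) \<partial>PiM {..<n} N)"
  proof (rule nn_integral_mono)
    fix x
    have eq: "stopped_prod c (\<lambda>i. g i ((x(n := y)) i)) n = ?S x" for y
      by (rule stopped_prod_cong) simp
    have gm: "(\<lambda>y. ennreal (g n y)) \<in> borel_measurable (N n)" using Suc.prems(1)[of n] by simp
    show "(\<integral>\<^sup>+y. ennreal (stopped_prod c (\<lambda>i. g i ((x(n := y)) i)) (Suc n)) \<partial>N n) \<le> ennreal (?S x)"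
    proof (cases "?S x \<ge> c")
      case True
      then show ?thesis
        unfolding stopped_prod.simps eq using prob_space.emeasure_space_1[OF N[of n]] by simp
    next
      case False
      have "(\<integral>\<^sup>+y. ennreal (stopped_prod c (\<lambda>i. g i ((x(n := y)) i)) (Suc n)) \<partial>N n)
         = (\<integral>\<^sup>+y. ennreal (?S x) * ennreal (g n y) \<partial>N n)"
        unfolding stopped_prod.simps eq using False S0 g0 by (simp add: ennreal_mult)
      also have "\<dots> = ennreal (?S x) * (\<integral>\<^sup>+y. ennreal (g n y) \<partial>N n)"
        by (rule nn_integral_cmult[OF gm])
      also have "\<dots> \<le> ennreal (?S x) * 1" using Suc.prems(2)[of n] by (intro mult_left_mono) auto
      finally show ?thesis by simp
    qed
  qed
  also have "\<dots> \<le> 1" using Suc.prems by (intro Suc.IH) auto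
  finally show ?case .
qed

text \<open>Doob's maximal inequality for the exponential martingale: Markov's inequality for the
  product of the step factors stopped at level exp x. The bound does not involve T, which later
  permits an infinite time horizon.\<close>

lemma wiener_maximal_finite:
  assumes W: "wiener M T X" and J: "finite J" "J \<subseteq> {0..T}"
  shows "emeasure M {\<omega>\<in>space M. \<exists>t\<in>J. x \<le> v \<bullet> X t \<omega> - (norm v)\<^sup>2 * t / 2} \<le> ennreal (exp (- x))"
proof -
  obtain n and \<tau> :: "nat \<Rightarrow> real" where n: "\<tau> 0 = 0" "\<tau> n = T" "\<forall>i<n. \<tau> i \<le> \<tau> (Suc i)" "J \<subseteq> \<tau> ` {..n}"
    using ex_grid[OF J wiener_nonneg[OF W]] by (elim exE conjE)
  interpret wiener_grid M T X n \<tau> using W n by unfold_locales auto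
  define h where "h i = (if i < n then \<tau> (Suc i) - \<tau> i else 0)" for i
  have h0: "h i \<ge> 0" for i using n by (auto simp: h_def)
  have sumh: "(\<Sum>i<k. h i) = \<tau> k" if "k \<le> n" for k
  proof -
    have "(\<Sum>i<k. h i) = (\<Sum>i<k. \<tau> (Suc i) - \<tau> i)" using that by (intro sum.cong) (auto simp: h_def)
    then show ?thesis using n by (simp add: sum_lessThan_telescope)
  qed
  define g where "g i y = exp (v \<bullet> y - (norm v)\<^sup>2 * h i / 2)" for i and y :: "real \<times> real"
  have law: "law = PiM {..<n} (\<lambda>i. planar_gauss (h i))" by (intro PiM_cong) (auto simp: h_def)
  have gm: "g i \<in> borel_measurable (planar_gauss (h i))" for i
    unfolding g_def measurable_cong_sets[OF sets_planar_gauss refl] by measurable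
  define Z where "Z \<omega> = stopped_prod (exp x) (\<lambda>i. g i (incr \<omega> i)) n" for \<omega>
  have Sm: "(\<lambda>y. stopped_prod (exp x) (\<lambda>i. g i (y i)) n) \<in> borel_measurable law"
    unfolding law by (rule measurable_stopped_prod) (auto intro: gm)
  have Zm: "Z \<in> borel_measurable M" unfolding Z_def by (rule measurable_compose[OF measurable_incr Sm])
  have "emeasure M {\<omega>\<in>space M. \<exists>t\<in>J. x \<le> v \<bullet> X t \<omega> - (norm v)\<^sup>2 * t / 2}
     \<le> emeasure M {\<omega>\<in>space M. 1 \<le> ennreal (exp (-x)) * ennreal (Z \<omega>)}"
  proof (rule emeasure_mono_AE)
    show "AE \<omega> in M. \<omega> \<in> {\<omega>\<in>space M. \<exists>t\<in>J. x \<le> v \<bullet> X t \<omega> - (norm v)\<^sup>2 * t / 2}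
       \<longrightarrow> \<omega> \<in> {\<omega>\<in>space M. 1 \<le> ennreal (exp (-x)) * ennreal (Z \<omega>)}"
      using X_eq_sum_incr
    proof (eventually_elim, intro impI)
      fix \<omega> assume sum: "\<forall>k\<le>n. X (\<tau> k) \<omega> = (\<Sum>i<k. incr \<omega> i)"
        and "\<omega> \<in> {\<omega>\<in>space M. \<exists>t\<in>J. x \<le> v \<bullet> X t \<omega> - (norm v)\<^sup>2 * t / 2}"
      then obtain t where t: "\<omega> \<in> space M" "t \<in> J" "x \<le> v \<bullet> X t \<omega> - (norm v)\<^sup>2 * t / 2" by auto
      then obtain k where k: "k \<le> n" "t = \<tau> k" using n by auto
      have "(\<Prod>i<k. g i (incr \<omega> i)) = exp (\<Sum>i<k. v \<bullet> incr \<omega> i - (norm v)\<^sup>2 * h i / 2)"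
        by (simp add: g_def exp_sum)
      also have "(\<Sum>i<k. v \<bullet> incr \<omega> i - (norm v)\<^sup>2 * h i / 2) = v \<bullet> (\<Sum>i<k. incr \<omega> i) - (norm v)\<^sup>2 * (\<Sum>i<k. h i) / 2"
        by (simp add: inner_sum_right sum_subtractf sum_divide_distrib[symmetric] sum_distrib_left[symmetric])
      also have "\<dots> = v \<bullet> X t \<omega> - (norm v)\<^sup>2 * t / 2" using sumh[OF k(1)] sum k by simp
      finally have "exp x \<le> (\<Prod>i<k. g i (incr \<omega> i))" using t by simp
      then have Z: "exp x \<le> Z \<omega>" unfolding Z_def using k by (intro stopped_prod_ge)
      have "1 \<le> exp (-x) * Z \<omega>" using mult_left_mono[OF Z, of "exp (-x)"] by (simp add: exp_minus)
      moreover have "0 \<le> Z \<omega>" by (rule order_trans[OF _ Z]) simp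
      ultimately have "1 \<le> ennreal (exp (-x)) * ennreal (Z \<omega>)"
        by (simp add: ennreal_mult[symmetric])
      then show "\<omega> \<in> {\<omega>\<in>space M. 1 \<le> ennreal (exp (-x)) * ennreal (Z \<omega>)}" using t by simp
    qed
    show "{\<omega>\<in>space M. 1 \<le> ennreal (exp (-x)) * ennreal (Z \<omega>)} \<in> sets M" using Zm by measurable
  qed
  also have "\<dots> \<le> ennreal (exp (-x)) * (\<integral>\<^sup>+\<omega>\<in>space M. ennreal (Z \<omega>) \<partial>M)"
    using Zm by (intro nn_integral_Markov_inequality) auto
  also have "(\<integral>\<^sup>+\<omega>\<in>space M. ennreal (Z \<omega>) \<partial>M) = (\<integral>\<^sup>+\<omega>. ennreal (Z \<omega>) \<partial>M)"
    by (rule nn_integral_cong) simp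
  also have "\<dots> = (\<integral>\<^sup>+y. ennreal (stopped_prod (exp x) (\<lambda>i. g i (y i)) n) \<partial>law)"
    unfolding Z_def using Sm by (intro nn_integral_incr) simp
  also have "\<dots> \<le> 1"
    unfolding law
  proof (rule nn_integral_stopped_prod)
    show "(\<integral>\<^sup>+y. ennreal (g i y) \<partial>planar_gauss (h i)) \<le> 1" for i
      unfolding g_def using nn_integral_planar_gauss_exp[OF h0] by simp
  qed (auto intro: gm prob_space_planar_gauss h0 simp: g_def)
  finally show ?thesis by (simp add: mult_left_mono)
qed

text \<open>An enumeration of D exhausts it by increasing finite sets; the finite bound is the same
  for all of them and passes to the supremum.\<close>

lemma wiener_maximal:
  assumes W: "wiener M T X" and D: "countable D" "D \<subseteq> {0..T}"
  shows "emeasure M {\<omega>\<in>space M. \<exists>t\<in>D. x \<le> v \<bullet> X t \<omega> - (norm v)\<^sup>2 * t / 2} \<le> ennreal (exp (- x))"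
proof (cases "D = {}")
  case False
  define J where "J n = from_nat_into D ` {..n}" for n
  have J: "finite (J n)" "J n \<subseteq> {0..T}" for n using D from_nat_into[OF False] by (auto simp: J_def)
  define E where "E n = {\<omega>\<in>space M. \<exists>t\<in>J n. x \<le> v \<bullet> X t \<omega> - (norm v)\<^sup>2 * t / 2}" for n
  have "(\<Union>n. J n) = D"
    using range_from_nat_into[OF False D(1)] unfolding J_def by blast
  then have eq: "{\<omega>\<in>space M. \<exists>t\<in>D. x \<le> v \<bullet> X t \<omega> - (norm v)\<^sup>2 * t / 2} = (\<Union>n. E n)"
    unfolding E_def by blast
  have Em: "E n \<in> sets M" for n
  proof -
    have "E n = (\<Union>t\<in>J n. {\<omega>\<in>space M. x \<le> v \<bullet> X t \<omega> - (norm v)\<^sup>2 * t / 2})" by (auto simp: E_def)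
    also have "\<dots> \<in> sets M"
    proof (rule sets.finite_UN[OF J(1)])
      fix t assume "t \<in> J n"
      then have [measurable]: "X t \<in> borel_measurable M" using J wiener_measurable[OF W] by blast
      show "{\<omega>\<in>space M. x \<le> v \<bullet> X t \<omega> - (norm v)\<^sup>2 * t / 2} \<in> sets M" by measurable
    qed
    finally show ?thesis .
  qed
  have "incseq E" by (auto simp: incseq_def E_def J_def)
  then have "emeasure M (\<Union>n. E n) = (SUP n. emeasure M (E n))"
    using Em by (intro SUP_emeasure_incseq[symmetric]) auto
  also have "\<dots> \<le> ennreal (exp (- x))"
    unfolding E_def by (intro SUP_least wiener_maximal_finite[OF W J])
  finally show ?thesis by (simp only: eq)
qed simp

section \<open>Planar Brownian motion\<close>

definition linear_gauss :: "real \<Rightarrow> real measure" where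
  "linear_gauss h = (if h = 0 then return borel 0 else density lborel (\<lambda>x. ennreal (normal_density 0 (sqrt h) x)))"

lemma sets_linear_gauss [simp, measurable_cong]: "sets (linear_gauss h) = sets borel"
  by (simp add: linear_gauss_def)

lemma prob_space_linear_gauss: "h \<ge> 0 \<Longrightarrow> prob_space (linear_gauss h)"
  by (auto simp: linear_gauss_def prob_space_return intro!: prob_space_normal_density)

text \<open>The iterated form is what appears once the laws of two independent coordinate vectors
  have been separated; at \<open>h = 0\<close> it is evaluated by hand on point masses.\<close>

lemma emeasure_planar_gauss_eq:
  assumes "h \<ge> 0" and [measurable]: "A \<in> sets borel"
  shows "emeasure (planar_gauss h) A = (\<integral>\<^sup>+y. \<integral>\<^sup>+x. indicator A (x, y) \<partial>linear_gauss h \<partial>linear_gauss h)"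
proof (cases "h = 0")
  case True
  have [measurable]: "(\<lambda>x. (x, 0)) \<in> borel \<rightarrow>\<^sub>M (borel :: (real \<times> real) measure)"
    by (intro borel_measurable_continuous_onI continuous_intros)
  have "(\<integral>\<^sup>+y. \<integral>\<^sup>+x. indicator A (x, y) \<partial>return borel (0::real) \<partial>return borel (0::real))
    = (\<integral>\<^sup>+y. indicator A (0, y) \<partial>return borel (0::real))"
  proof (intro nn_integral_cong nn_integral_return)
    fix y :: real
    have [measurable]: "(\<lambda>x. (x, y)) \<in> borel \<rightarrow>\<^sub>M (borel :: (real \<times> real) measure)"
      by (intro borel_measurable_continuous_onI continuous_intros)
    show "(\<lambda>x. indicator A (x, y) :: ennreal) \<in> borel_measurable borel" by measurable
  qed simp
  also have "\<dots> = indicator A (0, 0)"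
  proof (intro nn_integral_return)
    have [measurable]: "(\<lambda>y. (0, y)) \<in> borel \<rightarrow>\<^sub>M (borel :: (real \<times> real) measure)"
      by (intro borel_measurable_continuous_onI continuous_intros)
    show "(\<lambda>y. indicator A (0, y) :: ennreal) \<in> borel_measurable borel" by measurable
  qed simp
  finally show ?thesis using True by (simp add: planar_gauss_def linear_gauss_def zero_prod_def)
next
  case False
  then have h: "h > 0" using assms by simp
  interpret L: prob_space "linear_gauss h" using assms(1) by (rule prob_space_linear_gauss)
  interpret LL: pair_prob_space "linear_gauss h" "linear_gauss h" ..
  have eq: "planar_gauss h = linear_gauss h \<Otimes>\<^sub>M linear_gauss h"
    using planar_gauss_eq_pair[OF h] h by (simp add: linear_gauss_def)
  have "A \<in> sets (linear_gauss h \<Otimes>\<^sub>M linear_gauss h)" using sets_planar_gauss[of h] unfolding eq by simp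
  then have "(\<integral>\<^sup>+z. indicator A z \<partial>(linear_gauss h \<Otimes>\<^sub>M linear_gauss h))
     = (\<integral>\<^sup>+y. \<integral>\<^sup>+x. indicator A (x, y) \<partial>linear_gauss h \<partial>linear_gauss h)"
    by (intro LL.nn_integral_snd[symmetric]) simp
  then show ?thesis unfolding eq[symmetric] by simp
qed

context standard_brownian_motion
begin

lemma distr_increments:
  fixes \<tau> :: "nat \<Rightarrow> real"
  assumes "0 \<le> \<tau> 0" "\<And>i. i < n \<Longrightarrow> \<tau> i \<le> \<tau> (Suc i)"
  shows "distr M (PiM {..<n} (\<lambda>i. linear_gauss (\<tau> (Suc i) - \<tau> i))) (\<lambda>\<omega>. \<lambda>i\<in>{..<n}. B (\<tau> (Suc i)) \<omega> - B (\<tau> i) \<omega>)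
    = PiM {..<n} (\<lambda>i. linear_gauss (\<tau> (Suc i) - \<tau> i))"
proof (cases "n = 0")
  \<comment> \<open>The characterisation of independence by a product law needs a nonempty index
    set. With no coordinates at all, both sides are probability measures on a one-point
    space.\<close>
  case True
  have "distr M (PiM {} (\<lambda>i. linear_gauss (\<tau> (Suc i) - \<tau> i))) (\<lambda>\<omega> i. undefined) = PiM {} (\<lambda>i. linear_gauss (\<tau> (Suc i) - \<tau> i))"
    (is "?D = ?P")
  proof (rule measure_eqI)
    fix A assume "A \<in> sets ?D"
    then have A: "A \<in> sets ?P" by simp
    have m: "(\<lambda>\<omega> i. undefined) \<in> M \<rightarrow>\<^sub>M ?P" by (rule measurableI) (auto simp: space_PiM PiM_empty)
    interpret D: prob_space ?D by (rule prob_space_distr[OF m])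
    interpret P: prob_space ?P by (rule prob_space_PiM) simp
    have "A = {} \<or> A = space ?P"
      using A subset_singletonD[of A "\<lambda>_. undefined"] by (simp add: PiM_empty)
    then show "emeasure ?D A = emeasure ?P A"
      using D.emeasure_space_1 P.emeasure_space_1 by (elim disjE) (simp_all only: emeasure_empty space_distr)
  qed simp
  then show ?thesis using True by (simp add: restrict_def)
next
  case False
  \<comment> \<open>Constant beyond n, since the independence hypothesis asks for a time sequence
    that is monotone on all naturals.\<close>
  define \<sigma> where "\<sigma> i = \<tau> (min i n)" for i
  have \<sigma>: "\<sigma> i = \<tau> i" if "i \<le> n" for i using that by (simp add: \<sigma>_def)
  have "\<sigma> i \<le> \<sigma> (Suc i)" for i
    using assms(2)[of i] by (cases "i < n") (auto simp: \<sigma>_def min_def not_less le_Suc_eq)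
  then have mono: "mono \<sigma>" by (rule incseq_SucI)
  have nonneg: "0 \<le> \<sigma> i" for i using monoD[OF mono, of 0 i] assms(1) by (simp add: \<sigma>_def)
  have le: "\<sigma> i \<le> \<sigma> (Suc i)" for i using monoD[OF mono, of i "Suc i"] by simp
  let ?X = "\<lambda>i \<omega>. B (\<sigma> (Suc i)) \<omega> - B (\<sigma> i) \<omega>"
  have rv: "?X i \<in> borel_measurable M" for i
    using random_variable[OF nonneg] by simp
  have marg: "distr M borel (?X i) = linear_gauss (\<sigma> (Suc i) - \<sigma> i)" for i
  proof (cases "\<sigma> i = \<sigma> (Suc i)")
    case True
    have "distr M borel (\<lambda>_. 0) = return borel (0::real)" by (rule distr_const) simp
    then show ?thesis using True by (simp add: linear_gauss_def)
  next
    case False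
    then have "\<sigma> i < \<sigma> (Suc i)" using le[of i] by simp
    then have "distributed M lborel (?X i) (normal_density 0 (sqrt (\<sigma> (Suc i) - \<sigma> i)))"
      using normal_increments nonneg by blast
    then have "distr M lborel (?X i) = density lborel (normal_density 0 (sqrt (\<sigma> (Suc i) - \<sigma> i)))"
      by (rule distributed_distr_eq_density)
    moreover have "distr M lborel (?X i) = distr M borel (?X i)" by (rule distr_cong) simp_all
    ultimately show ?thesis using False by (simp add: linear_gauss_def)
  qed
  have "indep_vars (\<lambda>_. borel) ?X {..<n}" using indep_increments[of \<sigma> n] mono nonneg by simp
  then have "distr M (PiM {..<n} (\<lambda>_. borel)) (\<lambda>\<omega>. \<lambda>i\<in>{..<n}. ?X i \<omega>) = PiM {..<n} (\<lambda>i. distr M borel (?X i))"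
    using False rv by (subst (asm) indep_vars_iff_distr_eq_PiM') auto
  also have "PiM {..<n} (\<lambda>i. distr M borel (?X i)) = PiM {..<n} (\<lambda>i. linear_gauss (\<tau> (Suc i) - \<tau> i))"
    unfolding marg by (intro PiM_cong) (auto simp: \<sigma>)
  also have "distr M (PiM {..<n} (\<lambda>_. borel)) (\<lambda>\<omega>. \<lambda>i\<in>{..<n}. ?X i \<omega>)
     = distr M (PiM {..<n} (\<lambda>i. linear_gauss (\<tau> (Suc i) - \<tau> i))) (\<lambda>\<omega>. \<lambda>i\<in>{..<n}. B (\<tau> (Suc i)) \<omega> - B (\<tau> i) \<omega>)"
    by (intro distr_cong sets_PiM_cong restrict_ext) (auto simp: \<sigma>)
  finally show ?thesis .
qed

end

locale planar_brownian_motion = B1: standard_brownian_motion M B1 + B2: standard_brownian_motion M B2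
  for M :: "'a measure" and B1 B2 +
  assumes indep: "independent_processes M B1 B2"
begin

definition B :: "real \<Rightarrow> 'a \<Rightarrow> real \<times> real" where
  "B t \<omega> = (B1 t \<omega>, B2 t \<omega>)"

lemma measurable_B: "t \<ge> 0 \<Longrightarrow> B t \<in> borel_measurable M"
  unfolding B_def using B1.random_variable[of t] B2.random_variable[of t] by (intro borel_measurable_Pair) auto

lemma continuous_B: "\<omega> \<in> space M \<Longrightarrow> continuous_on {0..} (\<lambda>t. B t \<omega>)"
  unfolding B_def using B1.continuous_paths[of \<omega>] B2.continuous_paths[of \<omega>] by (intro continuous_on_Pair)

lemma B_start: "AE \<omega> in M. B 0 \<omega> = 0"
  using B1.start B2.start by eventually_elim (simp add: B_def zero_prod_def)

text \<open>Independence is given for whole paths. Applying the map \<open>F\<close> to both paths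
  yields two independent vectors of independent Gaussian increments, and these 2n coordinates are
  regrouped into n planar increments.\<close>

lemma emeasure_increments:
  fixes \<tau> :: "nat \<Rightarrow> real"
  assumes \<tau>: "0 \<le> \<tau> 0" "\<And>i. i < n \<Longrightarrow> \<tau> i \<le> \<tau> (Suc i)" and A: "\<And>i. i < n \<Longrightarrow> A i \<in> sets borel"
  shows "emeasure M {\<omega>\<in>space M. \<forall>i<n. B (\<tau> (Suc i)) \<omega> - B (\<tau> i) \<omega> \<in> A i}
    = (\<Prod>i<n. emeasure (planar_gauss (\<tau> (Suc i) - \<tau> i)) (A i))"
proof -
  define h where "h i = (if i < n then \<tau> (Suc i) - \<tau> i else 0)" for i
  have h0: "h i \<ge> 0" for i using \<tau> by (simp add: h_def)
  let ?P = "PiM {..<n} (\<lambda>i. linear_gauss (h i))"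
  have P: "?P = PiM {..<n} (\<lambda>i. linear_gauss (\<tau> (Suc i) - \<tau> i))" by (intro PiM_cong) (auto simp: h_def)
  have setsP: "sets ?P = sets (PiM {..<n} (\<lambda>_. borel))" by (intro sets_PiM_cong) auto
  define F where "F x = (\<lambda>i\<in>{..<n}. x (\<tau> (Suc i)) - x (\<tau> i))" for x :: "real \<Rightarrow> real"
  have pos: "0 \<le> \<tau> i" if "i \<le> n" for i
    using grid_mono[of n \<tau> 0 i, OF \<tau>(2)] that \<tau>(1) by simp
  have F: "F \<in> path_space \<rightarrow>\<^sub>M ?P"
    unfolding measurable_cong_sets[OF refl setsP] F_def path_space_def
  proof (rule measurable_restrict)
    fix i assume "i \<in> {..<n}"
    then have "(\<lambda>x. x (\<tau> (Suc i))) \<in> PiM {0..} (\<lambda>_. borel) \<rightarrow>\<^sub>M (borel :: real measure)"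
       "(\<lambda>x. x (\<tau> i)) \<in> PiM {0..} (\<lambda>_. borel) \<rightarrow>\<^sub>M (borel :: real measure)"
      using pos by (auto intro!: measurable_component_singleton)
    then show "(\<lambda>x. x (\<tau> (Suc i)) - x (\<tau> i) :: real) \<in> borel_measurable (PiM {0..} (\<lambda>_. borel))"
      by (rule borel_measurable_diff)
  qed
  define D1 where "D1 \<omega> = F (path B1 \<omega>)" for \<omega>
  define D2 where "D2 \<omega> = F (path B2 \<omega>)" for \<omega>
  have D1: "D1 = (\<lambda>\<omega>. \<lambda>i\<in>{..<n}. B1 (\<tau> (Suc i)) \<omega> - B1 (\<tau> i) \<omega>)"
    and D2: "D2 = (\<lambda>\<omega>. \<lambda>i\<in>{..<n}. B2 (\<tau> (Suc i)) \<omega> - B2 (\<tau> i) \<omega>)"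
    using pos by (auto simp: D1_def D2_def F_def path_def intro!: ext restrict_ext)
  have ind: "B1.indep_var ?P D1 ?P D2"
    using B1.indep_var_compose[OF indep[unfolded independent_processes_def] F F]
    unfolding D1_def D2_def comp_def .
  have distr: "distr M ?P D1 = ?P" "distr M ?P D2 = ?P"
    using B1.distr_increments[OF \<tau>] B2.distr_increments[OF \<tau>] unfolding P D1 D2 by auto
  have joint: "distr M (?P \<Otimes>\<^sub>M ?P) (\<lambda>\<omega>. (D1 \<omega>, D2 \<omega>)) = ?P \<Otimes>\<^sub>M ?P"
    and D1m: "D1 \<in> M \<rightarrow>\<^sub>M ?P" and D2m: "D2 \<in> M \<rightarrow>\<^sub>M ?P"
    using ind unfolding B1.indep_var_distribution_eq by (auto simp: distr)
  interpret product_prob_space "\<lambda>i. linear_gauss (h i)" UNIV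
    using h0 by (intro product_prob_spaceI prob_space_linear_gauss)
  interpret PX: prob_space ?P by (intro prob_space_PiM prob_space_linear_gauss h0)
  interpret PP: pair_prob_space ?P ?P ..
  have comp: "(\<lambda>x. x i) \<in> borel_measurable ?P" if "i < n" for i
    using that measurable_component_singleton[of i "{..<n}" "\<lambda>i. linear_gauss (h i)"]
    by (simp add: measurable_cong_sets[OF refl sets_linear_gauss])
  define f where "f i z = (indicator (A i) z :: ennreal)" for i z
  have f: "f i \<in> borel_measurable borel" if "i < n" for i using A[OF that] unfolding f_def by measurable
  have fz: "(\<lambda>z. f i (fst z i, snd z i)) \<in> borel_measurable (?P \<Otimes>\<^sub>M ?P)" if "i < n" for i
    using measurable_compose[OF measurable_fst comp[OF that]] measurable_compose[OF measurable_snd comp[OF that]]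
    by (intro measurable_compose[OF _ f[OF that]] borel_measurable_Pair)
  have m: "(\<lambda>z. \<Prod>i<n. f i (fst z i, snd z i)) \<in> borel_measurable (?P \<Otimes>\<^sub>M ?P)"
    using fz by (intro borel_measurable_prod_ennreal) auto
  have fxy: "(\<lambda>(x, y). f i (x, y)) \<in> borel_measurable (linear_gauss (h i) \<Otimes>\<^sub>M linear_gauss (h i))" if "i < n" for i
  proof -
    have "sets (linear_gauss (h i) \<Otimes>\<^sub>M linear_gauss (h i)) = sets (borel :: (real \<times> real) measure)"
      unfolding borel_prod[symmetric] by (intro sets_pair_measure_cong) auto
    then show ?thesis unfolding case_prod_eta using f[OF that] by (subst measurable_cong_sets[OF _ refl])
  qed
  have "emeasure M {\<omega>\<in>space M. \<forall>i<n. B (\<tau> (Suc i)) \<omega> - B (\<tau> i) \<omega> \<in> A i}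
     = (\<integral>\<^sup>+\<omega>. indicator {\<omega>\<in>space M. \<forall>i<n. B (\<tau> (Suc i)) \<omega> - B (\<tau> i) \<omega> \<in> A i} \<omega> \<partial>M)"
    using pos A by (intro nn_integral_indicator[symmetric] sets_Collect_all_less borel_measurable_diff measurable_B) auto
  also have "\<dots> = (\<integral>\<^sup>+\<omega>. (\<Prod>i<n. f i (D1 \<omega> i, D2 \<omega> i)) \<partial>M)"
  proof (rule nn_integral_cong)
    fix \<omega> assume "\<omega> \<in> space M"
    have "(\<Prod>i<n. f i (D1 \<omega> i, D2 \<omega> i)) = (\<Prod>i<n. indicator (A i) (B (\<tau> (Suc i)) \<omega> - B (\<tau> i) \<omega>))"
      by (intro prod.cong) (auto simp: f_def D1 D2 B_def)
    also have "\<dots> = indicator {\<omega>\<in>space M. \<forall>i<n. B (\<tau> (Suc i)) \<omega> - B (\<tau> i) \<omega> \<in> A i} \<omega>"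
    proof (cases "\<forall>i<n. B (\<tau> (Suc i)) \<omega> - B (\<tau> i) \<omega> \<in> A i")
      case True
      then have "(\<Prod>i<n. indicator (A i) (B (\<tau> (Suc i)) \<omega> - B (\<tau> i) \<omega>) :: ennreal) = 1"
        by (intro prod.neutral) auto
      then show ?thesis using True \<open>\<omega> \<in> space M\<close> by (auto simp: indicator_def)
    next
      case False
      then obtain i where "i < n" "B (\<tau> (Suc i)) \<omega> - B (\<tau> i) \<omega> \<notin> A i" by auto
      then have "(\<Prod>i<n. indicator (A i) (B (\<tau> (Suc i)) \<omega> - B (\<tau> i) \<omega>) :: ennreal) = 0"
        by (intro prod_zero) (auto intro!: bexI[of _ i])
      then show ?thesis using False by (auto simp: indicator_def)
    qed
    finally show "indicator {\<omega>\<in>space M. \<forall>i<n. B (\<tau> (Suc i)) \<omega> - B (\<tau> i) \<omega> \<in> A i} \<omega> = (\<Prod>i<n. f i (D1 \<omega> i, D2 \<omega> i))"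
      by simp
  qed
  also have "\<dots> = (\<integral>\<^sup>+z. (\<Prod>i<n. f i (fst z i, snd z i)) \<partial>distr M (?P \<Otimes>\<^sub>M ?P) (\<lambda>\<omega>. (D1 \<omega>, D2 \<omega>)))"
    using m D1m D2m by (subst nn_integral_distr) simp_all
  also have "\<dots> = (\<integral>\<^sup>+z. (\<Prod>i<n. f i (fst z i, snd z i)) \<partial>(?P \<Otimes>\<^sub>M ?P))" by (simp only: joint)
  also have "\<dots> = (\<integral>\<^sup>+y. \<integral>\<^sup>+x. (\<Prod>i<n. f i (x i, y i)) \<partial>?P \<partial>?P)"
    using m by (subst PP.nn_integral_snd[symmetric]) (simp_all add: case_prod_beta')
  \<comment> \<open>For fixed y the integrand is a product of functions of separate coordinates of
    x, so the inner integral factorises; the outer one then factorises in y for the same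
    reason.\<close>
  also have "\<dots> = (\<integral>\<^sup>+y. (\<Prod>i<n. \<integral>\<^sup>+x. f i (x, y i) \<partial>linear_gauss (h i)) \<partial>?P)"
  proof (rule nn_integral_cong, rule product_nn_integral_prod)
    fix y i assume "i \<in> {..<n}"
    then have i: "i < n" by simp
    have "(\<lambda>x. (x, y i)) \<in> borel \<rightarrow>\<^sub>M (borel :: (real \<times> real) measure)"
      by (intro borel_measurable_continuous_onI continuous_intros)
    from measurable_compose[OF this f[OF i]]
    show "(\<lambda>x. f i (x, y i)) \<in> borel_measurable (linear_gauss (h i))"
      by (simp add: measurable_cong_sets[OF sets_linear_gauss refl])
  qed simp
  also have "\<dots> = (\<Prod>i<n. \<integral>\<^sup>+y. \<integral>\<^sup>+x. f i (x, y) \<partial>linear_gauss (h i) \<partial>linear_gauss (h i))"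
  proof (rule product_nn_integral_prod)
    fix i assume "i \<in> {..<n}"
    then have i: "i < n" by simp
    show "(\<lambda>y. \<integral>\<^sup>+x. f i (x, y) \<partial>linear_gauss (h i)) \<in> borel_measurable (linear_gauss (h i))"
      by (rule sigma_finite_measure.borel_measurable_nn_integral[OF prob_space_imp_sigma_finite[OF prob_space_linear_gauss[OF h0]]]) (use measurable_pair_swap[OF fxy[OF i]] in \<open>simp add: case_prod_beta'\<close>)
  qed simp
  also have "\<dots> = (\<Prod>i<n. emeasure (planar_gauss (\<tau> (Suc i) - \<tau> i)) (A i))"
  proof (rule prod.cong)
    fix i assume "i \<in> {..<n}"
    then have i: "i < n" by simp
    then show "(\<integral>\<^sup>+y. \<integral>\<^sup>+x. f i (x, y) \<partial>linear_gauss (h i) \<partial>linear_gauss (h i))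
       = emeasure (planar_gauss (\<tau> (Suc i) - \<tau> i)) (A i)"
      using emeasure_planar_gauss_eq[OF h0[of i] A[OF i]] by (simp add: f_def h_def)
  qed simp
  finally show ?thesis .
qed

lemma wiener_B: "0 \<le> T \<Longrightarrow> wiener M T B"
  unfolding wiener_def
  using emeasure_increments B_start measurable_B B1.prob_space_axioms by (intro conjI allI impI ballI) auto

end

section \<open>Time reversal at time one\<close>

context planar_brownian_motion
begin

text \<open>The scale is forced by balance: a motion that has to reach distance of order u by time 1
  drifts by 1/u during a time of order u^(-2), the same order as its fluctuations.\<close>

definition reversed :: "real \<Rightarrow> real \<Rightarrow> 'a \<Rightarrow> real \<times> real" where
  "reversed u t \<omega> = u *\<^sub>R (B 1 \<omega> - B (1 - t / u\<^sup>2) \<omega>)"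

lemma measurable_reversed: "u > 0 \<Longrightarrow> t \<le> u\<^sup>2 \<Longrightarrow> reversed u t \<in> borel_measurable M"
  unfolding reversed_def by (intro borel_measurable_scaleR borel_measurable_diff measurable_B) auto

lemma all_less_rev: "(\<forall>j<n. P (n - Suc j)) \<longleftrightarrow> (\<forall>i<n. P i)" for n :: nat
proof
  assume *: "\<forall>j<n. P (n - Suc j)"
  show "\<forall>i<n. P i"
  proof (intro allI impI)
    fix i assume "i < n"
    then show "P i" using *[rule_format, of "n - Suc i"] by simp
  qed
qed simp

text \<open>Reading the grid backwards from time 1 leaves one initial stretch, from 0 to 1 - S/u^2,
  which carries the event E and is independent of everything later.\<close>

lemma emeasure_reversed_increments:
  fixes \<tau> :: "nat \<Rightarrow> real"
  assumes u: "u > 0" "0 \<le> S" "S \<le> u\<^sup>2" and E: "E \<in> sets borel"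
    and \<tau>: "\<tau> 0 = 0" "\<tau> n = S" "\<And>i. i < n \<Longrightarrow> \<tau> i \<le> \<tau> (Suc i)" and A: "\<And>i. i < n \<Longrightarrow> A i \<in> sets borel"
  shows "emeasure M ({\<omega>\<in>space M. B (1 - S / u\<^sup>2) \<omega> \<in> E} \<inter>
       {\<omega>\<in>space M. \<forall>i<n. reversed u (\<tau> (Suc i)) \<omega> - reversed u (\<tau> i) \<omega> \<in> A i})
    = emeasure (planar_gauss (1 - S / u\<^sup>2)) E * (\<Prod>i<n. emeasure (planar_gauss (\<tau> (Suc i) - \<tau> i)) (A i))"
proof -
  \<comment> \<open>Forward step 0 is the initial stretch; forward step j + 1 is the reversed step n
    - 1 - j, hence \<open>n - Suc j\<close> in \<open>A'\<close>.\<close>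
  define \<sigma> where "\<sigma> j = (case j of 0 \<Rightarrow> 0 | Suc j \<Rightarrow> 1 - \<tau> (n - j) / u\<^sup>2)" for j
  define A' where "A' j = (case j of 0 \<Rightarrow> E | Suc j \<Rightarrow> {x. u *\<^sub>R x \<in> A (n - Suc j)})" for j
  have \<sigma>0: "\<sigma> 0 = 0" and \<sigma>S: "\<sigma> (Suc j) = 1 - \<tau> (n - j) / u\<^sup>2" for j by (simp_all add: \<sigma>_def)
  have range: "0 \<le> \<tau> i \<and> \<tau> i \<le> S" if "i \<le> n" for i
    using grid_mono[of n \<tau> 0 i, OF \<tau>(3)] grid_mono[of n \<tau> i n, OF \<tau>(3)] that \<tau>(1,2) by simp
  have S1: "S / u\<^sup>2 \<le> 1" using u by (simp add: divide_le_eq)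
  have mono: "\<sigma> i \<le> \<sigma> (Suc i)" if "i < Suc n" for i
  proof (cases i)
    case 0
    then show ?thesis using S1 \<tau> by (simp add: \<sigma>_def)
  next
    case (Suc j)
    with that have "j < n" by simp
    then have "Suc (n - Suc j) = n - j" by simp
    then have "\<tau> (n - Suc j) \<le> \<tau> (n - j)" using \<tau>(3)[of "n - Suc j"] \<open>j < n\<close> by simp
    then show ?thesis using u unfolding Suc \<sigma>S by (simp add: divide_right_mono)
  qed
  have A': "A' i \<in> sets borel" if "i < Suc n" for i
  proof (cases i)
    case 0
    then show ?thesis using E by (simp add: A'_def)
  next
    case (Suc j)
    have [measurable]: "A (n - Suc j) \<in> sets borel" using A[of "n - Suc j"] that Suc by simp
    have "{x. u *\<^sub>R x \<in> A (n - Suc j)} \<in> sets borel" by measurable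
    then show ?thesis by (simp add: A'_def Suc)
  qed
  have rev: "reversed u (\<tau> (Suc i)) \<omega> - reversed u (\<tau> i) \<omega> = u *\<^sub>R (B (1 - \<tau> i / u\<^sup>2) \<omega> - B (1 - \<tau> (Suc i) / u\<^sup>2) \<omega>)" for i \<omega>
    by (simp add: reversed_def scaleR_diff_right)
  have step: "(B (\<sigma> (Suc (Suc j))) \<omega> - B (\<sigma> (Suc j)) \<omega> \<in> A' (Suc j)) \<longleftrightarrow>
     reversed u (\<tau> (Suc (n - Suc j))) \<omega> - reversed u (\<tau> (n - Suc j)) \<omega> \<in> A (n - Suc j)" if "j < n" for j \<omega>
  proof -
    have "Suc (n - Suc j) = n - j" using that by simp
    then show ?thesis unfolding rev \<sigma>S by (simp add: A'_def)
  qed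
  let ?R = "{\<omega>\<in>space M. \<forall>i<n. reversed u (\<tau> (Suc i)) \<omega> - reversed u (\<tau> i) \<omega> \<in> A i}"
  have iff: "(\<forall>i<Suc n. B (\<sigma> (Suc i)) \<omega> - B (\<sigma> i) \<omega> \<in> A' i) \<longleftrightarrow>
     B (1 - S / u\<^sup>2) \<omega> - B 0 \<omega> \<in> E \<and> (\<forall>i<n. reversed u (\<tau> (Suc i)) \<omega> - reversed u (\<tau> i) \<omega> \<in> A i)" for \<omega>
  proof -
    have "(\<forall>i<Suc n. B (\<sigma> (Suc i)) \<omega> - B (\<sigma> i) \<omega> \<in> A' i) \<longleftrightarrow>
       B (\<sigma> (Suc 0)) \<omega> - B (\<sigma> 0) \<omega> \<in> A' 0 \<and> (\<forall>j<n. B (\<sigma> (Suc (Suc j))) \<omega> - B (\<sigma> (Suc j)) \<omega> \<in> A' (Suc j))"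
      by (rule All_less_Suc2)
    also have "(\<forall>j<n. B (\<sigma> (Suc (Suc j))) \<omega> - B (\<sigma> (Suc j)) \<omega> \<in> A' (Suc j)) \<longleftrightarrow>
       (\<forall>j<n. reversed u (\<tau> (Suc (n - Suc j))) \<omega> - reversed u (\<tau> (n - Suc j)) \<omega> \<in> A (n - Suc j))"
      using step by (simp only: cong: conj_cong imp_cong)
    also have "\<dots> \<longleftrightarrow> (\<forall>i<n. reversed u (\<tau> (Suc i)) \<omega> - reversed u (\<tau> i) \<omega> \<in> A i)"
      by (rule all_less_rev)
    also have "B (\<sigma> (Suc 0)) \<omega> - B (\<sigma> 0) \<omega> \<in> A' 0 \<longleftrightarrow> B (1 - S / u\<^sup>2) \<omega> - B 0 \<omega> \<in> E"
      using \<tau>(2) by (simp add: \<sigma>S \<sigma>0 A'_def)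
    finally show ?thesis .
  qed
  have R: "?R \<in> sets M"
  proof (intro sets_Collect_all_less borel_measurable_diff A)
    fix i assume i: "i < n"
    then have "\<tau> (Suc i) \<le> u\<^sup>2" "\<tau> i \<le> u\<^sup>2" using range[of i] range[of "Suc i"] u by auto
    then show "reversed u (\<tau> (Suc i)) \<in> borel_measurable M" "reversed u (\<tau> i) \<in> borel_measurable M"
      using u by (auto intro: measurable_reversed)
  qed
  have [measurable]: "B (1 - S / u\<^sup>2) \<in> borel_measurable M" "B 0 \<in> borel_measurable M"
    using S1 by (auto intro: measurable_B)
  note E[measurable]
  have "emeasure M ({\<omega>\<in>space M. B (1 - S / u\<^sup>2) \<omega> \<in> E} \<inter> ?R)
    = emeasure M ({\<omega>\<in>space M. B (1 - S / u\<^sup>2) \<omega> - B 0 \<omega> \<in> E} \<inter> ?R)"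
  proof (rule emeasure_eq_AE)
    show "AE \<omega> in M. \<omega> \<in> {\<omega>\<in>space M. B (1 - S / u\<^sup>2) \<omega> \<in> E} \<inter> ?R \<longleftrightarrow> \<omega> \<in> {\<omega>\<in>space M. B (1 - S / u\<^sup>2) \<omega> - B 0 \<omega> \<in> E} \<inter> ?R"
      using B_start
    proof eventually_elim
      case (elim \<omega>)
      then show ?case by (simp only: mem_Collect_eq Int_iff diff_zero)
    qed
  qed (intro sets.Int R; measurable)+
  also have "{\<omega>\<in>space M. B (1 - S / u\<^sup>2) \<omega> - B 0 \<omega> \<in> E} \<inter> ?R
     = {\<omega>\<in>space M. \<forall>i<Suc n. B (\<sigma> (Suc i)) \<omega> - B (\<sigma> i) \<omega> \<in> A' i}"
    unfolding iff by blast
  also have "emeasure M \<dots> = (\<Prod>i<Suc n. emeasure (planar_gauss (\<sigma> (Suc i) - \<sigma> i)) (A' i))"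
    using \<sigma>0 mono A' by (intro emeasure_increments) auto
  also have "\<dots> = emeasure (planar_gauss (\<sigma> (Suc 0) - \<sigma> 0)) (A' 0) *
     (\<Prod>j<n. emeasure (planar_gauss (\<sigma> (Suc (Suc j)) - \<sigma> (Suc j))) (A' (Suc j)))"
    by (rule prod.lessThan_Suc_shift)
  also have "emeasure (planar_gauss (\<sigma> (Suc 0) - \<sigma> 0)) (A' 0) = emeasure (planar_gauss (1 - S / u\<^sup>2)) E"
    using \<tau>(2) by (simp add: \<sigma>S \<sigma>0 A'_def)
  also have "(\<Prod>j<n. emeasure (planar_gauss (\<sigma> (Suc (Suc j)) - \<sigma> (Suc j))) (A' (Suc j)))
     = (\<Prod>j<n. emeasure (planar_gauss (\<tau> (Suc (n - Suc j)) - \<tau> (n - Suc j))) (A (n - Suc j)))"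
  proof (rule prod.cong)
    fix j assume "j \<in> {..<n}"
    then have j: "j < n" "Suc (n - Suc j) = n - j" by auto
    have "\<sigma> (Suc (Suc j)) - \<sigma> (Suc j) = (\<tau> (Suc (n - Suc j)) - \<tau> (n - Suc j)) / u\<^sup>2"
      unfolding j(2) by (simp add: \<sigma>S diff_divide_distrib)
    moreover have "0 \<le> \<tau> (Suc (n - Suc j)) - \<tau> (n - Suc j)" using \<tau>(3)[of "n - Suc j"] j(1) by simp
    ultimately show "emeasure (planar_gauss (\<sigma> (Suc (Suc j)) - \<sigma> (Suc j))) (A' (Suc j))
       = emeasure (planar_gauss (\<tau> (Suc (n - Suc j)) - \<tau> (n - Suc j))) (A (n - Suc j))"
      using emeasure_planar_gauss_scale[OF _ u(1) A[of "n - Suc j"]] j(1) by (simp add: A'_def)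
  qed simp
  also have "\<dots> = (\<Prod>i<n. emeasure (planar_gauss (\<tau> (Suc i) - \<tau> i)) (A i))"
    by (rule prod.nat_diff_reindex)
  finally show ?thesis .
qed

lemma emeasure_B:
  assumes "0 \<le> S" "S \<le> 1" "E \<in> sets borel"
  shows "emeasure M {\<omega>\<in>space M. B (1 - S) \<omega> \<in> E} = emeasure (planar_gauss (1 - S)) E"
proof -
  interpret G: prob_space "planar_gauss S" using assms by (intro prob_space_planar_gauss)
  show ?thesis
    using emeasure_reversed_increments[of 1 S E "\<lambda>i. if i = 0 then 0 else S" 1 "\<lambda>_. UNIV"] assms G.emeasure_space_1
    by (simp add: Int_absorb2)
qed

text \<open>Independence of the reversed path from the earlier position, in the form that suits
  \<open>wiener_unique\<close>: conditioning on any nonnull event for that position leaves a Wiener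
  path.\<close>

lemma wiener_reversed:
  assumes u: "u > 0" "0 \<le> S" "S \<le> u\<^sup>2" and E: "E \<in> sets borel"
    and nz: "emeasure M {\<omega>\<in>space M. B (1 - S / u\<^sup>2) \<omega> \<in> E} \<noteq> 0"
  shows "wiener (uniform_measure M {\<omega>\<in>space M. B (1 - S / u\<^sup>2) \<omega> \<in> E}) S (reversed u)"
proof -
  let ?Q = "{\<omega>\<in>space M. B (1 - S / u\<^sup>2) \<omega> \<in> E}"
  have S1: "0 \<le> S / u\<^sup>2" "S / u\<^sup>2 \<le> 1" using u by (auto simp: divide_le_eq)
  note E[measurable]
  have [measurable]: "B (1 - S / u\<^sup>2) \<in> borel_measurable M" using S1 by (auto intro: measurable_B)
  have Q: "?Q \<in> sets M" by measurable
  show ?thesis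
    unfolding wiener_def
  proof (intro conjI allI impI ballI)
    show "prob_space (uniform_measure M ?Q)" using nz by (intro prob_space_uniform_measure) auto
    show "0 \<le> S" by fact
    show "reversed u t \<in> borel_measurable (uniform_measure M ?Q)" if "t \<in> {0..S}" for t
      using measurable_reversed[of u t] u that by simp
    show "AE \<omega> in uniform_measure M ?Q. reversed u 0 \<omega> = 0"
      using Q by (intro AE_uniform_measureI) (auto simp: reversed_def)
    fix n and \<tau> :: "nat \<Rightarrow> real" and A :: "nat \<Rightarrow> (real \<times> real) set"
    assume \<tau>: "\<tau> 0 = 0" "\<tau> n = S" "\<forall>i<n. \<tau> i \<le> \<tau> (Suc i)" and A: "\<forall>i<n. A i \<in> sets borel"
    have range: "0 \<le> \<tau> i \<and> \<tau> i \<le> S" if "i \<le> n" for i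
      using grid_mono[of n \<tau> 0 i, OF \<tau>(3)[rule_format]] grid_mono[of n \<tau> i n, OF \<tau>(3)[rule_format]] that \<tau>(1,2) by simp
    let ?R = "{\<omega>\<in>space M. \<forall>i<n. reversed u (\<tau> (Suc i)) \<omega> - reversed u (\<tau> i) \<omega> \<in> A i}"
    have R: "?R \<in> sets M"
    proof (intro sets_Collect_all_less borel_measurable_diff A[rule_format])
      fix i assume i: "i < n"
      then have "\<tau> (Suc i) \<le> u\<^sup>2" "\<tau> i \<le> u\<^sup>2" using range[of i] range[of "Suc i"] u by auto
      then show "reversed u (\<tau> (Suc i)) \<in> borel_measurable M" "reversed u (\<tau> i) \<in> borel_measurable M"
        using u by (auto intro: measurable_reversed)
    qed
    have "emeasure (uniform_measure M ?Q) ?R = emeasure M (?Q \<inter> ?R) / emeasure M ?Q"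
      by (rule emeasure_uniform_measure[OF Q R])
    also have "emeasure M (?Q \<inter> ?R) = emeasure M ?Q * (\<Prod>i<n. emeasure (planar_gauss (\<tau> (Suc i) - \<tau> i)) (A i))"
      using emeasure_reversed_increments[OF u E \<tau>(1,2) \<tau>(3)[rule_format] A[rule_format]] emeasure_B[OF S1 E]
      by (simp only:)
    also have "\<dots> / emeasure M ?Q = (\<Prod>i<n. emeasure (planar_gauss (\<tau> (Suc i) - \<tau> i)) (A i))"
    proof -
      have "emeasure M ?Q \<noteq> top" using B1.emeasure_finite[of ?Q] by simp
      then show ?thesis using nz by (subst mult.commute) (rule ennreal_mult_divide_eq)
    qed
    finally show "emeasure (uniform_measure M ?Q) {\<omega>\<in>space (uniform_measure M ?Q). \<forall>i<n. reversed u (\<tau> (Suc i)) \<omega> - reversed u (\<tau> i) \<omega> \<in> A i}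
      = (\<Prod>i<n. emeasure (planar_gauss (\<tau> (Suc i) - \<tau> i)) (A i))"
      by (simp only: space_uniform_measure)
  qed
qed

text \<open>Any Wiener path X may represent the reversed path here. The freedom in N and X is the
  purpose: it will be filled with the tilted motion.\<close>

lemma distr_B_reversed:
  assumes u: "u > 0" "0 \<le> S" "S \<le> u\<^sup>2" and W: "wiener N S X"
  shows "distr M (borel \<Otimes>\<^sub>M PiM {0..S} (\<lambda>_. borel)) (\<lambda>\<omega>. (B (1 - S / u\<^sup>2) \<omega>, path_upto S (reversed u) \<omega>))
    = planar_gauss (1 - S / u\<^sup>2) \<Otimes>\<^sub>M distr N (PiM {0..S} (\<lambda>_. borel)) (path_upto S X)"
proof (rule pair_measure_eqI[symmetric])
  let ?L = "distr N (PiM {0..S} (\<lambda>_. borel)) (path_upto S X)"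
  have S1: "0 \<le> S / u\<^sup>2" "S / u\<^sup>2 \<le> 1" using u by (auto simp: divide_le_eq)
  interpret G: prob_space "planar_gauss (1 - S / u\<^sup>2)" using S1 by (intro prob_space_planar_gauss) simp
  show "sigma_finite_measure (planar_gauss (1 - S / u\<^sup>2))" by unfold_locales
  interpret N: prob_space N using W by (rule wiener_prob_space)
  interpret L: prob_space ?L by (rule N.prob_space_distr[OF wiener_measurable_path[OF W]])
  show "sigma_finite_measure ?L" by unfold_locales
  show "sets (planar_gauss (1 - S / u\<^sup>2) \<Otimes>\<^sub>M ?L) = sets (distr M (borel \<Otimes>\<^sub>M PiM {0..S} (\<lambda>_. borel)) (\<lambda>\<omega>. (B (1 - S / u\<^sup>2) \<omega>, path_upto S (reversed u) \<omega>)))"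
    unfolding sets_distr by (intro sets_pair_measure_cong) auto
  have pathm: "path_upto S (reversed u) \<in> M \<rightarrow>\<^sub>M PiM {0..S} (\<lambda>_. borel)"
    using u by (intro measurable_path_upto measurable_reversed) auto
  have Bm: "B (1 - S / u\<^sup>2) \<in> borel_measurable M" using S1 by (auto intro: measurable_B)
  fix E F assume E': "E \<in> sets (planar_gauss (1 - S / u\<^sup>2))" and F': "F \<in> sets ?L"
  have E: "E \<in> sets borel" and F: "F \<in> sets (PiM {0..S} (\<lambda>_. borel))" using E' F' by simp_all
  let ?Q = "{\<omega>\<in>space M. B (1 - S / u\<^sup>2) \<omega> \<in> E}"
  let ?R = "path_upto S (reversed u) -` F \<inter> space M"
  note E[measurable] Bm[measurable]
  have Q: "?Q \<in> sets M" by measurable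
  have R: "?R \<in> sets M" by (rule measurable_sets[OF pathm F])
  have "emeasure (distr M (borel \<Otimes>\<^sub>M PiM {0..S} (\<lambda>_. borel)) (\<lambda>\<omega>. (B (1 - S / u\<^sup>2) \<omega>, path_upto S (reversed u) \<omega>))) (E \<times> F)
     = emeasure M ((\<lambda>\<omega>. (B (1 - S / u\<^sup>2) \<omega>, path_upto S (reversed u) \<omega>)) -` (E \<times> F) \<inter> space M)"
    using E F by (intro emeasure_distr measurable_Pair Bm pathm pair_measureI)
  also have "(\<lambda>\<omega>. (B (1 - S / u\<^sup>2) \<omega>, path_upto S (reversed u) \<omega>)) -` (E \<times> F) \<inter> space M = ?Q \<inter> ?R" by auto
  also have "emeasure M \<dots> = emeasure M ?Q * emeasure ?L F"
  proof (cases "emeasure M ?Q = 0")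
    case True
    have "emeasure M (?Q \<inter> ?R) \<le> emeasure M ?Q" by (rule emeasure_mono) (use Q in auto)
    then show ?thesis using True by simp
  next
    \<comment> \<open>Dividing by the probability of the position event turns the claim into
      equality of two path laws, one of them conditional.\<close>
    case False
    note WR = wiener_reversed[OF u E False]
    have "emeasure ?L F = emeasure (distr (uniform_measure M ?Q) (PiM {0..S} (\<lambda>_. borel)) (path_upto S (reversed u))) F"
      unfolding wiener_unique[OF W WR] ..
    also have "\<dots> = emeasure (uniform_measure M ?Q) ?R"
      using emeasure_distr[OF wiener_measurable_path[OF WR] F] by (simp only: space_uniform_measure)
    also have "\<dots> = emeasure M (?Q \<inter> ?R) / emeasure M ?Q" by (rule emeasure_uniform_measure[OF Q R])
    finally have "emeasure ?L F * emeasure M ?Q = emeasure M (?Q \<inter> ?R) / emeasure M ?Q * emeasure M ?Q" by simp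
    also have "\<dots> = emeasure M (?Q \<inter> ?R)"
      using ennreal_mult_divide_eq[of "emeasure M ?Q" 1] False unfolding ennreal_divide_times by simp
    finally show ?thesis by (simp add: mult.commute)
  qed
  finally show "emeasure (planar_gauss (1 - S / u\<^sup>2)) E * emeasure ?L F = emeasure (distr M (borel \<Otimes>\<^sub>M PiM {0..S} (\<lambda>_. borel)) (\<lambda>\<omega>. (B (1 - S / u\<^sup>2) \<omega>, path_upto S (reversed u) \<omega>))) (E \<times> F)"
    using emeasure_B[OF S1 E] by simp
qed

end

section \<open>Exact formula for an exit during the last 1/u of the time interval\<close>

lemma sets_Collect_bex_countable:
  assumes "countable D" "\<And>s. s \<in> D \<Longrightarrow> f s \<in> borel_measurable M" "K \<in> sets borel"
  shows "{z\<in>space M. \<exists>s\<in>D. f s z \<in> K} \<in> sets M"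
proof -
  have "{z\<in>space M. \<exists>s\<in>D. f s z \<in> K} = (\<Union>s\<in>D. f s -` K \<inter> space M)" by auto
  also have "\<dots> \<in> sets M"
    using assms by (intro sets.countable_UN'' measurable_sets)
  finally show ?thesis .
qed

text \<open>With u v = \<theta> the argument of the density is q \<theta> - d/u, where d = w - b. In
  the exponent, the terms in |\<theta>|^2 add up to one half because q + 1/u = 1, and the two linear
  terms combine to \<theta> . w / u, so that b is left only in the Gaussian factor.\<close>

lemma planar_density_shift:
  assumes q: "q = 1 - 1 / u" "u > 1" and v: "v = (1 / u) *\<^sub>R \<theta>"
  shows "exp (v \<bullet> b - (norm v)\<^sup>2 * u / 2) * planar_density q (\<theta> - (1 / u) *\<^sub>R (u *\<^sub>R v - b) + (- 1 / u) *\<^sub>R w)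
    = exp (- (norm \<theta>)\<^sup>2 / 2) / (2 * pi * q) * (exp (\<theta> \<bullet> w / u) * exp (- (norm (w - b))\<^sup>2 / (2 * u\<^sup>2 * q)))"
proof -
  have q0: "q > 0" using q by simp
  define d where "d = w - b"
  have uv: "u *\<^sub>R v = \<theta>" using v q by simp
  have arg: "\<theta> - (1 / u) *\<^sub>R (u *\<^sub>R v - b) + (- 1 / u) *\<^sub>R w = q *\<^sub>R \<theta> - (1 / u) *\<^sub>R d"
    unfolding uv by (simp add: q d_def algebra_simps)
  have vb: "v \<bullet> b = (\<theta> \<bullet> b) / u" using v by simp
  have vv: "(norm v)\<^sup>2 * u = (norm \<theta>)\<^sup>2 / u"
    using v q by (simp add: power_mult_distrib power_divide power2_eq_square)
  have n: "(norm (q *\<^sub>R \<theta> - (1 / u) *\<^sub>R d))\<^sup>2 = q\<^sup>2 * (norm \<theta>)\<^sup>2 - 2 * q * (\<theta> \<bullet> d) / u + (norm d)\<^sup>2 / u\<^sup>2"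
    using dot_norm_neg[of "q *\<^sub>R \<theta>" "(1 / u) *\<^sub>R d"] by (simp add: power_mult_distrib power_divide)
  have "- (norm (q *\<^sub>R \<theta> - (1 / u) *\<^sub>R d))\<^sup>2 / (2 * q) = - q * (norm \<theta>)\<^sup>2 / 2 + (\<theta> \<bullet> d) / u - (norm d)\<^sup>2 / (2 * u\<^sup>2 * q)"
    unfolding n using q0 by (simp add: diff_divide_distrib add_divide_distrib power2_eq_square)
  then have "v \<bullet> b - (norm v)\<^sup>2 * u / 2 + - (norm (q *\<^sub>R \<theta> - (1 / u) *\<^sub>R d))\<^sup>2 / (2 * q)
     = (\<theta> \<bullet> b) / u - (norm \<theta>)\<^sup>2 / u / 2 + (- q * (norm \<theta>)\<^sup>2 / 2 + (\<theta> \<bullet> d) / u - (norm d)\<^sup>2 / (2 * u\<^sup>2 * q))"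
    unfolding vb vv by simp
  also have "\<dots> = - (norm \<theta>)\<^sup>2 / 2 + \<theta> \<bullet> w / u + - (norm d)\<^sup>2 / (2 * u\<^sup>2 * q)"
    unfolding d_def q(1) by (simp add: inner_diff_right diff_divide_distrib algebra_simps)
  finally have "exp (v \<bullet> b - (norm v)\<^sup>2 * u / 2) * exp (- (norm (q *\<^sub>R \<theta> - (1 / u) *\<^sub>R d))\<^sup>2 / (2 * q))
     = exp (- (norm \<theta>)\<^sup>2 / 2) * exp (\<theta> \<bullet> w / u) * exp (- (norm d)\<^sup>2 / (2 * u\<^sup>2 * q))"
    by (simp only: exp_add[symmetric])
  then show ?thesis unfolding arg planar_density_def d_def by (simp add: mult.assoc)
qed

context planar_brownian_motion
begin

text \<open>Equivalently, the motion with drift -m started at -w enters K at a time in D. Countable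
  D makes the event measurable, also jointly with w.\<close>

definition hitting :: "(real \<times> real) set \<Rightarrow> real \<times> real \<Rightarrow> real set \<Rightarrow> real \<times> real \<Rightarrow> 'a set" where
  "hitting K m D w = {\<omega>\<in>space M. \<exists>s\<in>D. B s \<omega> - s *\<^sub>R m - w \<in> K}"

lemma hitting_sets:
  assumes "countable D" "D \<subseteq> {0..}" "K \<in> sets borel"
  shows "hitting K m D w \<in> sets M"
  unfolding hitting_def using assms
  by (intro sets_Collect_bex_countable) (auto intro!: borel_measurable_diff measurable_B)

lemma hitting_sets_pair:
  assumes "countable D" "D \<subseteq> {0..}" "K \<in> sets borel"
  shows "(\<lambda>(\<omega>, w). indicator (hitting K m D w) \<omega> :: ennreal) \<in> borel_measurable (M \<Otimes>\<^sub>M lborel)"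
proof -
  have "{z\<in>space (M \<Otimes>\<^sub>M lborel). \<exists>s\<in>D. B s (fst z) - s *\<^sub>R m - snd z \<in> K} \<in> sets (M \<Otimes>\<^sub>M lborel)" (is "?S \<in> _")
  proof (intro sets_Collect_bex_countable assms)
    fix s assume "s \<in> D"
    then have [measurable]: "B s \<in> borel_measurable M" using assms by (intro measurable_B) auto
    show "(\<lambda>z. B s (fst z) - s *\<^sub>R m - snd z) \<in> borel_measurable (M \<Otimes>\<^sub>M lborel)" by measurable
  qed
  then have "(indicator ?S :: _ \<Rightarrow> ennreal) \<in> borel_measurable (M \<Otimes>\<^sub>M (lborel :: (real \<times> real) measure))"
    by (rule borel_measurable_indicator)
  also have "(indicator ?S :: _ \<Rightarrow> ennreal) \<in> borel_measurable (M \<Otimes>\<^sub>M (lborel :: (real \<times> real) measure)) \<longleftrightarrow>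
     (\<lambda>(\<omega>, w). indicator (hitting K m D w) \<omega> :: ennreal) \<in> borel_measurable (M \<Otimes>\<^sub>M lborel)"
    by (rule measurable_cong) (auto simp: hitting_def space_pair_measure indicator_def)
  finally show ?thesis .
qed

text \<open>The position at time q and the reversed path are independent, and the path may be taken
  tilted. Integrating first over that position and choosing the displacement from the corner as
  integration variable separates a deterministic prefactor from hitting probabilities of the
  untilted B; Fubini then puts w outermost.\<close>

lemma late_exit_formula:
  assumes u: "u > 1" and K: "K \<in> sets borel" and cone: "\<And>c x. c > 0 \<Longrightarrow> c *\<^sub>R x \<in> K \<longleftrightarrow> x \<in> K"
    and D: "countable D" "D \<subseteq> {0..u}" and q: "q = 1 - 1 / u" and \<theta>: "\<theta> = u *\<^sub>R m + \<gamma>"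
  shows "emeasure M {\<omega>\<in>space M. \<exists>s\<in>D. B (1 - s / u\<^sup>2) \<omega> - (1 - s / u\<^sup>2) *\<^sub>R \<gamma> - u *\<^sub>R m \<in> K}
    = ennreal (exp (- (norm \<theta>)\<^sup>2 / 2) / (2 * pi * q * u\<^sup>2)) *
      (\<integral>\<^sup>+w. ennreal (exp (\<theta> \<bullet> w / u)) *
         (\<integral>\<^sup>+\<omega>. ennreal (exp (- (norm (w - B u \<omega>))\<^sup>2 / (2 * u\<^sup>2 * q))) * indicator (hitting K m D w) \<omega> \<partial>M) \<partial>lborel)"
proof -
  \<comment> \<open>Tilting the path by \<theta>/u makes its drift over rescaled time s cancel the
    motion s \<gamma> / u^2 of the barrier and leave -s m.\<close>
  define v where "v = (1 / u) *\<^sub>R \<theta>"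
  have u0: "u > 0" "0 \<le> u" "u \<le> u\<^sup>2" using u by (auto simp: power2_eq_square)
  have q0: "q > 0" using u q by simp
  have qu: "1 - u / u\<^sup>2 = q" using u q by (simp add: power2_eq_square)
  have D0: "D \<subseteq> {0..}" using D by auto
  let ?Y = "PiM {0..u} (\<lambda>_. borel :: (real \<times> real) measure)"
  define X where "X s \<omega> = s *\<^sub>R v - B s \<omega>" for s \<omega>
  let ?D = "\<lambda>\<omega>. ennreal (exp (v \<bullet> B u \<omega> - (norm v)\<^sup>2 * u / 2))"
  define N where "N = density M ?D"
  have WX: "wiener N u X"
    unfolding N_def X_def by (intro wiener_girsanov wiener_B u0)
  have Bu[measurable]: "B u \<in> borel_measurable M" using u0 by (intro measurable_B)
  interpret N: prob_space N using WX by (rule wiener_prob_space)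
  let ?L = "distr N ?Y (path_upto u X)"
  have Xm: "path_upto u X \<in> N \<rightarrow>\<^sub>M ?Y" by (rule wiener_measurable_path[OF WX])
  interpret L: prob_space ?L by (rule N.prob_space_distr[OF Xm])
  interpret G: prob_space "planar_gauss q" using q0 by (intro prob_space_planar_gauss) simp
  interpret GL: pair_prob_space "planar_gauss q" ?L ..
  interpret PM: pair_sigma_finite M "lborel :: (real \<times> real) measure" ..

  \<comment> \<open>The displacement from the moving corner at time 1 - s/u^2, rebuilt from the
    position at q and the reversed path R through B(1 - s/u^2) = B(q) + (R(u) - R(s))/u.\<close>
  define a where "a s z = fst z + (1 / u) *\<^sub>R (snd z u - snd z s) - (1 - s / u\<^sup>2) *\<^sub>R \<gamma> - u *\<^sub>R m"
    for s and z :: "(real \<times> real) \<times> (real \<Rightarrow> real \<times> real)"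
  define S where "S = {z\<in>space (borel \<Otimes>\<^sub>M ?Y). \<exists>s\<in>D. a s z \<in> K}"
  have S: "S \<in> sets (borel \<Otimes>\<^sub>M ?Y)"
    unfolding S_def
  proof (intro sets_Collect_bex_countable D K)
    fix s assume s: "s \<in> D"
    have "(\<lambda>z. snd z r) \<in> borel_measurable (borel \<Otimes>\<^sub>M ?Y)" if "r \<in> {0..u}" for r
      by (rule measurable_compose[OF measurable_snd measurable_component_singleton[OF that]])
    then have [measurable]: "(\<lambda>z. snd z u) \<in> borel_measurable (borel \<Otimes>\<^sub>M ?Y)" "(\<lambda>z. snd z s) \<in> borel_measurable (borel \<Otimes>\<^sub>M ?Y)"
      using D s u0 by auto
    show "a s \<in> borel_measurable (borel \<Otimes>\<^sub>M ?Y)" unfolding a_def by measurable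
  qed
  have spY: "path_upto u Z \<omega> \<in> space ?Y" for Z :: "real \<Rightarrow> 'a \<Rightarrow> real \<times> real" and \<omega>
    by (simp add: space_PiM path_upto_def)
  have setsGL: "sets (planar_gauss q \<Otimes>\<^sub>M ?L) = sets (borel \<Otimes>\<^sub>M ?Y)"
    by (intro sets_pair_measure_cong) auto
  have Sm: "indicator S \<in> borel_measurable (planar_gauss q \<Otimes>\<^sub>M ?L)"
    using S setsGL by (intro borel_measurable_indicator) simp
  have inner: "(\<lambda>(y, h). indicator S (h, y) :: ennreal) \<in> borel_measurable (?Y \<Otimes>\<^sub>M planar_gauss q)"
  proof -
    have "sets (planar_gauss q \<Otimes>\<^sub>M ?Y) = sets (borel \<Otimes>\<^sub>M ?Y)"
      by (intro sets_pair_measure_cong) auto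
    then have "(indicator S :: _ \<Rightarrow> ennreal) \<in> borel_measurable (planar_gauss q \<Otimes>\<^sub>M ?Y)"
      using S by (intro borel_measurable_indicator) simp
    then show ?thesis using measurable_pair_swap[of "indicator S :: _ \<Rightarrow> ennreal"] by (simp add: case_prod_beta')
  qed
  have revm: "path_upto u (reversed u) \<in> M \<rightarrow>\<^sub>M ?Y"
    using u0 by (intro measurable_path_upto measurable_reversed) auto
  have Bq: "B q \<in> borel_measurable M" using q0 by (intro measurable_B) simp

  have "emeasure M {\<omega>\<in>space M. \<exists>s\<in>D. B (1 - s / u\<^sup>2) \<omega> - (1 - s / u\<^sup>2) *\<^sub>R \<gamma> - u *\<^sub>R m \<in> K}
     = emeasure M ((\<lambda>\<omega>. (B q \<omega>, path_upto u (reversed u) \<omega>)) -` S \<inter> space M)"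
  proof (rule arg_cong[of _ _ "emeasure M"])
    have "a s (B q \<omega>, path_upto u (reversed u) \<omega>) = B (1 - s / u\<^sup>2) \<omega> - (1 - s / u\<^sup>2) *\<^sub>R \<gamma> - u *\<^sub>R m" if "s \<in> D" for s \<omega>
    proof -
      have "s \<in> {0..u}" using D that by auto
      then show ?thesis using u0
        by (simp add: a_def path_upto_def reversed_def qu) (simp add: scaleR_diff_right)
    qed
    then show "{\<omega>\<in>space M. \<exists>s\<in>D. B (1 - s / u\<^sup>2) \<omega> - (1 - s / u\<^sup>2) *\<^sub>R \<gamma> - u *\<^sub>R m \<in> K}
       = (\<lambda>\<omega>. (B q \<omega>, path_upto u (reversed u) \<omega>)) -` S \<inter> space M"
      by (auto simp: S_def space_pair_measure spY)
  qed
  also have "\<dots> = emeasure (distr M (borel \<Otimes>\<^sub>M ?Y) (\<lambda>\<omega>. (B q \<omega>, path_upto u (reversed u) \<omega>))) S"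
    using S by (intro emeasure_distr[symmetric] measurable_Pair Bq revm)
  also have "\<dots> = emeasure (planar_gauss q \<Otimes>\<^sub>M ?L) S"
    using distr_B_reversed[OF u0 WX] unfolding qu by simp
  also have "\<dots> = (\<integral>\<^sup>+z. indicator S z \<partial>(planar_gauss q \<Otimes>\<^sub>M ?L))"
    using S setsGL by simp
  also have "\<dots> = (\<integral>\<^sup>+y. \<integral>\<^sup>+h. indicator S (h, y) \<partial>planar_gauss q \<partial>?L)"
    by (rule GL.nn_integral_snd[OF Sm, symmetric])
  also have "\<dots> = (\<integral>\<^sup>+\<omega>. \<integral>\<^sup>+h. indicator S (h, path_upto u X \<omega>) \<partial>planar_gauss q \<partial>N)"
  proof (rule nn_integral_distr[OF Xm])
    show "(\<lambda>y. \<integral>\<^sup>+h. indicator S (h, y) \<partial>planar_gauss q) \<in> borel_measurable ?L"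
      using G.borel_measurable_nn_integral[OF inner] by simp
  qed
  also have "\<dots> = (\<integral>\<^sup>+\<omega>. ?D \<omega> * (\<integral>\<^sup>+h. indicator S (h, path_upto u X \<omega>) \<partial>planar_gauss q) \<partial>M)"
    unfolding N_def
  proof (rule nn_integral_density)
    have Xm': "path_upto u X \<in> M \<rightarrow>\<^sub>M ?Y" using Xm unfolding N_def by simp
    from measurable_compose[OF Xm' G.borel_measurable_nn_integral[OF inner]]
    show "(\<lambda>\<omega>. \<integral>\<^sup>+h. indicator S (h, path_upto u X \<omega>) \<partial>planar_gauss q) \<in> borel_measurable M" .
  qed measurable
  also have "\<dots> = (\<integral>\<^sup>+\<omega>. \<integral>\<^sup>+w. ennreal (exp (- (norm \<theta>)\<^sup>2 / 2) / (2 * pi * q * u\<^sup>2)) * (ennreal (exp (\<theta> \<bullet> w / u)) *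
         (ennreal (exp (- (norm (w - B u \<omega>))\<^sup>2 / (2 * u\<^sup>2 * q))) * indicator (hitting K m D w) \<omega>)) \<partial>lborel \<partial>M)"
  proof (rule nn_integral_cong)
    fix \<omega> assume \<omega>: "\<omega> \<in> space M"
    define y where "y = path_upto u X \<omega>"
    have yY: "y \<in> space ?Y" unfolding y_def by (rule spY)
    have ind: "(\<lambda>h. indicator S (h, y) :: ennreal) \<in> borel_measurable borel"
      by (rule measurable_compose[OF measurable_Pair2'[OF yY] borel_measurable_indicator[OF S]])
    note ind[measurable]
    have yu: "y u = u *\<^sub>R v - B u \<omega>" using u0 by (simp add: y_def path_upto_def X_def)
    have "(\<integral>\<^sup>+h. indicator S (h, y) \<partial>planar_gauss q) = (\<integral>\<^sup>+h. ennreal (planar_density q h) * indicator S (h, y) \<partial>lborel)"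
      using q0 by (intro nn_integral_planar_gauss) auto
    \<comment> \<open>The substitution is w = u (\<theta> - h - y(u)/u). As h + y(u)/u stands for
      the endpoint at time 1, w is its magnified displacement from the corner; the Jacobian produces
      the factor u^(-2).\<close>
    also have "\<dots> = ennreal ((- 1 / u)\<^sup>2) * (\<integral>\<^sup>+w. ennreal (planar_density q (\<theta> - (1 / u) *\<^sub>R y u + (- 1 / u) *\<^sub>R w))
         * indicator S (\<theta> - (1 / u) *\<^sub>R y u + (- 1 / u) *\<^sub>R w, y) \<partial>lborel)"
      using u0 by (intro nn_integral_lborel_affine) auto
    finally have "?D \<omega> * (\<integral>\<^sup>+h. indicator S (h, y) \<partial>planar_gauss q)
      = (?D \<omega> * ennreal ((- 1 / u)\<^sup>2)) * (\<integral>\<^sup>+w. ennreal (planar_density q (\<theta> - (1 / u) *\<^sub>R y u + (- 1 / u) *\<^sub>R w))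
         * indicator S (\<theta> - (1 / u) *\<^sub>R y u + (- 1 / u) *\<^sub>R w, y) \<partial>lborel)"
      by (simp only: mult.assoc)
    also have "\<dots> = (\<integral>\<^sup>+w. (?D \<omega> * ennreal ((- 1 / u)\<^sup>2)) * (ennreal (planar_density q (\<theta> - (1 / u) *\<^sub>R y u + (- 1 / u) *\<^sub>R w))
         * indicator S (\<theta> - (1 / u) *\<^sub>R y u + (- 1 / u) *\<^sub>R w, y)) \<partial>lborel)"
    proof (rule nn_integral_cmult[symmetric])
      have [measurable]: "(\<lambda>w. indicator S (\<theta> - (1 / u) *\<^sub>R y u + (- 1 / u) *\<^sub>R w, y) :: ennreal) \<in> borel_measurable lborel"
        by (rule measurable_compose[OF _ ind]) measurable
      show "(\<lambda>w. ennreal (planar_density q (\<theta> - (1 / u) *\<^sub>R y u + (- 1 / u) *\<^sub>R w))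
         * indicator S (\<theta> - (1 / u) *\<^sub>R y u + (- 1 / u) *\<^sub>R w, y)) \<in> borel_measurable lborel"
        by measurable
    qed
    also have "\<dots> = (\<integral>\<^sup>+w. ennreal (exp (- (norm \<theta>)\<^sup>2 / 2) / (2 * pi * q * u\<^sup>2)) * (ennreal (exp (\<theta> \<bullet> w / u)) *
         (ennreal (exp (- (norm (w - B u \<omega>))\<^sup>2 / (2 * u\<^sup>2 * q))) * indicator (hitting K m D w) \<omega>)) \<partial>lborel)"
    proof (rule nn_integral_cong)
      fix w :: "real \<times> real"
      let ?t = "\<theta> - (1 / u) *\<^sub>R y u + (- 1 / u) *\<^sub>R w"
      \<comment> \<open>The two \<gamma> terms cancel here, and homogeneity of K then removes the
        factor 1/u.\<close>
      have "a s (?t, y) = (1 / u) *\<^sub>R (B s \<omega> - s *\<^sub>R m - w)" if "s \<in> D" for s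
      proof -
        have s: "y s = s *\<^sub>R v - B s \<omega>" using that D by (auto simp: y_def path_upto_def X_def)
        have "a s (?t, y) = \<theta> + (- 1 / u) *\<^sub>R w - (1 / u) *\<^sub>R y s - (1 - s / u\<^sup>2) *\<^sub>R \<gamma> - u *\<^sub>R m"
          by (simp add: a_def algebra_simps)
        also have "(1 / u) *\<^sub>R y s = (s / u) *\<^sub>R m + (s / u\<^sup>2) *\<^sub>R \<gamma> - (1 / u) *\<^sub>R B s \<omega>"
          using u0 unfolding s v_def \<theta> by (simp add: algebra_simps power2_eq_square)
        finally show ?thesis unfolding \<theta> by (simp add: algebra_simps)
      qed
      then have "a s (?t, y) \<in> K \<longleftrightarrow> B s \<omega> - s *\<^sub>R m - w \<in> K" if "s \<in> D" for s
        using cone[of "1 / u"] u0 that by simp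
      then have "(?t, y) \<in> S \<longleftrightarrow> \<omega> \<in> hitting K m D w"
        using \<omega> yY by (auto simp: S_def hitting_def space_pair_measure)
      then have ind: "indicator S (?t, y) = (indicator (hitting K m D w) \<omega> :: ennreal)" by (simp add: indicator_def)
      have "exp (v \<bullet> B u \<omega> - (norm v)\<^sup>2 * u / 2) * ((- 1 / u)\<^sup>2) * planar_density q ?t
         = (1 / u\<^sup>2) * (exp (v \<bullet> B u \<omega> - (norm v)\<^sup>2 * u / 2) * planar_density q ?t)"
        by (simp add: power_divide)
      also have "\<dots> = (1 / u\<^sup>2) * (exp (- (norm \<theta>)\<^sup>2 / 2) / (2 * pi * q) * (exp (\<theta> \<bullet> w / u) * exp (- (norm (w - B u \<omega>))\<^sup>2 / (2 * u\<^sup>2 * q))))"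
        unfolding yu planar_density_shift[OF q u v_def] ..
      also have "\<dots> = exp (- (norm \<theta>)\<^sup>2 / 2) / (2 * pi * q * u\<^sup>2) * (exp (\<theta> \<bullet> w / u) * exp (- (norm (w - B u \<omega>))\<^sup>2 / (2 * u\<^sup>2 * q)))"
        by simp
      finally have e: "exp (v \<bullet> B u \<omega> - (norm v)\<^sup>2 * u / 2) * ((- 1 / u)\<^sup>2) * planar_density q ?t = \<dots>" .
      have "?D \<omega> * ennreal ((- 1 / u)\<^sup>2) * (ennreal (planar_density q ?t) * indicator S (?t, y))
         = ennreal (exp (v \<bullet> B u \<omega> - (norm v)\<^sup>2 * u / 2) * ((- 1 / u)\<^sup>2) * planar_density q ?t) * indicator S (?t, y)"
        by (simp only: mult.assoc[symmetric] ennreal_mult'' zero_le_power2 planar_density_nonneg[OF less_imp_le[OF q0]])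
      also have "\<dots> = ennreal (exp (- (norm \<theta>)\<^sup>2 / 2) / (2 * pi * q * u\<^sup>2)) * (ennreal (exp (\<theta> \<bullet> w / u)) *
         (ennreal (exp (- (norm (w - B u \<omega>))\<^sup>2 / (2 * u\<^sup>2 * q))) * indicator (hitting K m D w) \<omega>))"
        unfolding e ind by (simp only: mult.assoc ennreal_mult'' exp_ge_zero mult_nonneg_nonneg)
      finally show "?D \<omega> * ennreal ((- 1 / u)\<^sup>2) * (ennreal (planar_density q ?t) * indicator S (?t, y))
         = ennreal (exp (- (norm \<theta>)\<^sup>2 / 2) / (2 * pi * q * u\<^sup>2)) * (ennreal (exp (\<theta> \<bullet> w / u)) *
         (ennreal (exp (- (norm (w - B u \<omega>))\<^sup>2 / (2 * u\<^sup>2 * q))) * indicator (hitting K m D w) \<omega>))" .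
    qed
    finally show "?D \<omega> * (\<integral>\<^sup>+h. indicator S (h, path_upto u X \<omega>) \<partial>planar_gauss q)
      = (\<integral>\<^sup>+w. ennreal (exp (- (norm \<theta>)\<^sup>2 / 2) / (2 * pi * q * u\<^sup>2)) * (ennreal (exp (\<theta> \<bullet> w / u)) *
         (ennreal (exp (- (norm (w - B u \<omega>))\<^sup>2 / (2 * u\<^sup>2 * q))) * indicator (hitting K m D w) \<omega>)) \<partial>lborel)"
      unfolding y_def .
  qed
  also have "\<dots> = (\<integral>\<^sup>+w. \<integral>\<^sup>+\<omega>. ennreal (exp (- (norm \<theta>)\<^sup>2 / 2) / (2 * pi * q * u\<^sup>2)) * (ennreal (exp (\<theta> \<bullet> w / u)) *
         (ennreal (exp (- (norm (w - B u \<omega>))\<^sup>2 / (2 * u\<^sup>2 * q))) * indicator (hitting K m D w) \<omega>)) \<partial>M \<partial>lborel)"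
  proof (rule PM.Fubini'[symmetric])
    note hitting_sets_pair[OF D(1) D0 K, measurable]
    show "(\<lambda>(\<omega>, w). ennreal (exp (- (norm \<theta>)\<^sup>2 / 2) / (2 * pi * q * u\<^sup>2)) * (ennreal (exp (\<theta> \<bullet> w / u)) *
         (ennreal (exp (- (norm (w - B u \<omega>))\<^sup>2 / (2 * u\<^sup>2 * q))) * indicator (hitting K m D w) \<omega>)))
         \<in> borel_measurable (M \<Otimes>\<^sub>M lborel)"
      using hitting_sets_pair[OF D(1) D0 K] unfolding case_prod_beta' by (intro borel_measurable_times_ennreal) measurable
  qed
  also have "\<dots> = (\<integral>\<^sup>+w. ennreal (exp (- (norm \<theta>)\<^sup>2 / 2) / (2 * pi * q * u\<^sup>2)) * (ennreal (exp (\<theta> \<bullet> w / u)) *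
         (\<integral>\<^sup>+\<omega>. ennreal (exp (- (norm (w - B u \<omega>))\<^sup>2 / (2 * u\<^sup>2 * q))) * indicator (hitting K m D w) \<omega> \<partial>M)) \<partial>lborel)"
  proof (rule nn_integral_cong)
    fix w :: "real \<times> real"
    note hitting_sets[OF D(1) D0 K, measurable]
    have [measurable]: "(\<lambda>\<omega>. ennreal (exp (- (norm (w - B u \<omega>))\<^sup>2 / (2 * u\<^sup>2 * q))) * indicator (hitting K m D w) \<omega>) \<in> borel_measurable M"
      by measurable
    show "(\<integral>\<^sup>+\<omega>. ennreal (exp (- (norm \<theta>)\<^sup>2 / 2) / (2 * pi * q * u\<^sup>2)) * (ennreal (exp (\<theta> \<bullet> w / u)) *
         (ennreal (exp (- (norm (w - B u \<omega>))\<^sup>2 / (2 * u\<^sup>2 * q))) * indicator (hitting K m D w) \<omega>)) \<partial>M)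
      = ennreal (exp (- (norm \<theta>)\<^sup>2 / 2) / (2 * pi * q * u\<^sup>2)) * (ennreal (exp (\<theta> \<bullet> w / u)) *
         (\<integral>\<^sup>+\<omega>. ennreal (exp (- (norm (w - B u \<omega>))\<^sup>2 / (2 * u\<^sup>2 * q))) * indicator (hitting K m D w) \<omega> \<partial>M))"
      by (simp add: nn_integral_cmult)
  qed
  also have "\<dots> = ennreal (exp (- (norm \<theta>)\<^sup>2 / 2) / (2 * pi * q * u\<^sup>2)) *
      (\<integral>\<^sup>+w. ennreal (exp (\<theta> \<bullet> w / u)) *
         (\<integral>\<^sup>+\<omega>. ennreal (exp (- (norm (w - B u \<omega>))\<^sup>2 / (2 * u\<^sup>2 * q))) * indicator (hitting K m D w) \<omega> \<partial>M) \<partial>lborel)"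
  proof (rule nn_integral_cmult)
    have m: "(\<lambda>(w, \<omega>). ennreal (exp (- (norm (w - B u \<omega>))\<^sup>2 / (2 * u\<^sup>2 * q))) * indicator (hitting K m D w) \<omega>)
        \<in> borel_measurable (lborel \<Otimes>\<^sub>M M)"
      using measurable_pair_swap[OF hitting_sets_pair[OF D(1) D0 K]] unfolding case_prod_beta'
      by (intro borel_measurable_times_ennreal) (simp_all, measurable)
    have [measurable]: "(\<lambda>w. \<integral>\<^sup>+\<omega>. ennreal (exp (- (norm (w - B u \<omega>))\<^sup>2 / (2 * u\<^sup>2 * q))) * indicator (hitting K m D w) \<omega> \<partial>M) \<in> borel_measurable lborel"
      by (rule B1.borel_measurable_nn_integral[OF m])
    show "(\<lambda>w. ennreal (exp (\<theta> \<bullet> w / u)) *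
         (\<integral>\<^sup>+\<omega>. ennreal (exp (- (norm (w - B u \<omega>))\<^sup>2 / (2 * u\<^sup>2 * q))) * indicator (hitting K m D w) \<omega> \<partial>M)) \<in> borel_measurable lborel"
      by measurable
  qed
  finally show ?thesis .
qed

end

section \<open>Bounds for early exits and hitting probabilities\<close>

text \<open>The preimage of an open set is relatively open, and a relatively open set around a point
  of S meets any subset of S that is dense in it.\<close>

lemma ex_rational_in_open:
  fixes f :: "real \<Rightarrow> 'b::topological_space"
  assumes f: "continuous_on S f" and K: "open K" and S: "S \<subseteq> closure (\<rat> \<inter> S)"
  shows "(\<exists>t\<in>S. f t \<in> K) \<longleftrightarrow> (\<exists>t\<in>\<rat> \<inter> S. f t \<in> K)"
proof
  assume "\<exists>t\<in>S. f t \<in> K"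
  then obtain t where t: "t \<in> S" "f t \<in> K" by auto
  obtain T where T: "open T" "T \<inter> S = f -` K \<inter> S"
    using f K unfolding continuous_on_open_invariant by blast
  have "t \<in> T \<inter> closure (\<rat> \<inter> S)" using t T S by auto
  then have "T \<inter> (\<rat> \<inter> S) \<noteq> {}" using open_Int_closure_eq_empty[OF T(1)] by blast
  then show "\<exists>t\<in>\<rat> \<inter> S. f t \<in> K" using T by blast
qed auto

lemma closure_rational_atLeastAtMost:
  fixes a b :: real
  assumes "a < b"
  shows "{a..b} \<subseteq> closure (\<rat> \<inter> {a..b})"
proof
  fix t assume t: "t \<in> {a..b}"
  show "t \<in> closure (\<rat> \<inter> {a..b})"
    unfolding closure_approachable
  proof (intro allI impI)
    fix e :: real assume "e > 0"
    then have "max a (t - e) < min b (t + e)" using t assms by auto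
    then obtain r where "r \<in> \<rat>" "max a (t - e) < r" "r < min b (t + e)" using Rats_dense_in_real by blast
    then show "\<exists>y\<in>\<rat> \<inter> {a..b}. dist y t < e" by (intro bexI[of _ r]) (auto simp: dist_real_def abs_less_iff)
  qed
qed

lemma closure_rational_atLeast:
  fixes a :: real
  shows "{a..} \<subseteq> closure (\<rat> \<inter> {a..})"
proof
  fix t assume "t \<in> {a..}"
  then have "t \<in> {a..t + 1}" by simp
  then have "t \<in> closure (\<rat> \<inter> {a..t + 1})" using closure_rational_atLeastAtMost[of a "t + 1"] \<open>t \<in> {a..}\<close> by auto
  also have "\<dots> \<subseteq> closure (\<rat> \<inter> {a..})" by (intro closure_mono) auto
  finally show "t \<in> closure (\<rat> \<inter> {a..})" .
qed

lemma countable_Rats_Int: "countable (\<rat> \<inter> A :: real set)"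
  by (rule countable_subset[OF _ countable_rat]) auto

text \<open>The norm is at least the average of the absolute values of the coordinates, so the
  integrand lies below a product of two-sided exponentials; their integrals are finite because the
  exponential density has mass 1.\<close>

lemma integrable_exp_neg_norm:
  assumes "c > 0"
  shows "integrable lborel (\<lambda>w :: real \<times> real. exp (- c * norm w))"
proof -
  have abs: "(\<integral>\<^sup>+x. ennreal (exp (- (c / 2) * \<bar>x\<bar>)) \<partial>lborel) < \<infinity>"
  proof -
    have pos: "(\<integral>\<^sup>+x. ennreal (exp (- (c / 2) * x)) * indicator {0..} x \<partial>lborel) < \<infinity>"
    proof -
      have "(\<integral>\<^sup>+x. ennreal (exponential_density (c / 2) x) \<partial>lborel) = 1"
        using prob_space.emeasure_space_1[OF prob_space_exponential_density[of "c / 2"]] assms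
        by (simp add: emeasure_density)
      moreover have "(\<integral>\<^sup>+x. ennreal (exponential_density (c / 2) x) \<partial>lborel)
        = ennreal (c / 2) * (\<integral>\<^sup>+x. ennreal (exp (- (c / 2) * x)) * indicator {0..} x \<partial>lborel)"
        using assms by (subst nn_integral_cmult[symmetric])
          (auto simp: exponential_density_def ennreal_mult[symmetric] mult_ac intro!: nn_integral_cong split: split_indicator)
      ultimately show ?thesis using assms
        by (metis ennreal_mult_top ennreal_top_neq_one ennreal_eq_0_iff infinity_ennreal_def less_top mult.commute not_le divide_pos_pos zero_less_numeral)
    qed
    have "(\<integral>\<^sup>+x. ennreal (exp (- (c / 2) * \<bar>x\<bar>)) \<partial>lborel)
      \<le> (\<integral>\<^sup>+x. (ennreal (exp (- (c / 2) * x)) * indicator {0..} x + ennreal (exp (- (c / 2) * - x)) * indicator {0..} (- x)) \<partial>lborel)"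
      by (intro nn_integral_mono) (auto split: split_indicator)
    also have "\<dots> = (\<integral>\<^sup>+x. ennreal (exp (- (c / 2) * x)) * indicator {0..} x \<partial>lborel)
       + (\<integral>\<^sup>+x. ennreal (exp (- (c / 2) * - x)) * indicator {0..} (- x) \<partial>lborel)"
      by (intro nn_integral_add) auto
    also have "(\<integral>\<^sup>+x. ennreal (exp (- (c / 2) * - x)) * indicator {0..} (- x) \<partial>lborel)
       = (\<integral>\<^sup>+x. ennreal (exp (- (c / 2) * x)) * indicator {0..} x \<partial>lborel)"
      by (subst (2) nn_integral_real_affine[where c = "-1" and t = 0]) auto
    finally show ?thesis using pos by (simp add: ennreal_add_eq_top less_top le_less_trans)
  qed
  have le: "norm (exp (- c * norm w)) \<le> exp (- (c / 2) * \<bar>fst w\<bar>) * exp (- (c / 2) * \<bar>snd w\<bar>)" for w :: "real \<times> real"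
  proof -
    have "\<bar>fst w\<bar> \<le> norm w" "\<bar>snd w\<bar> \<le> norm w"
      using norm_fst_le[of "fst w" "snd w"] norm_snd_le[of "snd w" "fst w"] by simp_all
    then have "c / 2 * \<bar>fst w\<bar> + c / 2 * \<bar>snd w\<bar> \<le> c / 2 * norm w + c / 2 * norm w"
      using assms by (intro add_mono mult_left_mono) auto
    then have "- c * norm w \<le> - (c / 2) * \<bar>fst w\<bar> + - (c / 2) * \<bar>snd w\<bar>" by simp
    then show ?thesis unfolding exp_add[symmetric] by simp
  qed
  have "(\<integral>\<^sup>+w. ennreal (norm (exp (- c * norm w))) \<partial>(lborel :: (real \<times> real) measure))
    \<le> (\<integral>\<^sup>+w. ennreal (exp (- (c / 2) * \<bar>fst w\<bar>)) * ennreal (exp (- (c / 2) * \<bar>snd w\<bar>)) \<partial>lborel)"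
    using le by (intro nn_integral_mono) (simp add: ennreal_mult[symmetric] del: ennreal_le_iff2)
  also have "\<dots> = (\<integral>\<^sup>+x. \<integral>\<^sup>+y. ennreal (exp (- (c / 2) * \<bar>x\<bar>)) * ennreal (exp (- (c / 2) * \<bar>y\<bar>)) \<partial>lborel \<partial>lborel)"
    unfolding lborel_prod[symmetric] by (subst lborel.nn_integral_fst[symmetric]) simp_all
  also have "\<dots> = (\<integral>\<^sup>+x. ennreal (exp (- (c / 2) * \<bar>x\<bar>)) \<partial>lborel) * (\<integral>\<^sup>+y. ennreal (exp (- (c / 2) * \<bar>y\<bar>)) \<partial>lborel)"
    by (simp add: nn_integral_cmult nn_integral_multc)
  also have "\<dots> < \<infinity>" using abs by (simp add: ennreal_mult_less_top)
  finally show ?thesis by (intro integrableI_bounded) auto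
qed

context planar_brownian_motion
begin

lemma second_moment_B:
  assumes "u > 0"
  shows "integrable M (\<lambda>\<omega>. (norm (B u \<omega>))\<^sup>2)" "(\<integral>\<omega>. (norm (B u \<omega>))\<^sup>2 \<partial>M) = 2 * u"
proof -
  have 1: "integrable M (\<lambda>\<omega>. (b u \<omega>)\<^sup>2) \<and> (\<integral>\<omega>. (b u \<omega>)\<^sup>2 \<partial>M) = u"
    if b: "standard_brownian_motion M b" for b
  proof -
    interpret b: standard_brownian_motion M b by fact
    have d: "distributed M lborel (\<lambda>\<omega>. b u \<omega> - b 0 \<omega>) (normal_density 0 (sqrt u))"
      using b.normal_increments[of 0 u] assms by simp
    have e: "(\<integral>\<omega>. b u \<omega> - b 0 \<omega> \<partial>M) = 0" using B1.normal_distributed_expectation[OF _ d] assms by simp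
    have v: "(\<integral>\<omega>. (b u \<omega> - b 0 \<omega>)\<^sup>2 \<partial>M) = u" using B1.normal_distributed_variance[OF _ d] assms by (simp add: e)
    \<comment> \<open>A Bochner integral of a nonintegrable function is 0, whereas this one equals
      the variance u > 0.\<close>
    have i: "integrable M (\<lambda>\<omega>. (b u \<omega> - b 0 \<omega>)\<^sup>2)"
      using v assms not_integrable_integral_eq[of M "\<lambda>\<omega>. (b u \<omega> - b 0 \<omega>)\<^sup>2"] by auto
    have ae: "AE \<omega> in M. (b u \<omega> - b 0 \<omega>)\<^sup>2 = (b u \<omega>)\<^sup>2" using b.start by eventually_elim simp
    have [measurable]: "b u \<in> borel_measurable M" "b 0 \<in> borel_measurable M" using assms by (auto intro: b.random_variable)
    show ?thesis
      using i v integrable_cong_AE[OF _ _ ae] integral_cong_AE[OF _ _ ae] by simp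
  qed
  have "norm (B u \<omega>) ^ 2 = (B1 u \<omega>)\<^sup>2 + (B2 u \<omega>)\<^sup>2" for \<omega> by (simp add: B_def norm_Pair)
  then show "integrable M (\<lambda>\<omega>. (norm (B u \<omega>))\<^sup>2)" "(\<integral>\<omega>. (norm (B u \<omega>))\<^sup>2 \<partial>M) = 2 * u"
    using 1[OF B1.standard_brownian_motion_axioms] 1[OF B2.standard_brownian_motion_axioms] by simp_all
qed

text \<open>An exit at time t forces \<theta> . B(t) >= \<theta> . b + t \<theta> . \<gamma>. With
  \<theta> = b + \<gamma> the exponential martingale's exponent is then at least \<theta> . b - t c,
  which equals |\<theta>|^2/2 at t = 1 and is larger by \<delta> c for t <= 1 - \<delta>. The choice
  of \<theta> is thus the one for which the bound at time 1 has the Gaussian exponent of the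
  corner.\<close>

lemma early_exit_bound:
  assumes \<theta>: "\<theta> = b + \<gamma>" and dual: "\<And>k. k \<in> K \<Longrightarrow> 0 \<le> \<theta> \<bullet> k"
    and \<delta>: "0 \<le> \<delta>" "\<delta> < 1" and K: "open K"
    and c: "c = (norm \<theta>)\<^sup>2 / 2 - \<theta> \<bullet> \<gamma>" "0 \<le> c"
  shows "measure M {\<omega>\<in>space M. \<exists>t\<in>{0..1-\<delta>}. B t \<omega> - t *\<^sub>R \<gamma> - b \<in> K} \<le> exp (- (norm \<theta>)\<^sup>2 / 2 - \<delta> * c)"
proof -
  let ?D = "\<rat> \<inter> {0..1-\<delta>}"
  have eq: "(\<exists>t\<in>{0..1-\<delta>}. B t \<omega> - t *\<^sub>R \<gamma> - b \<in> K) \<longleftrightarrow> (\<exists>t\<in>?D. B t \<omega> - t *\<^sub>R \<gamma> - b \<in> K)" if "\<omega> \<in> space M" for \<omega>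
    using \<delta> by (intro ex_rational_in_open K closure_rational_atLeastAtMost continuous_intros
        continuous_on_subset[OF continuous_B[OF that]]) auto
  have "emeasure M {\<omega>\<in>space M. \<exists>t\<in>{0..1-\<delta>}. B t \<omega> - t *\<^sub>R \<gamma> - b \<in> K}
     \<le> emeasure M {\<omega>\<in>space M. \<exists>t\<in>?D. (norm \<theta>)\<^sup>2 / 2 + \<delta> * c \<le> \<theta> \<bullet> B t \<omega> - (norm \<theta>)\<^sup>2 * t / 2}"
  proof (rule emeasure_mono)
    show "{\<omega>\<in>space M. \<exists>t\<in>{0..1-\<delta>}. B t \<omega> - t *\<^sub>R \<gamma> - b \<in> K}
      \<subseteq> {\<omega>\<in>space M. \<exists>t\<in>?D. (norm \<theta>)\<^sup>2 / 2 + \<delta> * c \<le> \<theta> \<bullet> B t \<omega> - (norm \<theta>)\<^sup>2 * t / 2}"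
    proof safe
      fix \<omega> t assume "\<omega> \<in> space M" "t \<in> {0..1-\<delta>}" "B t \<omega> - t *\<^sub>R \<gamma> - b \<in> K"
      then obtain t where t: "t \<in> ?D" "B t \<omega> - t *\<^sub>R \<gamma> - b \<in> K" using eq by blast
      define P G X where "P = \<theta> \<bullet> b" and "G = \<theta> \<bullet> \<gamma>" and "X = \<theta> \<bullet> B t \<omega>"
      have N: "(norm \<theta>)\<^sup>2 = P + G" by (simp add: power2_norm_eq_inner \<theta> inner_add_right P_def G_def)
      then have c': "c = (P - G) / 2" unfolding c(1) G_def by (simp add: field_simps)
      have "t * c \<le> (1 - \<delta>) * c" using t c(2) by (intro mult_right_mono) auto
      then have 1: "\<delta> * c \<le> c - t * c" by (simp add: left_diff_distrib)
      have 2: "t * G + P \<le> X" using dual[OF t(2)] by (simp add: inner_diff_right P_def G_def X_def)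
      have 3: "t * c = t * P / 2 - t * G / 2" unfolding c' by (simp add: right_diff_distrib diff_divide_distrib)
      have 4: "(P + G) * t / 2 = t * P / 2 + t * G / 2" by (simp add: algebra_simps add_divide_distrib)
      have "(P + G) / 2 + \<delta> * c \<le> X - (P + G) * t / 2"
        using 1 2 unfolding 4 3 c' by (simp add: field_simps)
      then have "(norm \<theta>)\<^sup>2 / 2 + \<delta> * c \<le> \<theta> \<bullet> B t \<omega> - (norm \<theta>)\<^sup>2 * t / 2"
        unfolding N X_def .
      then show "\<exists>t\<in>?D. (norm \<theta>)\<^sup>2 / 2 + \<delta> * c \<le> \<theta> \<bullet> B t \<omega> - (norm \<theta>)\<^sup>2 * t / 2" using t by blast
    qed
    have "{\<omega>\<in>space M. \<exists>t\<in>?D. \<theta> \<bullet> B t \<omega> - (norm \<theta>)\<^sup>2 * t / 2 \<in> {(norm \<theta>)\<^sup>2 / 2 + \<delta> * c..}} \<in> sets M"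
    proof (intro sets_Collect_bex_countable countable_Rats_Int)
      fix t assume "t \<in> ?D"
      then have [measurable]: "B t \<in> borel_measurable M" by (intro measurable_B) auto
      show "(\<lambda>\<omega>. \<theta> \<bullet> B t \<omega> - (norm \<theta>)\<^sup>2 * t / 2) \<in> borel_measurable M" by measurable
    qed simp
    then show "{\<omega>\<in>space M. \<exists>t\<in>?D. (norm \<theta>)\<^sup>2 / 2 + \<delta> * c \<le> \<theta> \<bullet> B t \<omega> - (norm \<theta>)\<^sup>2 * t / 2} \<in> sets M" by simp
  qed
  also have "\<dots> \<le> ennreal (exp (- ((norm \<theta>)\<^sup>2 / 2 + \<delta> * c)))"
    using \<delta> by (intro wiener_maximal[where T = 1] wiener_B countable_Rats_Int) auto
  finally show ?thesis by (simp add: B1.emeasure_eq_measure)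
qed

lemma hitting_mono: "D \<subseteq> D' \<Longrightarrow> hitting K m D w \<subseteq> hitting K m D' w"
  by (auto simp: hitting_def)

text \<open>The condition |\<theta> - m| <= |m| says |\<theta>|^2/2 <= \<theta> . m, so the drift
  term s \<theta> . m pays for the compensator of the exponential martingale at every time s. The
  resulting bound is the same on every [0,n].\<close>

lemma hitting_bound:
  assumes dual: "\<And>k. k \<in> K \<Longrightarrow> 0 \<le> \<theta> \<bullet> k" and \<theta>: "norm (\<theta> - m) \<le> norm m" and K: "K \<in> sets borel"
  shows "measure M (hitting K m (\<rat> \<inter> {0..}) w) \<le> exp (- (\<theta> \<bullet> w))"
proof -
  let ?H = "\<lambda>n::nat. hitting K m (\<rat> \<inter> {0..real n}) w"
  have "(\<Union>n. ?H n) = hitting K m (\<rat> \<inter> {0..}) w"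
  proof
    show "(\<Union>n. ?H n) \<subseteq> hitting K m (\<rat> \<inter> {0..}) w" by (auto simp: hitting_def)
    show "hitting K m (\<rat> \<inter> {0..}) w \<subseteq> (\<Union>n. ?H n)"
    proof
      fix \<omega> assume "\<omega> \<in> hitting K m (\<rat> \<inter> {0..}) w"
      then obtain s where s: "\<omega> \<in> space M" "s \<in> \<rat> \<inter> {0..}" "B s \<omega> - s *\<^sub>R m - w \<in> K" by (auto simp: hitting_def)
      obtain n where "s \<le> real n" using real_arch_simple by blast
      then have "s \<in> \<rat> \<inter> {0..real n}" using s by simp
      then have "\<omega> \<in> ?H n" using s unfolding hitting_def by blast
      then show "\<omega> \<in> (\<Union>n. ?H n)" by blast
    qed
  qed
  moreover have "incseq ?H" by (intro monoI hitting_mono) auto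
  moreover have "range ?H \<subseteq> sets M" by (auto intro!: hitting_sets countable_Rats_Int K)
  ultimately have "emeasure M (hitting K m (\<rat> \<inter> {0..}) w) = (SUP n. emeasure M (?H n))"
    using SUP_emeasure_incseq[of ?H M] by simp
  also have "\<dots> \<le> ennreal (exp (- (\<theta> \<bullet> w)))"
  proof (rule SUP_least)
    fix n :: nat
    have sq: "(norm \<theta>)\<^sup>2 / 2 \<le> \<theta> \<bullet> m"
    proof -
      have "(norm (\<theta> - m))\<^sup>2 \<le> (norm m)\<^sup>2" using \<theta> by (intro power_mono) auto
      then show ?thesis using dot_norm_neg[of \<theta> m] by simp
    qed
    have "emeasure M (?H n) \<le> emeasure M {\<omega>\<in>space M. \<exists>t\<in>\<rat> \<inter> {0..real n}. \<theta> \<bullet> w \<le> \<theta> \<bullet> B t \<omega> - (norm \<theta>)\<^sup>2 * t / 2}"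
    proof (rule emeasure_mono)
      show "?H n \<subseteq> {\<omega>\<in>space M. \<exists>t\<in>\<rat> \<inter> {0..real n}. \<theta> \<bullet> w \<le> \<theta> \<bullet> B t \<omega> - (norm \<theta>)\<^sup>2 * t / 2}"
      proof
        fix \<omega> assume "\<omega> \<in> ?H n"
        then obtain s where s: "\<omega> \<in> space M" "s \<in> \<rat> \<inter> {0..real n}" "B s \<omega> - s *\<^sub>R m - w \<in> K" by (auto simp: hitting_def)
        have "0 \<le> \<theta> \<bullet> B s \<omega> - s * (\<theta> \<bullet> m) - \<theta> \<bullet> w" using dual[OF s(3)] by (simp add: inner_diff_right)
        moreover have "s * ((norm \<theta>)\<^sup>2 / 2) \<le> s * (\<theta> \<bullet> m)" using s sq by (intro mult_left_mono) auto
        ultimately have "\<theta> \<bullet> w \<le> \<theta> \<bullet> B s \<omega> - (norm \<theta>)\<^sup>2 * s / 2" by (simp add: mult.commute)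
        then show "\<omega> \<in> {\<omega>\<in>space M. \<exists>t\<in>\<rat> \<inter> {0..real n}. \<theta> \<bullet> w \<le> \<theta> \<bullet> B t \<omega> - (norm \<theta>)\<^sup>2 * t / 2}"
          using s by blast
      qed
      have "{\<omega>\<in>space M. \<exists>t\<in>\<rat> \<inter> {0..real n}. \<theta> \<bullet> B t \<omega> - (norm \<theta>)\<^sup>2 * t / 2 \<in> {\<theta> \<bullet> w..}} \<in> sets M"
      proof (intro sets_Collect_bex_countable countable_Rats_Int)
        fix t assume "t \<in> \<rat> \<inter> {0..real n}"
        then have [measurable]: "B t \<in> borel_measurable M" by (intro measurable_B) auto
        show "(\<lambda>\<omega>. \<theta> \<bullet> B t \<omega> - (norm \<theta>)\<^sup>2 * t / 2) \<in> borel_measurable M" by measurable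
      qed simp
      then show "{\<omega>\<in>space M. \<exists>t\<in>\<rat> \<inter> {0..real n}. \<theta> \<bullet> w \<le> \<theta> \<bullet> B t \<omega> - (norm \<theta>)\<^sup>2 * t / 2} \<in> sets M" by simp
    qed
    also have "\<dots> \<le> ennreal (exp (- (\<theta> \<bullet> w)))"
      by (intro wiener_maximal[where T = "real n"] wiener_B countable_Rats_Int) auto
    finally show "emeasure M (?H n) \<le> ennreal (exp (- (\<theta> \<bullet> w)))" .
  qed
  finally show ?thesis by (simp add: B1.emeasure_eq_measure)
qed

text \<open>\<open>hitting_bound\<close> with \<theta> = m alone only makes the product bounded.
  Moving \<theta> by \<epsilon> in the direction of w gains \<epsilon> |w|; the room for this is the
  strict positivity of m on K.\<close>

lemma hitting_decay:
  assumes K: "K \<in> sets borel" and \<epsilon>: "0 \<le> \<epsilon>" "\<epsilon> \<le> norm m" and dual: "\<And>k. k \<in> K \<Longrightarrow> \<epsilon> * norm k \<le> m \<bullet> k"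
  shows "exp (m \<bullet> w) * measure M (hitting K m (\<rat> \<inter> {0..}) w) \<le> exp (- \<epsilon> * norm w)"
proof -
  \<comment> \<open>At w = 0 this is the zero vector, for which the two properties below still
    hold.\<close>
  define e where "e = sgn w"
  have e: "norm e \<le> 1" "e \<bullet> w = norm w"
    by (cases "w = 0"; simp add: e_def norm_sgn) (cases "w = 0"; simp add: e_def sgn_div_norm power2_norm_eq_inner[symmetric] power2_eq_square)
  let ?\<theta> = "m + \<epsilon> *\<^sub>R e"
  have "measure M (hitting K m (\<rat> \<inter> {0..}) w) \<le> exp (- (?\<theta> \<bullet> w))"
  proof (rule hitting_bound[OF _ _ K])
    show "norm (?\<theta> - m) \<le> norm m"
      using mult_mono[OF \<epsilon>(2) e(1)] \<epsilon> by simp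
    fix k assume k: "k \<in> K"
    have "\<bar>e \<bullet> k\<bar> \<le> norm e * norm k" by (rule Cauchy_Schwarz_ineq2)
    also have "\<dots> \<le> norm k" using e(1) by (simp add: mult_left_le_one_le)
    finally have "\<epsilon> * \<bar>e \<bullet> k\<bar> \<le> \<epsilon> * norm k" using \<epsilon> by (intro mult_left_mono)
    moreover have "- (\<epsilon> * (e \<bullet> k)) \<le> \<epsilon> * \<bar>e \<bullet> k\<bar>" using \<epsilon> by (metis abs_ge_minus_self abs_mult abs_of_nonneg)
    ultimately show "0 \<le> ?\<theta> \<bullet> k" using dual[OF k] by (simp add: inner_add_left)
  qed
  then have "exp (m \<bullet> w) * measure M (hitting K m (\<rat> \<inter> {0..}) w) \<le> exp (m \<bullet> w) * exp (- (?\<theta> \<bullet> w))"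
    by (intro mult_left_mono) auto
  also have "\<dots> = exp (- \<epsilon> * norm w)" unfolding exp_add[symmetric] by (simp add: inner_add_left e)
  finally show ?thesis .
qed

end

section \<open>Exit into a cone\<close>

text \<open>The last assumption places m in the interior of the dual cone of K, with \<epsilon> a
  quantitative margin; \<epsilon> <= |m| is the size restriction of \<open>hitting_bound\<close>.
  The barrier drift \<gamma> is arbitrary.\<close>

locale planar_cone_problem = planar_brownian_motion +
  fixes K :: "(real \<times> real) set" and m \<gamma> :: "real \<times> real" and \<epsilon> :: real
  assumes open_K: "open K" and K_nonempty: "K \<noteq> {}"
    and cone: "\<And>c x. c > 0 \<Longrightarrow> c *\<^sub>R x \<in> K \<longleftrightarrow> x \<in> K"
    and eps: "0 < \<epsilon>" "\<epsilon> \<le> norm m" and dual: "\<And>k. k \<in> K \<Longrightarrow> \<epsilon> * norm k \<le> m \<bullet> k"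
begin

lemma sets_K [measurable]: "K \<in> sets borel"
  using open_K by simp

definition hitting_prob :: "real \<times> real \<Rightarrow> real" where
  "hitting_prob w = measure M (hitting K m (\<rat> \<inter> {0..}) w)"

text \<open>The inner integral of \<open>late_exit_formula\<close> with q = 1 - 1/u: a hitting
  probability weighted by what the density at time q leaves after the dominant factors are taken
  out.\<close>

definition damped :: "real \<Rightarrow> real \<times> real \<Rightarrow> real" where
  "damped u w = (\<integral>\<omega>. exp (- (norm (w - B u \<omega>))\<^sup>2 / (2 * u\<^sup>2 * (1 - 1 / u))) * indicator (hitting K m (\<rat> \<inter> {0..u}) w) \<omega> \<partial>M)"

lemma hitting_rat_sets [measurable]: "hitting K m (\<rat> \<inter> {0..}) w \<in> sets M" "hitting K m (\<rat> \<inter> {0..u}) w \<in> sets M"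
  by (auto intro!: hitting_sets countable_Rats_Int)

lemma measurable_hitting_prob [measurable]: "hitting_prob \<in> borel_measurable borel"
proof -
  have D: "countable (\<rat> \<inter> {0..} :: real set)" "\<rat> \<inter> {0..} \<subseteq> {0::real..}" by (auto intro: countable_Rats_Int)
  have "(\<lambda>(w, \<omega>). indicator (hitting K m (\<rat> \<inter> {0..}) w) \<omega> :: ennreal) \<in> borel_measurable (lborel \<Otimes>\<^sub>M M)"
    using measurable_pair_swap[OF hitting_sets_pair[OF D sets_K, of m]] by (simp add: case_prod_beta')
  then have "(\<lambda>w. \<integral>\<^sup>+\<omega>. indicator (hitting K m (\<rat> \<inter> {0..}) w) \<omega> \<partial>M) \<in> borel_measurable lborel"
    by (rule B1.borel_measurable_nn_integral)
  then have "(\<lambda>w. enn2real (emeasure M (hitting K m (\<rat> \<inter> {0..}) w))) \<in> borel_measurable lborel"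
    by simp
  then show ?thesis by (simp add: hitting_prob_def[abs_def] measure_def)
qed

lemma damped_integrable:
  assumes "u > 1"
  shows "integrable M (\<lambda>\<omega>. exp (- (norm (w - B u \<omega>))\<^sup>2 / (2 * u\<^sup>2 * (1 - 1 / u))) * indicator (hitting K m (\<rat> \<inter> {0..u}) w) \<omega>)"
proof (rule B1.integrable_const_bound[where B = 1])
  have [measurable]: "B u \<in> borel_measurable M" using assms by (intro measurable_B) simp
  show "(\<lambda>\<omega>. exp (- (norm (w - B u \<omega>))\<^sup>2 / (2 * u\<^sup>2 * (1 - 1 / u))) * indicator (hitting K m (\<rat> \<inter> {0..u}) w) \<omega>) \<in> borel_measurable M"
    by measurable
  show "AE \<omega> in M. norm (exp (- (norm (w - B u \<omega>))\<^sup>2 / (2 * u\<^sup>2 * (1 - 1 / u))) * indicator (hitting K m (\<rat> \<inter> {0..u}) w) \<omega> :: real) \<le> 1"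
    using assms by (intro AE_I2) (auto split: split_indicator)
qed

lemma nn_damped:
  assumes "u > 1"
  shows "(\<integral>\<^sup>+\<omega>. ennreal (exp (- (norm (w - B u \<omega>))\<^sup>2 / (2 * u\<^sup>2 * (1 - 1 / u)))) * indicator (hitting K m (\<rat> \<inter> {0..u}) w) \<omega> \<partial>M)
    = ennreal (damped u w)"
proof -
  have "(\<integral>\<^sup>+\<omega>. ennreal (exp (- (norm (w - B u \<omega>))\<^sup>2 / (2 * u\<^sup>2 * (1 - 1 / u)))) * indicator (hitting K m (\<rat> \<inter> {0..u}) w) \<omega> \<partial>M)
     = (\<integral>\<^sup>+\<omega>. ennreal (exp (- (norm (w - B u \<omega>))\<^sup>2 / (2 * u\<^sup>2 * (1 - 1 / u))) * indicator (hitting K m (\<rat> \<inter> {0..u}) w) \<omega>) \<partial>M)"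
    by (intro nn_integral_cong) (auto split: split_indicator)
  also have "\<dots> = ennreal (damped u w)"
    unfolding damped_def by (intro nn_integral_eq_integral damped_integrable assms) auto
  finally show ?thesis .
qed

lemma measurable_damped:
  assumes "u > 1"
  shows "damped u \<in> borel_measurable borel"
proof -
  have D: "countable (\<rat> \<inter> {0..u})" "\<rat> \<inter> {0..u} \<subseteq> {0..}" by (auto intro: countable_Rats_Int)
  have [measurable]: "B u \<in> borel_measurable M" using assms by (intro measurable_B) simp
  have m: "(\<lambda>(w, \<omega>). ennreal (exp (- (norm (w - B u \<omega>))\<^sup>2 / (2 * u\<^sup>2 * (1 - 1 / u)))) * indicator (hitting K m (\<rat> \<inter> {0..u}) w) \<omega>)
        \<in> borel_measurable (lborel \<Otimes>\<^sub>M M)"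
    using measurable_pair_swap[OF hitting_sets_pair[OF D sets_K, of m]] unfolding case_prod_beta'
    by (intro borel_measurable_times_ennreal) (simp_all, measurable)
  have "(\<lambda>w. \<integral>\<^sup>+\<omega>. ennreal (exp (- (norm (w - B u \<omega>))\<^sup>2 / (2 * u\<^sup>2 * (1 - 1 / u)))) * indicator (hitting K m (\<rat> \<inter> {0..u}) w) \<omega> \<partial>M) \<in> borel_measurable lborel"
    by (rule B1.borel_measurable_nn_integral[OF m])
  then have "(\<lambda>w. enn2real (ennreal (damped u w))) \<in> borel_measurable borel"
    unfolding nn_damped[OF assms] by simp
  moreover have "0 \<le> damped u w" for w unfolding damped_def by (intro integral_nonneg_AE) auto
  ultimately show ?thesis by simp
qed

lemma damped_nonneg: "0 \<le> damped u w"
  unfolding damped_def by (intro integral_nonneg_AE) auto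

lemma damped_le:
  assumes "u > 1"
  shows "damped u w \<le> hitting_prob w"
proof -
  have "damped u w \<le> (\<integral>\<omega>. indicator (hitting K m (\<rat> \<inter> {0..}) w) \<omega> \<partial>M)"
    unfolding damped_def
  proof (intro integral_mono damped_integrable assms)
    have "hitting K m (\<rat> \<inter> {0..u}) w \<subseteq> hitting K m (\<rat> \<inter> {0..}) w" by (intro hitting_mono) auto
    then show "exp (- (norm (w - B u \<omega>))\<^sup>2 / (2 * u\<^sup>2 * (1 - 1 / u))) * indicator (hitting K m (\<rat> \<inter> {0..u}) w) \<omega>
       \<le> (indicator (hitting K m (\<rat> \<inter> {0..}) w) \<omega> :: real)" for \<omega>
      using assms by (auto split: split_indicator)
  qed (auto simp: less_top[symmetric])
  then show ?thesis by (simp add: hitting_prob_def Int_absorb2 sets.sets_into_space[OF hitting_rat_sets(1)])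
qed

text \<open>From exp(-x) >= 1 - x and |w - B|^2 <= 2|w|^2 + 2|B|^2 with E|B(u)|^2 = 2u, the loss by
  damping is of order 1/u for fixed w.\<close>

lemma damped_ge:
  assumes u: "u > 1"
  shows "measure M (hitting K m (\<rat> \<inter> {0..u}) w) - ((norm w)\<^sup>2 + 2 * u) / (u\<^sup>2 * (1 - 1 / u)) \<le> damped u w"
proof -
  let ?c = "2 * u\<^sup>2 * (1 - 1 / u)"
  have c: "?c > 0" using u by simp
  have "(\<integral>\<omega>. indicator (hitting K m (\<rat> \<inter> {0..u}) w) \<omega> - (2 * (norm w)\<^sup>2 + 2 * (norm (B u \<omega>))\<^sup>2) / ?c \<partial>M)
     \<le> damped u w"
    unfolding damped_def
  proof (intro integral_mono damped_integrable u)
    show "integrable M (\<lambda>\<omega>. indicator (hitting K m (\<rat> \<inter> {0..u}) w) \<omega> - (2 * (norm w)\<^sup>2 + 2 * (norm (B u \<omega>))\<^sup>2) / ?c)"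
      using second_moment_B(1)[of u] u by (intro Bochner_Integration.integrable_diff) (auto simp: less_top[symmetric])
    fix \<omega>
    have "(norm (w - B u \<omega>))\<^sup>2 \<le> (norm w + norm (B u \<omega>))\<^sup>2" by (intro power_mono norm_triangle_ineq4) auto
    also have "\<dots> \<le> 2 * (norm w)\<^sup>2 + 2 * (norm (B u \<omega>))\<^sup>2"
      using zero_le_power2[of "norm w - norm (B u \<omega>)"] by (simp add: power2_sum power2_diff)
    finally have "(norm (w - B u \<omega>))\<^sup>2 / ?c \<le> (2 * (norm w)\<^sup>2 + 2 * (norm (B u \<omega>))\<^sup>2) / ?c"
      using c by (intro divide_right_mono) auto
    moreover have "1 - (norm (w - B u \<omega>))\<^sup>2 / ?c \<le> exp (- (norm (w - B u \<omega>))\<^sup>2 / ?c)"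
      using exp_ge_add_one_self[of "- (norm (w - B u \<omega>))\<^sup>2 / ?c"] by simp
    moreover have "0 \<le> (2 * (norm w)\<^sup>2 + 2 * (norm (B u \<omega>))\<^sup>2) / ?c" using c by simp
    ultimately show "indicator (hitting K m (\<rat> \<inter> {0..u}) w) \<omega> - (2 * (norm w)\<^sup>2 + 2 * (norm (B u \<omega>))\<^sup>2) / ?c
      \<le> exp (- (norm (w - B u \<omega>))\<^sup>2 / ?c) * indicator (hitting K m (\<rat> \<inter> {0..u}) w) \<omega>"
      by (cases "\<omega> \<in> hitting K m (\<rat> \<inter> {0..u}) w") (simp_all only: indicator_simps, simp_all)
  qed
  also have "(\<integral>\<omega>. indicator (hitting K m (\<rat> \<inter> {0..u}) w) \<omega> - (2 * (norm w)\<^sup>2 + 2 * (norm (B u \<omega>))\<^sup>2) / ?c \<partial>M)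
     = measure M (hitting K m (\<rat> \<inter> {0..u}) w) - (2 * (norm w)\<^sup>2 + 2 * (2 * u)) / ?c"
    using second_moment_B[of u] u
    by (subst Bochner_Integration.integral_diff)
      (auto simp: less_top[symmetric] B1.prob_space Int_absorb2 sets.sets_into_space[OF hitting_rat_sets(2)])
  also have "(2 * (norm w)\<^sup>2 + 2 * (2 * u)) / ?c = ((norm w)\<^sup>2 + 2 * u) / (u\<^sup>2 * (1 - 1 / u))"
  proof -
    have "2 * (norm w)\<^sup>2 + 2 * (2 * u) = 2 * ((norm w)\<^sup>2 + 2 * u)" "?c = 2 * (u\<^sup>2 * (1 - 1 / u))" by simp_all
    then show ?thesis by (simp only: mult_divide_mult_cancel_left_if) simp
  qed
  finally show ?thesis .
qed

lemma tendsto_hitting_upto: "((\<lambda>u. measure M (hitting K m (\<rat> \<inter> {0..u}) w)) \<longlongrightarrow> hitting_prob w) at_top"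
proof -
  let ?H = "\<lambda>n::nat. hitting K m (\<rat> \<inter> {0..real n}) w"
  have "(\<Union>n. ?H n) = hitting K m (\<rat> \<inter> {0..}) w"
  proof
    show "(\<Union>n. ?H n) \<subseteq> hitting K m (\<rat> \<inter> {0..}) w" by (auto simp: hitting_def)
    show "hitting K m (\<rat> \<inter> {0..}) w \<subseteq> (\<Union>n. ?H n)"
    proof
      fix \<omega> assume "\<omega> \<in> hitting K m (\<rat> \<inter> {0..}) w"
      then obtain s where s: "\<omega> \<in> space M" "s \<in> \<rat> \<inter> {0..}" "B s \<omega> - s *\<^sub>R m - w \<in> K" by (auto simp: hitting_def)
      obtain n where "s \<le> real n" using real_arch_simple by blast
      then have "s \<in> \<rat> \<inter> {0..real n}" using s by simp
      then have "\<omega> \<in> ?H n" using s unfolding hitting_def by blast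
      then show "\<omega> \<in> (\<Union>n. ?H n)" by blast
    qed
  qed
  moreover have "incseq ?H" by (intro monoI hitting_mono) auto
  ultimately have lim: "(\<lambda>n. measure M (?H n)) \<longlonglongrightarrow> hitting_prob w"
    using B1.finite_Lim_measure_incseq[of ?H] hitting_rat_sets(2) unfolding hitting_prob_def by (simp add: image_subset_iff)
  \<comment> \<open>Continuity of the measure works along integer horizons; the floor of u transfers
    it to real u, with monotonicity in between.\<close>
  have fl: "filterlim (\<lambda>u::real. nat \<lfloor>u\<rfloor>) sequentially at_top"
    by (rule filterlim_compose[OF filterlim_nat_sequentially filterlim_floor_sequentially])
  show ?thesis
  proof (rule tendsto_sandwich)
    show "((\<lambda>u::real. measure M (?H (nat \<lfloor>u\<rfloor>))) \<longlongrightarrow> hitting_prob w) at_top" by (rule filterlim_compose[OF lim fl])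
    show "((\<lambda>_. hitting_prob w) \<longlongrightarrow> hitting_prob w) at_top" by simp
    show "\<forall>\<^sub>F u in at_top. measure M (?H (nat \<lfloor>u\<rfloor>)) \<le> measure M (hitting K m (\<rat> \<inter> {0..u}) w)"
      using eventually_ge_at_top[of 0]
    proof eventually_elim
      case (elim u)
      then have "real (nat \<lfloor>u\<rfloor>) \<le> u" by simp
      then have "?H (nat \<lfloor>u\<rfloor>) \<subseteq> hitting K m (\<rat> \<inter> {0..u}) w" by (intro hitting_mono) auto
      then show ?case by (intro B1.finite_measure_mono) auto
    qed
    show "\<forall>\<^sub>F u in at_top. measure M (hitting K m (\<rat> \<inter> {0..u}) w) \<le> hitting_prob w"
      unfolding hitting_prob_def by (intro always_eventually allI B1.finite_measure_mono hitting_mono) auto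
  qed
qed

lemma tendsto_damped: "((\<lambda>u. damped u w) \<longlongrightarrow> hitting_prob w) at_top"
proof (rule tendsto_sandwich)
  have "((\<lambda>u. ((norm w)\<^sup>2 + 2 * u) / (u\<^sup>2 * (1 - 1 / u))) \<longlongrightarrow> 0) at_top" by real_asymp
  from tendsto_diff[OF tendsto_hitting_upto this]
  show "((\<lambda>u. measure M (hitting K m (\<rat> \<inter> {0..u}) w) - ((norm w)\<^sup>2 + 2 * u) / (u\<^sup>2 * (1 - 1 / u))) \<longlongrightarrow> hitting_prob w) at_top"
    by simp
  show "\<forall>\<^sub>F u in at_top. measure M (hitting K m (\<rat> \<inter> {0..u}) w) - ((norm w)\<^sup>2 + 2 * u) / (u\<^sup>2 * (1 - 1 / u)) \<le> damped u w"
    using eventually_gt_at_top[of 1] by eventually_elim (rule damped_ge)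
  show "\<forall>\<^sub>F u in at_top. damped u w \<le> hitting_prob w"
    using eventually_gt_at_top[of 1] by eventually_elim (rule damped_le)
qed simp

lemma hitting_prob_decay: "exp (m \<bullet> w) * hitting_prob w \<le> exp (- \<epsilon> * norm w)"
  unfolding hitting_prob_def using hitting_decay[of K \<epsilon> m] eps dual by auto

lemma hitting_prob_nonneg: "0 \<le> hitting_prob w"
  by (simp add: hitting_prob_def)

lemma integrable_hitting: "integrable lborel (\<lambda>w. exp (m \<bullet> w) * hitting_prob w)"
  by (rule Bochner_Integration.integrable_bound[OF integrable_exp_neg_norm[OF eps(1)]])
    (use hitting_prob_decay hitting_prob_nonneg in auto)

text \<open>For -w in K the path is inside the target already at time 0, so the hitting probability
  is 1 on a nonempty open set, and such a set is not Lebesgue null.\<close>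

lemma integral_hitting_pos: "0 < (\<integral>w. exp (m \<bullet> w) * hitting_prob w \<partial>lborel)"
proof -
  have one: "hitting_prob w = 1" if w: "- w \<in> K" for w
  proof -
    have "AE \<omega> in M. \<omega> \<in> hitting K m (\<rat> \<inter> {0..}) w"
      using B_start AE_space
    proof eventually_elim
      case (elim \<omega>)
      then have "B 0 \<omega> - 0 *\<^sub>R m - w \<in> K" using w by simp
      then show ?case using elim unfolding hitting_def by (intro CollectI conjI bexI[of _ 0]) auto
    qed
    then show ?thesis unfolding hitting_prob_def by (subst B1.prob_eq_1) auto
  qed
  let ?U = "uminus ` K"
  have openU: "open ?U" using open_K by (rule open_negations)
  have "?U \<noteq> {}" using K_nonempty by simp
  have "0 \<noteq> (\<integral>w. exp (m \<bullet> w) * hitting_prob w \<partial>lborel)"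
  proof
    assume "0 = (\<integral>w. exp (m \<bullet> w) * hitting_prob w \<partial>lborel)"
    then have "AE w in lborel. exp (m \<bullet> w) * hitting_prob w = 0"
      using integral_nonneg_eq_0_iff_AE[OF integrable_hitting] hitting_prob_nonneg by simp
    then have "AE w in lborel. w \<notin> ?U"
    proof eventually_elim
      case (elim w)
      show ?case
      proof
        assume "w \<in> ?U"
        then have "- w \<in> K" by (metis imageE minus_minus)
        from one[OF this] elim show False by simp
      qed
    qed
    then have "?U \<in> null_sets lborel"
      using openU by (subst (asm) AE_iff_null_sets[symmetric]) auto
    then have "negligible ?U" using null_sets_completionI negligible_iff_null_sets by blast
    then show False using open_not_negligible[OF openU \<open>?U \<noteq> {}\<close>] by simp
  qed
  moreover have "0 \<le> (\<integral>w. exp (m \<bullet> w) * hitting_prob w \<partial>lborel)"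
    using hitting_prob_nonneg by (intro integral_nonneg_AE) auto
  ultimately show ?thesis by simp
qed

text \<open>For large u the perturbation (\<gamma> . w)/u costs at most half of the decay rate
  \<epsilon>; the other half is a majorant independent of u.\<close>

lemma tilted_bound:
  assumes u: "u > 1" "u \<ge> 2 * norm \<gamma> / \<epsilon>"
  shows "norm (exp ((u *\<^sub>R m + \<gamma>) \<bullet> w / u) * damped u w) \<le> exp (- (\<epsilon> / 2) * norm w)"
proof -
  have "norm \<gamma> / u \<le> \<epsilon> / 2" using u eps by (simp add: field_simps)
  have "(u *\<^sub>R m + \<gamma>) \<bullet> w / u = m \<bullet> w + (\<gamma> \<bullet> w) / u" using u by (simp add: inner_add_left add_divide_distrib)
  also have "(\<gamma> \<bullet> w) / u \<le> (norm \<gamma> * norm w) / u" using u by (intro divide_right_mono norm_cauchy_schwarz) auto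
  also have "(norm \<gamma> * norm w) / u = norm \<gamma> / u * norm w" by simp
  also have "\<dots> \<le> \<epsilon> / 2 * norm w" by (intro mult_right_mono \<open>norm \<gamma> / u \<le> \<epsilon> / 2\<close>) simp
  finally have "exp ((u *\<^sub>R m + \<gamma>) \<bullet> w / u) \<le> exp (\<epsilon> / 2 * norm w) * exp (m \<bullet> w)"
    unfolding exp_add[symmetric] by simp
  then have "exp ((u *\<^sub>R m + \<gamma>) \<bullet> w / u) * damped u w \<le> (exp (\<epsilon> / 2 * norm w) * exp (m \<bullet> w)) * hitting_prob w"
    using damped_nonneg damped_le[OF u(1)] by (intro mult_mono) auto
  also have "\<dots> \<le> exp (\<epsilon> / 2 * norm w) * exp (- \<epsilon> * norm w)"
    unfolding mult.assoc by (intro mult_left_mono hitting_prob_decay) simp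
  also have "\<dots> = exp (- (\<epsilon> / 2) * norm w)" unfolding exp_add[symmetric] by simp
  finally show ?thesis using damped_nonneg[of u w] by simp
qed

lemma integrable_tilted:
  assumes u: "u > 1" "u \<ge> 2 * norm \<gamma> / \<epsilon>"
  shows "integrable lborel (\<lambda>w. exp ((u *\<^sub>R m + \<gamma>) \<bullet> w / u) * damped u w)"
proof (rule Bochner_Integration.integrable_bound)
  show "integrable lborel (\<lambda>w :: real \<times> real. exp (- (\<epsilon> / 2) * norm w))" using eps by (intro integrable_exp_neg_norm) simp
  note measurable_damped[OF u(1), measurable]
  show "(\<lambda>w. exp ((u *\<^sub>R m + \<gamma>) \<bullet> w / u) * damped u w) \<in> borel_measurable lborel" by measurable
  show "AE w in lborel. norm (exp ((u *\<^sub>R m + \<gamma>) \<bullet> w / u) * damped u w) \<le> norm (exp (- (\<epsilon> / 2) * norm w))"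
    using tilted_bound[OF u] by simp
qed

lemma tendsto_tilted:
  "((\<lambda>u. \<integral>w. exp ((u *\<^sub>R m + \<gamma>) \<bullet> w / u) * damped u w \<partial>lborel) \<longlongrightarrow> (\<integral>w. exp (m \<bullet> w) * hitting_prob w \<partial>lborel)) at_top"
proof -
  have ev: "\<forall>\<^sub>F u in at_top. u > 1 \<and> u \<ge> 2 * norm \<gamma> / \<epsilon>"
    by (intro eventually_conj eventually_gt_at_top eventually_ge_at_top)
  \<comment> \<open>The value 0 for u <= 1 makes the integrand measurable for every u, as the
    continuous-parameter form of dominated convergence requires.\<close>
  define s where "s u w = (if u > 1 then exp ((u *\<^sub>R m + \<gamma>) \<bullet> w / u) * damped u w else 0)" for u w
  have "((\<lambda>u. \<integral>w. s u w \<partial>lborel) \<longlongrightarrow> (\<integral>w. exp (m \<bullet> w) * hitting_prob w \<partial>lborel)) at_top"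
  proof (rule integral_dominated_convergence_at_top)
    show "integrable lborel (\<lambda>w :: real \<times> real. exp (- (\<epsilon> / 2) * norm w))" using eps by (intro integrable_exp_neg_norm) simp
    show "(\<lambda>w. exp (m \<bullet> w) * hitting_prob w) \<in> borel_measurable lborel" by measurable
    show "s u \<in> borel_measurable lborel" for u
    proof (cases "u > 1")
      case True
      note measurable_damped[OF True, measurable]
      show ?thesis using True unfolding s_def by simp
    qed (simp add: s_def[abs_def])
    show "\<forall>\<^sub>F u in at_top. AE w in lborel. norm (s u w) \<le> exp (- (\<epsilon> / 2) * norm w)"
      using ev by eventually_elim (use tilted_bound in \<open>auto simp: s_def\<close>)
    show "AE w in lborel. ((\<lambda>u. s u w) \<longlongrightarrow> exp (m \<bullet> w) * hitting_prob w) at_top"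
    proof (rule AE_I2)
      fix w
      have "((\<lambda>u. m \<bullet> w + (\<gamma> \<bullet> w) / u) \<longlongrightarrow> m \<bullet> w) at_top" by real_asymp
      then have "((\<lambda>u. exp (m \<bullet> w + (\<gamma> \<bullet> w) / u) * damped u w) \<longlongrightarrow> exp (m \<bullet> w) * hitting_prob w) at_top"
        by (intro tendsto_intros tendsto_damped)
      moreover have "\<forall>\<^sub>F u in at_top. exp (m \<bullet> w + (\<gamma> \<bullet> w) / u) * damped u w = s u w"
        using eventually_gt_at_top[of 1]
        by eventually_elim (simp add: s_def inner_add_left add_divide_distrib)
      ultimately show "((\<lambda>u. s u w) \<longlongrightarrow> exp (m \<bullet> w) * hitting_prob w) at_top"
        by (rule Lim_transform_eventually)
    qed
  qed
  moreover have "\<forall>\<^sub>F u in at_top. (\<integral>w. s u w \<partial>lborel) = (\<integral>w. exp ((u *\<^sub>R m + \<gamma>) \<bullet> w / u) * damped u w \<partial>lborel)"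
    using eventually_gt_at_top[of 1] by eventually_elim (simp add: s_def)
  ultimately show ?thesis by (rule Lim_transform_eventually)
qed

definition exit_prob :: "real set \<Rightarrow> real \<Rightarrow> real" where
  "exit_prob I u = measure M {\<omega>\<in>space M. \<exists>t\<in>I. B t \<omega> - t *\<^sub>R \<gamma> - u *\<^sub>R m \<in> K}"

lemma exit_sets:
  assumes "a < b" "0 \<le> a"
  shows "{\<omega>\<in>space M. \<exists>t\<in>{a..b}. B t \<omega> - t *\<^sub>R \<gamma> - u *\<^sub>R m \<in> K} \<in> sets M"
proof -
  have "{\<omega>\<in>space M. \<exists>t\<in>{a..b}. B t \<omega> - t *\<^sub>R \<gamma> - u *\<^sub>R m \<in> K} = {\<omega>\<in>space M. \<exists>t\<in>\<rat> \<inter> {a..b}. B t \<omega> - t *\<^sub>R \<gamma> - u *\<^sub>R m \<in> K}"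
    using assms
    by (intro Collect_cong conj_cong ex_rational_in_open open_K closure_rational_atLeastAtMost continuous_intros
        continuous_on_subset[OF continuous_B]) auto
  also have "\<dots> \<in> sets M"
    using assms by (intro sets_Collect_bex_countable countable_Rats_Int borel_measurable_diff measurable_B) auto
  finally show ?thesis .
qed

lemma late_exit_prob:
  assumes u: "u > 1" "u \<ge> 2 * norm \<gamma> / \<epsilon>"
  shows "exit_prob {1 - 1 / u..1} u = exp (- (norm (u *\<^sub>R m + \<gamma>))\<^sup>2 / 2) / (2 * pi * (1 - 1 / u) * u\<^sup>2) *
     (\<integral>w. exp ((u *\<^sub>R m + \<gamma>) \<bullet> w / u) * damped u w \<partial>lborel)"
proof -
  have u0: "u > 0" using u by simp
  have img: "{1 - 1 / u..1} = (\<lambda>s. 1 - s / u\<^sup>2) ` {0..u}"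
  proof
    show "(\<lambda>s. 1 - s / u\<^sup>2) ` {0..u} \<subseteq> {1 - 1 / u..1}" using u0 by (auto simp: field_simps power2_eq_square)
    show "{1 - 1 / u..1} \<subseteq> (\<lambda>s. 1 - s / u\<^sup>2) ` {0..u}"
    proof
      fix t assume t: "t \<in> {1 - 1 / u..1}"
      have "u\<^sup>2 * (1 - t) \<le> u\<^sup>2 * (1 / u)" using t by (intro mult_left_mono) auto
      then have "t = 1 - (u\<^sup>2 * (1 - t)) / u\<^sup>2" "u\<^sup>2 * (1 - t) \<in> {0..u}"
        using u0 t by (simp_all add: power2_eq_square)
      then show "t \<in> (\<lambda>s. 1 - s / u\<^sup>2) ` {0..u}" by blast
    qed
  qed
  \<comment> \<open>Rational points are taken in the rescaled time s after the substitution, since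
    these, and not rational t, are the times at which the late exit formula is stated.\<close>
  have eq: "(\<exists>t\<in>{1 - 1 / u..1}. B t \<omega> - t *\<^sub>R \<gamma> - u *\<^sub>R m \<in> K) \<longleftrightarrow>
      (\<exists>s\<in>\<rat> \<inter> {0..u}. B (1 - s / u\<^sup>2) \<omega> - (1 - s / u\<^sup>2) *\<^sub>R \<gamma> - u *\<^sub>R m \<in> K)" if \<omega>: "\<omega> \<in> space M" for \<omega>
  proof -
    have "(\<exists>t\<in>{1 - 1 / u..1}. B t \<omega> - t *\<^sub>R \<gamma> - u *\<^sub>R m \<in> K) \<longleftrightarrow>
      (\<exists>s\<in>{0..u}. B (1 - s / u\<^sup>2) \<omega> - (1 - s / u\<^sup>2) *\<^sub>R \<gamma> - u *\<^sub>R m \<in> K)"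
      unfolding img by simp
    also have "\<dots> \<longleftrightarrow> (\<exists>s\<in>\<rat> \<inter> {0..u}. B (1 - s / u\<^sup>2) \<omega> - (1 - s / u\<^sup>2) *\<^sub>R \<gamma> - u *\<^sub>R m \<in> K)"
    proof (intro ex_rational_in_open open_K closure_rational_atLeastAtMost u0 continuous_intros
        continuous_on_compose2[OF continuous_B[OF \<omega>]])
      show "(\<lambda>s. 1 - s / u\<^sup>2) ` {0..u} \<subseteq> {0..}" using u unfolding img[symmetric] by auto
    qed (use u0 in auto)
    finally show ?thesis .
  qed
  have "emeasure M {\<omega>\<in>space M. \<exists>t\<in>{1 - 1 / u..1}. B t \<omega> - t *\<^sub>R \<gamma> - u *\<^sub>R m \<in> K}
     = emeasure M {\<omega>\<in>space M. \<exists>s\<in>\<rat> \<inter> {0..u}. B (1 - s / u\<^sup>2) \<omega> - (1 - s / u\<^sup>2) *\<^sub>R \<gamma> - u *\<^sub>R m \<in> K}"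
    using eq by (intro arg_cong[of _ _ "emeasure M"] Collect_cong conj_cong) auto
  also have "\<dots> = ennreal (exp (- (norm (u *\<^sub>R m + \<gamma>))\<^sup>2 / 2) / (2 * pi * (1 - 1 / u) * u\<^sup>2)) *
      (\<integral>\<^sup>+w. ennreal (exp ((u *\<^sub>R m + \<gamma>) \<bullet> w / u)) *
         (\<integral>\<^sup>+\<omega>. ennreal (exp (- (norm (w - B u \<omega>))\<^sup>2 / (2 * u\<^sup>2 * (1 - 1 / u)))) * indicator (hitting K m (\<rat> \<inter> {0..u}) w) \<omega> \<partial>M) \<partial>lborel)"
    using u by (intro late_exit_formula sets_K cone countable_Rats_Int) auto
  also have "\<dots> = ennreal (exp (- (norm (u *\<^sub>R m + \<gamma>))\<^sup>2 / 2) / (2 * pi * (1 - 1 / u) * u\<^sup>2)) *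
      (\<integral>\<^sup>+w. ennreal (exp ((u *\<^sub>R m + \<gamma>) \<bullet> w / u) * damped u w) \<partial>lborel)"
    unfolding nn_damped[OF u(1)] by (simp add: ennreal_mult damped_nonneg)
  also have "(\<integral>\<^sup>+w. ennreal (exp ((u *\<^sub>R m + \<gamma>) \<bullet> w / u) * damped u w) \<partial>lborel)
     = ennreal (\<integral>w. exp ((u *\<^sub>R m + \<gamma>) \<bullet> w / u) * damped u w \<partial>lborel)"
    using damped_nonneg by (intro nn_integral_eq_integral integrable_tilted u) auto
  finally have "emeasure M {\<omega>\<in>space M. \<exists>t\<in>{1 - 1 / u..1}. B t \<omega> - t *\<^sub>R \<gamma> - u *\<^sub>R m \<in> K}
    = ennreal (exp (- (norm (u *\<^sub>R m + \<gamma>))\<^sup>2 / 2) / (2 * pi * (1 - 1 / u) * u\<^sup>2)) *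
      ennreal (\<integral>w. exp ((u *\<^sub>R m + \<gamma>) \<bullet> w / u) * damped u w \<partial>lborel)" .
  moreover have "0 \<le> (\<integral>w. exp ((u *\<^sub>R m + \<gamma>) \<bullet> w / u) * damped u w \<partial>lborel)"
    using damped_nonneg by (intro integral_nonneg_AE) auto
  moreover have "0 \<le> exp (- (norm (u *\<^sub>R m + \<gamma>))\<^sup>2 / 2) / (2 * pi * (1 - 1 / u) * u\<^sup>2)" using u by simp
  ultimately show ?thesis
    unfolding exit_prob_def measure_def by (simp add: enn2real_mult)
qed

text \<open>The normaliser is the reciprocal of the Gaussian density at the corner times u^2. Late
  exits give the limit through \<open>tendsto_tilted\<close>; the full exit probability exceeds the
  late one by at most the early one.\<close>

lemma tendsto_exit_prob:
  "((\<lambda>u. exit_prob {0..1} u * (2 * pi * u\<^sup>2 * exp ((norm (u *\<^sub>R m + \<gamma>))\<^sup>2 / 2))) \<longlongrightarrow>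
      (\<integral>w. exp (m \<bullet> w) * hitting_prob w \<partial>lborel)) at_top"
proof -
  define J where "J u = (\<integral>w. exp ((u *\<^sub>R m + \<gamma>) \<bullet> w / u) * damped u w \<partial>lborel)" for u
  define E where "E u = 2 * pi * u\<^sup>2 * exp ((norm (u *\<^sub>R m + \<gamma>))\<^sup>2 / 2)" for u
  \<comment> \<open>The normalised bound for exits before 1 - 1/u. The exponent is -c/u with c =
    (u^2 |m|^2 - |\<gamma>|^2)/2, which beats the factor u^2.\<close>
  define r where "r u = 2 * pi * u\<^sup>2 * exp (- (u * (norm m)\<^sup>2 / 2 - (norm \<gamma>)\<^sup>2 / (2 * u)))" for u
  have E: "E u \<ge> 0" for u by (simp add: E_def)
  have m0: "norm m > 0" using eps by linarith
  have q: "((\<lambda>u::real. 1 / (1 - 1 / u)) \<longlongrightarrow> 1) at_top" by real_asymp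
  have JL: "((\<lambda>u. 1 / (1 - 1 / u) * J u) \<longlongrightarrow> (\<integral>w. exp (m \<bullet> w) * hitting_prob w \<partial>lborel)) at_top"
    using tendsto_mult[OF q tendsto_tilted] by (simp add: J_def)
  have ev: "\<forall>\<^sub>F u in at_top. u > 1 \<and> u \<ge> 2 * norm \<gamma> / \<epsilon>"
    by (intro eventually_conj eventually_gt_at_top eventually_ge_at_top)
  have late: "1 / (1 - 1 / u) * J u = exit_prob {1 - 1 / u..1} u * E u" if u: "u > 1" "u \<ge> 2 * norm \<gamma> / \<epsilon>" for u
  proof -
    have "exp (- (norm (u *\<^sub>R m + \<gamma>))\<^sup>2 / 2) * exp ((norm (u *\<^sub>R m + \<gamma>))\<^sup>2 / 2) = 1"
      unfolding exp_add[symmetric] by simp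
    then have "exit_prob {1 - 1 / u..1} u * E u = J u * ((2 * pi * u\<^sup>2) / (2 * pi * (1 - 1 / u) * u\<^sup>2))"
      unfolding late_exit_prob[OF u] E_def J_def by (simp add: mult_ac)
    also have "(2 * pi * u\<^sup>2) / (2 * pi * (1 - 1 / u) * u\<^sup>2) = 1 / (1 - 1 / u)" using u by simp
    finally show ?thesis by simp
  qed
  have "((\<lambda>u. 1 / (1 - 1 / u) * J u + r u) \<longlongrightarrow> (\<integral>w. exp (m \<bullet> w) * hitting_prob w \<partial>lborel) + 0) at_top"
  proof (intro tendsto_add JL)
    have n: "0 < (norm m)\<^sup>2" using m0 by simp
    show "(r \<longlongrightarrow> 0) at_top" unfolding r_def[abs_def] using n by real_asymp
  qed
  then have JrL: "((\<lambda>u. 1 / (1 - 1 / u) * J u + r u) \<longlongrightarrow> (\<integral>w. exp (m \<bullet> w) * hitting_prob w \<partial>lborel)) at_top"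
    by simp
  have lower: "\<forall>\<^sub>F u in at_top. 1 / (1 - 1 / u) * J u \<le> exit_prob {0..1} u * (2 * pi * u\<^sup>2 * exp ((norm (u *\<^sub>R m + \<gamma>))\<^sup>2 / 2))"
    using ev
  proof eventually_elim
    case (elim u)
    have "exit_prob {1 - 1 / u..1} u \<le> exit_prob {0..1} u"
    proof -
      have sub: "{1 - 1 / u..1} \<subseteq> {0..1}" using elim by auto
      have "{\<omega>\<in>space M. \<exists>t\<in>{1 - 1 / u..1}. B t \<omega> - t *\<^sub>R \<gamma> - u *\<^sub>R m \<in> K} \<subseteq> {\<omega>\<in>space M. \<exists>t\<in>{0..1}. B t \<omega> - t *\<^sub>R \<gamma> - u *\<^sub>R m \<in> K}"
        using sub by blast
      then show ?thesis
        unfolding exit_prob_def by (intro B1.finite_measure_mono exit_sets) simp_all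
    qed
    then show ?case using late[of u] elim E[of u] unfolding E_def[symmetric] by (simp add: mult_right_mono)
  qed
  have upper: "\<forall>\<^sub>F u in at_top. exit_prob {0..1} u * (2 * pi * u\<^sup>2 * exp ((norm (u *\<^sub>R m + \<gamma>))\<^sup>2 / 2)) \<le> 1 / (1 - 1 / u) * J u + r u"
    using ev eventually_ge_at_top[of "norm \<gamma> / norm m"]
  proof eventually_elim
    case (elim u)
    let ?\<theta> = "u *\<^sub>R m + \<gamma>"
    have u: "u > 1" "u \<ge> 2 * norm \<gamma> / \<epsilon>" "u \<ge> norm \<gamma> / norm m" using elim by auto
    let ?c = "(norm ?\<theta>)\<^sup>2 / 2 - ?\<theta> \<bullet> \<gamma>"
    have c: "?c = (u\<^sup>2 * (norm m)\<^sup>2 - (norm \<gamma>)\<^sup>2) / 2"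
    proof -
      have "(norm ?\<theta>)\<^sup>2 = u\<^sup>2 * (norm m)\<^sup>2 + 2 * u * (m \<bullet> \<gamma>) + (norm \<gamma>)\<^sup>2"
        using dot_norm[of "u *\<^sub>R m" \<gamma>] by (simp add: power_mult_distrib)
      moreover have "?\<theta> \<bullet> \<gamma> = u * (m \<bullet> \<gamma>) + (norm \<gamma>)\<^sup>2"
        by (simp add: inner_add_left power2_norm_eq_inner)
      ultimately show ?thesis by (simp add: add_divide_distrib diff_divide_distrib)
    qed
    have "norm \<gamma> \<le> u * norm m" using u(3) m0 by (simp add: field_simps)
    then have "(norm \<gamma>)\<^sup>2 \<le> (u * norm m)\<^sup>2" by (intro power_mono) auto
    then have c0: "0 \<le> ?c" unfolding c by (simp add: power_mult_distrib)
    have early: "exit_prob {0..1 - 1 / u} u \<le> exp (- (norm ?\<theta>)\<^sup>2 / 2 - 1 / u * ?c)"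
      unfolding exit_prob_def
    proof (rule early_exit_bound)
      fix k assume k: "k \<in> K"
      \<comment> \<open>The margin of m on K absorbs \<gamma> once u is large, so the corner itself
        is nonnegative on K.\<close>
      have "- (\<gamma> \<bullet> k) \<le> norm \<gamma> * norm k" using norm_cauchy_schwarz[of "-\<gamma>" k] by simp
      also have "\<dots> \<le> u * \<epsilon> * norm k"
      proof (intro mult_right_mono)
        have "2 * norm \<gamma> \<le> u * \<epsilon>" using u(2) eps(1) by (simp add: field_simps)
        then show "norm \<gamma> \<le> u * \<epsilon>" using norm_ge_zero[of \<gamma>] by linarith
      qed simp
      also have "\<dots> \<le> u * (m \<bullet> k)" using dual[OF k] u by (simp add: mult.assoc)
      finally show "0 \<le> ?\<theta> \<bullet> k" by (simp add: inner_add_left)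
    qed (use u c0 open_K in auto)
    have "exp (- (norm ?\<theta>)\<^sup>2 / 2 - 1 / u * ?c) * E u = 2 * pi * u\<^sup>2 * exp (- 1 / u * ?c)"
    proof -
      have "exp (- (norm ?\<theta>)\<^sup>2 / 2 - 1 / u * ?c) * exp ((norm ?\<theta>)\<^sup>2 / 2) = exp (- 1 / u * ?c)"
        unfolding exp_add[symmetric] by simp
      then show ?thesis unfolding E_def by (subst mult.left_commute) simp
    qed
    also have "- 1 / u * ?c = - (u * (norm m)\<^sup>2 / 2 - (norm \<gamma>)\<^sup>2 / (2 * u))"
      unfolding c using u by (simp add: field_simps power2_eq_square)
    finally have early': "exit_prob {0..1 - 1 / u} u * E u \<le> r u"
      using mult_right_mono[OF early E[of u]] by (simp add: r_def)
    have "exit_prob {0..1} u \<le> exit_prob {0..1 - 1 / u} u + exit_prob {1 - 1 / u..1} u"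
    proof -
      have sub: "{\<omega>\<in>space M. \<exists>t\<in>{0..1}. B t \<omega> - t *\<^sub>R \<gamma> - u *\<^sub>R m \<in> K}
         \<subseteq> {\<omega>\<in>space M. \<exists>t\<in>{0..1 - 1 / u}. B t \<omega> - t *\<^sub>R \<gamma> - u *\<^sub>R m \<in> K} \<union>
            {\<omega>\<in>space M. \<exists>t\<in>{1 - 1 / u..1}. B t \<omega> - t *\<^sub>R \<gamma> - u *\<^sub>R m \<in> K}"
      proof
        fix \<omega> assume "\<omega> \<in> {\<omega>\<in>space M. \<exists>t\<in>{0..1}. B t \<omega> - t *\<^sub>R \<gamma> - u *\<^sub>R m \<in> K}"
        then obtain t where t: "\<omega> \<in> space M" "t \<in> {0..1}" "B t \<omega> - t *\<^sub>R \<gamma> - u *\<^sub>R m \<in> K" by blast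
        then have "t \<in> {0..1 - 1 / u} \<or> t \<in> {1 - 1 / u..1}" by auto
        then show "\<omega> \<in> {\<omega>\<in>space M. \<exists>t\<in>{0..1 - 1 / u}. B t \<omega> - t *\<^sub>R \<gamma> - u *\<^sub>R m \<in> K} \<union>
            {\<omega>\<in>space M. \<exists>t\<in>{1 - 1 / u..1}. B t \<omega> - t *\<^sub>R \<gamma> - u *\<^sub>R m \<in> K}" using t by blast
      qed
      have 1: "{\<omega>\<in>space M. \<exists>t\<in>{0..1 - 1 / u}. B t \<omega> - t *\<^sub>R \<gamma> - u *\<^sub>R m \<in> K} \<in> sets M"
         "{\<omega>\<in>space M. \<exists>t\<in>{1 - 1 / u..1}. B t \<omega> - t *\<^sub>R \<gamma> - u *\<^sub>R m \<in> K} \<in> sets M"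
        using u by (auto intro!: exit_sets)
      show ?thesis
        unfolding exit_prob_def by (rule order_trans[OF B1.finite_measure_mono[OF sub sets.Un[OF 1]] measure_Un_le[OF 1]])
    qed
    then have "exit_prob {0..1} u * E u \<le> (exit_prob {0..1 - 1 / u} u + exit_prob {1 - 1 / u..1} u) * E u"
      by (intro mult_right_mono E)
    also have "\<dots> \<le> 1 / (1 - 1 / u) * J u + r u"
      using early' late[OF u(1,2)] by (simp add: distrib_right)
    finally show ?case by (simp add: E_def)
  qed
  show ?thesis by (rule tendsto_sandwich[OF lower upper JL JrL])
qed

end

section \<open>The reflection principle\<close>

definition partial_sum :: "(nat \<Rightarrow> real) \<Rightarrow> nat \<Rightarrow> real" where
  "partial_sum x k = (\<Sum>i<k. x i)"

text \<open>The discrete path reflected after its first passage above u: the sign of increment i is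
  decided by the partial sums up to i, which do not contain that increment.\<close>

definition reflected_sum :: "real \<Rightarrow> (nat \<Rightarrow> real) \<Rightarrow> nat \<Rightarrow> real" where
  "reflected_sum u x k = (\<Sum>i<k. if \<exists>j\<le>i. partial_sum x j > u then - x i else x i)"

lemma reflected_sum_Suc:
  "reflected_sum u x (Suc n) = reflected_sum u x n + (if \<exists>j\<le>n. partial_sum x j > u then - x n else x n)"
  by (simp only: reflected_sum_def sum.lessThan_Suc)

lemma reflected_sum_no_hit:
  assumes "\<And>j. j < k \<Longrightarrow> partial_sum x j \<le> u"
  shows "reflected_sum u x k = partial_sum x k"
  unfolding reflected_sum_def partial_sum_def[of x k]
proof (rule sum.cong)
  fix i assume "i \<in> {..<k}"
  then have "\<not> (\<exists>j\<le>i. partial_sum x j > u)" using assms by (auto simp: not_less)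
  then show "(if \<exists>j\<le>i. partial_sum x j > u then - x i else x i) = x i" by (rule if_not_P)
qed simp

text \<open>From the first passage on, the two walks move in opposite directions. The mirror is the
  value at passage, not u itself; the overshoot between them is why the discrete principle gives two
  inequalities.\<close>

lemma reflected_sum_hit:
  assumes "partial_sum x l > u" "\<And>j. j < l \<Longrightarrow> partial_sum x j \<le> u" "l \<le> k"
  shows "reflected_sum u x k + partial_sum x k = 2 * partial_sum x l"
  using \<open>l \<le> k\<close>
proof (induction k rule: dec_induct)
  case base
  then show ?case using reflected_sum_no_hit[of l x u] assms by simp
next
  case (step k)
  have "\<exists>j\<le>k. partial_sum x j > u" using assms step by blast
  then have "reflected_sum u x (Suc k) = reflected_sum u x k - x k" by (simp add: reflected_sum_def)
  then show ?case using step.IH by (simp add: partial_sum_def)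
qed

lemma first_hit:
  assumes "\<exists>j\<le>n. partial_sum x j > u"
  obtains l where "l \<le> n" "partial_sum x l > u" "\<And>j. j < l \<Longrightarrow> partial_sum x j \<le> u"
proof
  let ?l = "LEAST j. partial_sum x j > u"
  obtain j where j: "j \<le> n" "partial_sum x j > u" using assms by blast
  show "partial_sum x ?l > u" by (rule LeastI[of _ j]) (rule j)
  show "?l \<le> n" using Least_le[of "\<lambda>j. partial_sum x j > u" j] j by simp
  show "partial_sum x i \<le> u" if "i < ?l" for i using not_less_Least[OF that] by simp
qed

lemma partial_sum_cong: "(\<And>i. i < k \<Longrightarrow> x i = y i) \<Longrightarrow> partial_sum x k = partial_sum y k"
  unfolding partial_sum_def by (intro sum.cong) auto

lemma reflected_sum_cong:
  assumes "\<And>i. i < k \<Longrightarrow> x i = y i"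
  shows "reflected_sum u x k = reflected_sum u y k"
  unfolding reflected_sum_def
proof (rule sum.cong)
  fix i assume i: "i \<in> {..<k}"
  have "partial_sum x j = partial_sum y j" if "j \<le> i" for j
    using i that assms by (intro partial_sum_cong) auto
  then show "(if \<exists>j\<le>i. partial_sum x j > u then - x i else x i) = (if \<exists>j\<le>i. partial_sum y j > u then - y i else y i)"
    using i assms by auto
qed simp

lemma measurable_partial_sum:
  assumes "\<And>i. sets (N i) = sets borel" "k \<le> m"
  shows "(\<lambda>x. partial_sum x k) \<in> borel_measurable (PiM {..<m} N)"
  unfolding partial_sum_def
proof (rule borel_measurable_sum)
  fix i assume "i \<in> {..<k}"
  then show "(\<lambda>x. x i) \<in> borel_measurable (PiM {..<m} N)"
    using assms measurable_component_singleton[of i "{..<m}" N] by (simp add: measurable_cong_sets[OF refl assms(1)])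
qed

lemma measurable_reflected_sum:
  assumes "\<And>i. sets (N i) = sets borel" "k \<le> m"
  shows "(\<lambda>x. reflected_sum u x k) \<in> borel_measurable (PiM {..<m} N)"
  unfolding reflected_sum_def
proof (rule borel_measurable_sum)
  fix i assume i: "i \<in> {..<k}"
  have [measurable]: "(\<lambda>x. x i) \<in> borel_measurable (PiM {..<m} N)"
    using assms i measurable_component_singleton[of i "{..<m}" N] by (simp add: measurable_cong_sets[OF refl assms(1)])
  have "{x\<in>space (PiM {..<m} N). \<exists>j\<in>{..i}. partial_sum x j \<in> {u<..}} \<in> sets (PiM {..<m} N)"
    using i assms by (intro sets_Collect_bex_countable measurable_partial_sum) auto
  then have "{x\<in>space (PiM {..<m} N). \<exists>j\<le>i. partial_sum x j > u} \<in> sets (PiM {..<m} N)"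
    by (simp only: Bex_def atMost_iff greaterThan_iff)
  then show "(\<lambda>x. if \<exists>j\<le>i. partial_sum x j > u then - x i else x i) \<in> borel_measurable (PiM {..<m} N)"
    by (rule measurable_If[rotated 2]) measurable
qed

text \<open>Condition on all coordinates but the last: its sign flip is then fixed, and symmetry of
  its law removes it. The induction runs over all test functions F because this step replaces F by
  its average G.\<close>

lemma nn_integral_reflected_sum:
  assumes N: "\<And>i. prob_space (N i)" "\<And>i. sets (N i) = sets borel"
    and sym: "\<And>i f. f \<in> borel_measurable borel \<Longrightarrow> (\<integral>\<^sup>+y. f (- y) \<partial>N i) = (\<integral>\<^sup>+y. f y \<partial>N i)"
    and F: "F \<in> borel_measurable borel"
  shows "(\<integral>\<^sup>+x. F (reflected_sum u x n) \<partial>PiM {..<n} N) = (\<integral>\<^sup>+x. F (partial_sum x n) \<partial>PiM {..<n} N)"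
  using F
proof (induction n arbitrary: F)
  case 0
  then show ?case by (simp add: reflected_sum_def partial_sum_def)
next
  case (Suc n)
  note F = Suc.prems
  interpret product_prob_space N UNIV using N by (intro product_prob_spaceI)
  have shift: "(\<lambda>y. F (s + y)) \<in> borel_measurable borel" for s
    by (rule measurable_compose[OF _ F]) simp
  define G where "G s = (\<integral>\<^sup>+y. F (s + y) \<partial>N n)" for s
  have "sets (borel \<Otimes>\<^sub>M N n) = sets (borel \<Otimes>\<^sub>M (borel :: real measure))"
    by (intro sets_pair_measure_cong) (auto simp: N)
  then have "(\<lambda>(s, y). F (s + y)) \<in> borel_measurable (borel \<Otimes>\<^sub>M N n)"
    unfolding case_prod_beta' by (subst measurable_cong_sets[OF _ refl], assumption) (rule measurable_compose[OF _ F], simp)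
  then have G: "G \<in> borel_measurable borel"
    unfolding G_def by (rule sigma_finite_measure.borel_measurable_nn_integral[OF prob_space_imp_sigma_finite[OF N(1)]])
  have ins: "(\<integral>\<^sup>+x. F (h x) \<partial>PiM {..<Suc n} N) = (\<integral>\<^sup>+x. \<integral>\<^sup>+y. F (h (x(n := y))) \<partial>N n \<partial>PiM {..<n} N)"
    if "h \<in> borel_measurable (PiM {..<Suc n} N)" for h
    unfolding lessThan_Suc using measurable_compose[OF that F] unfolding lessThan_Suc
    by (intro product_nn_integral_insert) auto
  have refl: "(\<integral>\<^sup>+y. F (reflected_sum u (x(n := y)) (Suc n)) \<partial>N n) = G (reflected_sum u x n)" for x
  proof -
    have "reflected_sum u (x(n := y)) n = reflected_sum u x n" for y by (rule reflected_sum_cong) simp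
    moreover have "(\<exists>j\<le>n. partial_sum (x(n := y)) j > u) = (\<exists>j\<le>n. partial_sum x j > u)" for y
    proof -
      have "partial_sum (x(n := y)) j = partial_sum x j" if "j \<le> n" for j
        using that by (intro partial_sum_cong) auto
      then show ?thesis by (simp cong: conj_cong)
    qed
    ultimately have eq: "reflected_sum u (x(n := y)) (Suc n) = reflected_sum u x n + (if \<exists>j\<le>n. partial_sum x j > u then - y else y)" for y
      by (simp only: reflected_sum_Suc fun_upd_same)
    show ?thesis
    proof (cases "\<exists>j\<le>n. partial_sum x j > u")
      case True
      then show ?thesis unfolding eq G_def using sym[OF shift] by simp
    next
      case False
      show ?thesis unfolding eq G_def if_not_P[OF False] ..
    qed
  qed
  have part: "(\<integral>\<^sup>+y. F (partial_sum (x(n := y)) (Suc n)) \<partial>N n) = G (partial_sum x n)" for x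
  proof -
    have "partial_sum (x(n := y)) (Suc n) = partial_sum x n + y" for y
      using partial_sum_cong[of n "x(n := y)" x] by (simp add: partial_sum_def)
    then show ?thesis by (simp add: G_def)
  qed
  have "(\<integral>\<^sup>+x. F (reflected_sum u x (Suc n)) \<partial>PiM {..<Suc n} N) = (\<integral>\<^sup>+x. G (reflected_sum u x n) \<partial>PiM {..<n} N)"
    unfolding ins[OF measurable_reflected_sum[OF N(2) le_refl]] refl ..
  also have "\<dots> = (\<integral>\<^sup>+x. G (partial_sum x n) \<partial>PiM {..<n} N)" by (rule Suc.IH[OF G])
  also have "\<dots> = (\<integral>\<^sup>+x. F (partial_sum x (Suc n)) \<partial>PiM {..<Suc n} N)"
    unfolding ins[OF measurable_partial_sum[OF N(2) le_refl]] part ..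
  finally show ?case .
qed

lemma linear_gauss_symmetric:
  assumes "h \<ge> 0" and f: "f \<in> borel_measurable borel"
  shows "(\<integral>\<^sup>+y. f (- y) \<partial>linear_gauss h) = (\<integral>\<^sup>+y. f y \<partial>linear_gauss h)"
proof (cases "h = 0")
  case True
  have [measurable]: "(\<lambda>y::real. f (- y)) \<in> borel_measurable borel" by (rule measurable_compose[OF _ f]) simp
  show ?thesis using True f by (simp add: linear_gauss_def nn_integral_return)
next
  case False
  have [measurable]: "(\<lambda>y::real. f (- y)) \<in> borel_measurable borel" by (rule measurable_compose[OF _ f]) simp
  note f[measurable]
  have "(\<integral>\<^sup>+y. f y \<partial>linear_gauss h) = (\<integral>\<^sup>+y. ennreal (normal_density 0 (sqrt h) y) * f y \<partial>lborel)"
    using False by (simp add: linear_gauss_def nn_integral_density)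
  also have "\<dots> = (\<integral>\<^sup>+y. ennreal (normal_density 0 (sqrt h) (- y)) * f (- y) \<partial>lborel)"
    by (subst nn_integral_real_affine[where c = "-1" and t = 0]) auto
  also have "\<dots> = (\<integral>\<^sup>+y. f (- y) \<partial>linear_gauss h)"
    using False by (simp add: linear_gauss_def nn_integral_density normal_density_def)
  finally show ?thesis by simp
qed

text \<open>The walk and its reflection sum to twice a value above u, so one of them ends above
  u.\<close>

lemma reflection_upper:
  assumes "\<exists>j\<le>n. partial_sum x j > u"
  shows "partial_sum x n > u \<or> reflected_sum u x n > u"
proof -
  obtain l where l: "l \<le> n" "partial_sum x l > u" "\<And>j. j < l \<Longrightarrow> partial_sum x j \<le> u" using first_hit[OF assms] by blast
  show ?thesis using reflected_sum_hit[OF l(2,3,1)] l(2) by linarith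
qed

text \<open>Small increments keep the overshoot below \<epsilon>, so the sum of both walks is at
  most 2u + 2\<epsilon>. A reflection ending above u + 2\<epsilon> therefore forces the walk itself
  to end below u.\<close>

lemma reflection_lower:
  assumes r: "reflected_sum u x n > u + 2 * \<epsilon>" and \<epsilon>: "\<epsilon> > 0" and u: "u \<ge> 0" and small: "\<And>i. i < n \<Longrightarrow> x i \<le> \<epsilon>"
  shows "(\<exists>j\<le>n. partial_sum x j > u) \<and> partial_sum x n \<le> u"
proof
  show hit: "\<exists>j\<le>n. partial_sum x j > u"
  proof (rule ccontr)
    assume "\<not> ?thesis"
    then have no: "\<And>j. j \<le> n \<Longrightarrow> partial_sum x j \<le> u" by (auto simp: not_less)
    then have "reflected_sum u x n = partial_sum x n" by (intro reflected_sum_no_hit) auto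
    then show False using r \<epsilon> no[of n] by simp
  qed
  obtain l where l: "l \<le> n" "partial_sum x l > u" "\<And>j. j < l \<Longrightarrow> partial_sum x j \<le> u" using first_hit[OF hit] by blast
  \<comment> \<open>The walk starts at 0 <= u, so the passage index is positive and has a preceding
    increment that controls the overshoot.\<close>
  have "l \<noteq> 0" using l(2) u by (intro notI) (simp add: partial_sum_def)
  then obtain k where k: "l = Suc k" by (cases l) auto
  have "partial_sum x l = partial_sum x k + x k" by (simp add: k partial_sum_def)
  then have "partial_sum x l \<le> u + \<epsilon>" using l(3)[of k] small[of k] l(1) k by simp
  then show "partial_sum x n \<le> u" using reflected_sum_hit[OF l(2,3,1)] r by simp
qed

text \<open>Substituting y = x + z/x in the tail integral takes out exp(-x^2/2)/x and leaves the
  integral of exp(-z - z^2/(2 x^2)) over z > 0. It is dominated by exp(-z) and tends to 1.\<close>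

lemma normal_tail_asymp:
  "((\<lambda>x. measure (density lborel (normal_density 0 1)) {x<..} * (x * exp (x\<^sup>2 / 2))) \<longlongrightarrow> 1 / sqrt (2 * pi)) at_top"
proof -
  define s where "s x z = indicator {0<..} z * exp (- z - z\<^sup>2 / (2 * x\<^sup>2))" for x z :: real
  have int: "integrable lborel (\<lambda>z. indicator {0<..} z * exp (- z) :: real)"
  and val: "(\<integral>z. indicator {0<..} z * exp (- z) \<partial>lborel) = (1::real)"
  proof -
    have "(\<integral>\<^sup>+z. ennreal (indicator {0<..} z * exp (- z)) \<partial>lborel) = (\<integral>\<^sup>+z. ennreal (exponential_density 1 z) \<partial>lborel)"
    proof (rule nn_integral_cong_AE)
      show "AE z in lborel. ennreal (indicator {0<..} z * exp (- z)) = ennreal (exponential_density 1 z)"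
        using AE_lborel_singleton[of "0::real"]
        by eventually_elim (simp add: exponential_density_def indicator_def)
    qed
    also have "\<dots> = 1"
      using prob_space.emeasure_space_1[OF prob_space_exponential_density[of 1]] by (simp add: emeasure_density)
    finally have 1: "(\<integral>\<^sup>+z. ennreal (indicator {0<..} z * exp (- z)) \<partial>lborel) = ennreal 1" by simp
    show "integrable lborel (\<lambda>z. indicator {0<..} z * exp (- z) :: real)"
      by (rule integrableI_nn_integral_finite[OF _ _ 1]) auto
    show "(\<integral>z. indicator {0<..} z * exp (- z) \<partial>lborel) = (1::real)"
      by (rule integral_eq_nn_integral[THEN trans]) (auto simp: 1 simp del: ennreal_1)
  qed
  have le: "norm (s x z) \<le> indicator {0<..} z * exp (- z)" for x z
    by (auto simp: s_def split: split_indicator)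
  have sm: "s x \<in> borel_measurable lborel" for x unfolding s_def by measurable
  have lim: "((\<lambda>x. \<integral>z. s x z \<partial>lborel) \<longlongrightarrow> (\<integral>z. indicator {0<..} z * exp (- z) \<partial>lborel)) at_top"
  proof (rule integral_dominated_convergence_at_top[OF _ _ int])
    show "\<forall>\<^sub>F x in at_top. AE z in lborel. norm (s x z) \<le> indicator {0<..} z * exp (- z)" using le by simp
    show "AE z in lborel. ((\<lambda>x. s x z) \<longlongrightarrow> indicator {0<..} z * exp (- z)) at_top"
    proof (rule AE_I2)
      fix z :: real
      have "((\<lambda>x::real. - z - z\<^sup>2 / (2 * x\<^sup>2)) \<longlongrightarrow> - z) at_top" by real_asymp
      then show "((\<lambda>x. s x z) \<longlongrightarrow> indicator {0<..} z * exp (- z)) at_top" unfolding s_def by (intro tendsto_intros)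
    qed
  qed (use sm in auto)
  have eq: "1 / sqrt (2 * pi) * (\<integral>z. s x z \<partial>lborel) = measure (density lborel (normal_density 0 1)) {x<..} * (x * exp (x\<^sup>2 / 2))"
    if x: "x > 0" for x
  proof -
    let ?c = "1 / sqrt (2 * pi) * exp (- x\<^sup>2 / 2) / x"
    have pt: "normal_density 0 1 (x + 1 / x * z) * indicator {x<..} (x + 1 / x * z) * (1 / x) = ?c * s x z" for z
    proof -
      have i: "indicator {x<..} (x + 1 / x * z) = (indicator {0<..} z :: real)"
        using x by (simp add: indicator_def zero_less_divide_iff)
      have "- (x + 1 / x * z)\<^sup>2 / 2 = - x\<^sup>2 / 2 + (- z - z\<^sup>2 / (2 * x\<^sup>2))"
        using x by (simp add: power2_sum power_divide power_mult_distrib add_divide_distrib)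
      then have "exp (- (x + 1 / x * z)\<^sup>2 / 2) = exp (- x\<^sup>2 / 2) * exp (- z - z\<^sup>2 / (2 * x\<^sup>2))"
        by (simp only: exp_add)
      then show ?thesis unfolding i s_def normal_density_def by simp
    qed
    have "emeasure (density lborel (normal_density 0 1)) {x<..} = (\<integral>\<^sup>+y. ennreal (normal_density 0 1 y) * indicator {x<..} y \<partial>lborel)"
      by (intro emeasure_density) auto
    also have "\<dots> = ennreal \<bar>1 / x\<bar> * (\<integral>\<^sup>+z. ennreal (normal_density 0 1 (x + 1 / x * z)) * indicator {x<..} (x + 1 / x * z) \<partial>lborel)"
      using x by (intro nn_integral_real_affine) auto
    also have "\<dots> = (\<integral>\<^sup>+z. ennreal (normal_density 0 1 (x + 1 / x * z) * indicator {x<..} (x + 1 / x * z) * (1 / x)) \<partial>lborel)"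
      using x by (subst nn_integral_cmult[symmetric])
        (auto intro!: nn_integral_cong simp: ennreal_mult[symmetric] mult.commute split: split_indicator)
    also have "\<dots> = ennreal (\<integral>z. ?c * s x z \<partial>lborel)"
      unfolding pt
    proof (intro nn_integral_eq_integral integrable_mult_right)
      show "integrable lborel (s x)"
        by (rule Bochner_Integration.integrable_bound[OF int]) (use le[of x] sm in \<open>auto intro!: AE_I2\<close>)
      show "AE z in lborel. 0 \<le> ?c * s x z" using x by (intro AE_I2) (auto simp: s_def)
    qed
    also have "(\<integral>z. ?c * s x z \<partial>lborel) = ?c * (\<integral>z. s x z \<partial>lborel)" by simp
    finally have "measure (density lborel (normal_density 0 1)) {x<..} = ?c * (\<integral>z. s x z \<partial>lborel)"
      using x unfolding measure_def by (simp add: s_def integral_nonneg_AE)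
    moreover have "exp (- x\<^sup>2 / 2) * exp (x\<^sup>2 / 2) = 1" unfolding exp_add[symmetric] by simp
    then have "?c * (x * exp (x\<^sup>2 / 2)) = 1 / sqrt (2 * pi)" using x by simp
    moreover have "?c * (\<integral>z. s x z \<partial>lborel) * (x * exp (x\<^sup>2 / 2)) = ?c * (x * exp (x\<^sup>2 / 2)) * (\<integral>z. s x z \<partial>lborel)"
      by (simp only: mult_ac)
    ultimately show ?thesis by (simp only:)
  qed
  have "((\<lambda>x. 1 / sqrt (2 * pi) * (\<integral>z. s x z \<partial>lborel)) \<longlongrightarrow> 1 / sqrt (2 * pi)) at_top"
    using tendsto_mult[OF tendsto_const[of "1 / sqrt (2 * pi)"] lim] unfolding val mult_1_right .
  moreover have "\<forall>\<^sub>F x in at_top. 1 / sqrt (2 * pi) * (\<integral>z. s x z \<partial>lborel) = measure (density lborel (normal_density 0 1)) {x<..} * (x * exp (x\<^sup>2 / 2))"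
    using eventually_gt_at_top[of 0] by eventually_elim (rule eq)
  ultimately show ?thesis by (rule Lim_transform_eventually)
qed

abbreviation normal_tail :: "real \<Rightarrow> real" where
  "normal_tail x \<equiv> measure (density lborel (normal_density 0 1)) {x<..}"

text \<open>Dominated convergence for indicators. The events need not be monotone, which is
  essential for the grids and time windows below.\<close>

lemma (in prob_space) tendsto_prob_at_top:
  assumes A: "\<And>u::real. A u \<in> events" "L \<in> events" and lim: "AE \<omega> in M. \<forall>\<^sub>F u in at_top. \<omega> \<in> A u \<longleftrightarrow> \<omega> \<in> L"
  shows "((\<lambda>u. prob (A u)) \<longlongrightarrow> prob L) at_top"
proof -
  have "((\<lambda>u. \<integral>\<omega>. indicator (A u) \<omega> \<partial>M) \<longlongrightarrow> ((\<integral>\<omega>. indicator L \<omega> \<partial>M) :: real)) at_top"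
  proof (rule integral_dominated_convergence_at_top[where w = "\<lambda>_. 1"])
    show "AE \<omega> in M. ((\<lambda>u. indicator (A u) \<omega>) \<longlongrightarrow> (indicator L \<omega> :: real)) at_top"
      using lim
    proof eventually_elim
      case (elim \<omega>)
      then have "\<forall>\<^sub>F u in at_top. indicator (A u) \<omega> = (indicator L \<omega> :: real)"
        by eventually_elim (auto simp: indicator_def)
      then show ?case by (rule tendsto_eventually)
    qed
    show "\<forall>\<^sub>F u in at_top. AE \<omega> in M. norm (indicator (A u) \<omega> :: real) \<le> 1"
      by (auto split: split_indicator)
  qed (use A in auto)
  then show ?thesis using A by (simp add: Int_absorb2 sets.sets_into_space)
qed

context standard_brownian_motion
begin

lemma increment_one: "distributed M lborel (\<lambda>\<omega>. B 1 \<omega> - B 0 \<omega>) (normal_density 0 1)"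
  using normal_increments[of 0 1] by simp

lemma prob_increment_one: "prob {\<omega>\<in>space M. B 1 \<omega> - B 0 \<omega> > x} = normal_tail x"
proof -
  have m: "(\<lambda>\<omega>. B 1 \<omega> - B 0 \<omega>) \<in> M \<rightarrow>\<^sub>M lborel" using increment_one by (rule distributed_measurable)
  have "normal_tail x = measure (distr M lborel (\<lambda>\<omega>. B 1 \<omega> - B 0 \<omega>)) {x<..}"
    using distributed_distr_eq_density[OF increment_one] by simp
  also have "\<dots> = prob {\<omega>\<in>space M. B 1 \<omega> - B 0 \<omega> > x}"
    using m by (subst measure_distr) (auto simp: vimage_def Int_def conj_commute)
  finally show ?thesis by simp
qed

end

context planar_brownian_motion
begin

lemma sets_first_exit:
  assumes "countable D" "D \<subseteq> {0..}"
  shows "{\<omega>\<in>space M. \<exists>t\<in>D. B1 t \<omega> - c * t > u} \<in> sets M"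
proof -
  have "{\<omega>\<in>space M. \<exists>t\<in>D. B1 t \<omega> - c * t \<in> {u<..}} \<in> sets M"
    using assms
    by (intro sets_Collect_bex_countable borel_measurable_diff B1.random_variable) auto
  then show ?thesis by (simp only: greaterThan_iff)
qed

lemma first_exit_rational:
  assumes "\<omega> \<in> space M" "a < b" "0 \<le> a"
  shows "(\<exists>t\<in>{a..b}. B1 t \<omega> - c * t > u) \<longleftrightarrow> (\<exists>t\<in>\<rat> \<inter> {a..b}. B1 t \<omega> - c * t > u)"
proof -
  have "continuous_on {a..b} (\<lambda>t. B1 t \<omega> - c * t)"
    using assms by (intro continuous_intros continuous_on_subset[OF B1.continuous_paths]) auto
  from ex_rational_in_open[OF this open_greaterThan[of u] closure_rational_atLeastAtMost[OF assms(2)]]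
  show ?thesis by (simp only: greaterThan_iff)
qed

lemma first_exit_sets:
  assumes "a < b" "0 \<le> a"
  shows "{\<omega>\<in>space M. \<exists>t\<in>{a..b}. B1 t \<omega> - c * t > u} \<in> sets M"
proof -
  have "{\<omega>\<in>space M. \<exists>t\<in>{a..b}. B1 t \<omega> - c * t > u} = {\<omega>\<in>space M. \<exists>t\<in>\<rat> \<inter> {a..b}. B1 t \<omega> - c * t > u}"
    using first_exit_rational assms by (intro Collect_cong conj_cong) auto
  also have "\<dots> \<in> sets M" using assms by (intro sets_first_exit countable_Rats_Int) auto
  finally show ?thesis .
qed

text \<open>The path is recentred at its initial value so that increments sum to it everywhere. The
  upper bound covers the passage event by two events of equal probability; the lower bound packs two
  disjoint events into it, at the cost of paths with a large grid increment.\<close>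

lemma reflection_grid:
  fixes n :: nat
  assumes n: "n > 0"
  defines "b \<equiv> \<lambda>j \<omega>. B1 (real j / real n) \<omega> - B1 0 \<omega>"
  shows "measure M {\<omega>\<in>space M. \<exists>j\<in>{..n}. b j \<omega> > u} \<le> 2 * normal_tail u" (is "measure M ?A \<le> _")
    and "u \<ge> 0 \<Longrightarrow> \<epsilon> > 0 \<Longrightarrow> normal_tail u + normal_tail (u + 2 * \<epsilon>)
        - measure M {\<omega>\<in>space M. \<exists>i\<in>{..<n}. b (Suc i) \<omega> - b i \<omega> > \<epsilon>} \<le> measure M {\<omega>\<in>space M. \<exists>j\<in>{..n}. b j \<omega> > u}"
proof -
  define D where "D \<omega> = (\<lambda>i\<in>{..<n}. B1 (real (Suc i) / real n) \<omega> - B1 (real i / real n) \<omega>)" for \<omega>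
  define h where "h = 1 / real n"
  have h: "h \<ge> 0" by (simp add: h_def)
  let ?P = "PiM {..<n} (\<lambda>_. linear_gauss h)"
  have law: "distr M ?P D = ?P"
  proof -
    have "real (Suc i) / real n - real i / real n = h" for i using n by (simp add: h_def field_simps)
    then show ?thesis
      using B1.distr_increments[of "\<lambda>i. real i / real n" n] unfolding D_def by (simp add: divide_right_mono)
  qed
  have bm: "b j \<in> borel_measurable M" for j
    unfolding b_def by (intro borel_measurable_diff B1.random_variable) auto
  have Dm: "D \<in> M \<rightarrow>\<^sub>M ?P"
    unfolding D_def
  proof (rule measurable_restrict)
    fix i
    have "(\<lambda>\<omega>. B1 (real (Suc i) / real n) \<omega> - B1 (real i / real n) \<omega>) \<in> borel_measurable M"
      by (intro borel_measurable_diff B1.random_variable) auto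
    then show "(\<lambda>\<omega>. B1 (real (Suc i) / real n) \<omega> - B1 (real i / real n) \<omega>) \<in> M \<rightarrow>\<^sub>M linear_gauss h"
      by (simp add: measurable_cong_sets[OF refl sets_linear_gauss])
  qed
  have bS: "b j \<omega> = partial_sum (D \<omega>) j" if "j \<le> n" for j \<omega>
  proof -
    have "partial_sum (D \<omega>) j = (\<Sum>i<j. B1 (real (Suc i) / real n) \<omega> - B1 (real i / real n) \<omega>)"
      unfolding partial_sum_def D_def using that by (intro sum.cong) auto
    also have "\<dots> = b j \<omega>"
      using sum_lessThan_telescope[of "\<lambda>i. B1 (real i / real n) \<omega>" j] by (simp add: b_def)
    finally show ?thesis by simp
  qed
  have bn: "b n \<omega> = B1 1 \<omega> - B1 0 \<omega>" for \<omega> using n by (simp add: b_def)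
  define R where "R \<omega> = reflected_sum u (D \<omega>) n" for \<omega>
  have rm: "(\<lambda>x. reflected_sum u x n) \<in> borel_measurable ?P" by (rule measurable_reflected_sum) auto
  have pm: "(\<lambda>x. partial_sum x n) \<in> borel_measurable ?P" by (rule measurable_partial_sum) auto
  have Rm: "R \<in> borel_measurable M" unfolding R_def by (rule measurable_compose[OF Dm rm])
  have An: "?A \<in> sets M"
  proof -
    have "{\<omega>\<in>space M. \<exists>j\<in>{..n}. b j \<omega> \<in> {u<..}} \<in> sets M" using bm by (intro sets_Collect_bex_countable) auto
    then show ?thesis by (simp only: greaterThan_iff)
  qed
  let ?S = "\<lambda>x. {\<omega>\<in>space M. b n \<omega> > x}"
  let ?R = "\<lambda>x. {\<omega>\<in>space M. R \<omega> > x}"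
  note bm[measurable] Rm[measurable]
  have Ss: "?S x \<in> sets M" and Rs: "?R x \<in> sets M" for x by measurable
  have PS: "measure M (?S x) = normal_tail x" for x
    using B1.prob_increment_one[of x] by (simp add: bn)
  have PR: "measure M (?R x) = normal_tail x" for x
  proof -
    have i: "(indicator {x<..} :: real \<Rightarrow> ennreal) \<in> borel_measurable borel" by measurable
    have ind: "emeasure M {\<omega>\<in>space M. Z \<omega> > x} = (\<integral>\<^sup>+\<omega>. indicator {x<..} (Z \<omega>) \<partial>M)"
      if "{\<omega>\<in>space M. Z \<omega> > x} \<in> sets M" for Z :: "'a \<Rightarrow> real"
    proof -
      have "emeasure M {\<omega>\<in>space M. Z \<omega> > x} = (\<integral>\<^sup>+\<omega>. indicator {\<omega>\<in>space M. Z \<omega> > x} \<omega> \<partial>M)"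
        by (rule nn_integral_indicator[OF that, symmetric])
      also have "\<dots> = (\<integral>\<^sup>+\<omega>. indicator {x<..} (Z \<omega>) \<partial>M)" by (rule nn_integral_cong) (simp add: indicator_def)
      finally show ?thesis .
    qed
    have "emeasure M (?R x) = (\<integral>\<^sup>+\<omega>. indicator {x<..} (reflected_sum u (D \<omega>) n) \<partial>M)"
      unfolding R_def[symmetric] by (rule ind[OF Rs])
    also have "\<dots> = (\<integral>\<^sup>+z. indicator {x<..} (reflected_sum u z n) \<partial>distr M ?P D)"
      by (rule nn_integral_distr[symmetric, OF Dm]) (simp only: measurable_distr_eq1 measurable_compose[OF rm i])
    also have "\<dots> = (\<integral>\<^sup>+z. indicator {x<..} (partial_sum z n) \<partial>?P)"
      unfolding law using h by (intro nn_integral_reflected_sum prob_space_linear_gauss linear_gauss_symmetric) auto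
    also have "\<dots> = (\<integral>\<^sup>+z. indicator {x<..} (partial_sum z n) \<partial>distr M ?P D)" unfolding law ..
    also have "\<dots> = (\<integral>\<^sup>+\<omega>. indicator {x<..} (partial_sum (D \<omega>) n) \<partial>M)"
      by (rule nn_integral_distr[OF Dm]) (simp only: measurable_distr_eq1 measurable_compose[OF pm i])
    also have "\<dots> = emeasure M (?S x)"
      unfolding bS[OF le_refl, symmetric] by (rule ind[OF Ss, symmetric])
    finally have "measure M (?R x) = measure M (?S x)" by (simp only: measure_def)
    then show ?thesis by (simp only: PS)
  qed
  have hit: "(\<exists>j\<in>{..n}. b j \<omega> > u) \<longleftrightarrow> (\<exists>j\<le>n. partial_sum (D \<omega>) j > u)" for \<omega>
    using bS by auto
  have "?A \<subseteq> ?S u \<union> ?R u"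
  proof
    fix \<omega> assume "\<omega> \<in> ?A"
    then have "\<omega> \<in> space M" "\<exists>j\<le>n. partial_sum (D \<omega>) j > u" using hit by blast+
    then show "\<omega> \<in> ?S u \<union> ?R u" using reflection_upper[where n = n and x = "D \<omega>" and u = u] bS[of n \<omega>] by (auto simp: R_def)
  qed
  then have "measure M ?A \<le> measure M (?S u) + measure M (?R u)"
    by (rule order_trans[OF B1.finite_measure_mono[OF _ sets.Un[OF Ss Rs]] measure_Un_le[OF Ss Rs]])
  then show "measure M ?A \<le> 2 * normal_tail u" by (simp add: PS PR)
  show "normal_tail u + normal_tail (u + 2 * \<epsilon>) - measure M {\<omega>\<in>space M. \<exists>i\<in>{..<n}. b (Suc i) \<omega> - b i \<omega> > \<epsilon>} \<le> measure M ?A"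
    if u: "u \<ge> 0" and \<epsilon>: "\<epsilon> > 0"
  proof -
    let ?I = "{\<omega>\<in>space M. \<exists>i\<in>{..<n}. b (Suc i) \<omega> - b i \<omega> > \<epsilon>}"
    have Is: "?I \<in> sets M"
    proof -
      have "{\<omega>\<in>space M. \<exists>i\<in>{..<n}. b (Suc i) \<omega> - b i \<omega> \<in> {\<epsilon><..}} \<in> sets M" using bm by (intro sets_Collect_bex_countable) auto
      then show ?thesis by (simp only: greaterThan_iff)
    qed
    \<comment> \<open>Reflection clearly above u and no large increment: by
      \<open>reflection_lower\<close> this lies in the passage event and is disjoint from the walk
      ending above u.\<close>
    let ?Q = "?R (u + 2 * \<epsilon>) - ?I"
    have Q: "\<omega> \<in> ?A \<and> \<omega> \<notin> ?S u" if "\<omega> \<in> ?Q" for \<omega>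
    proof -
      have r: "reflected_sum u (D \<omega>) n > u + 2 * \<epsilon>" and sp: "\<omega> \<in> space M" using that by (auto simp: R_def)
      have "D \<omega> i \<le> \<epsilon>" if "i < n" for i
      proof -
        have "D \<omega> i = b (Suc i) \<omega> - b i \<omega>" using that by (simp add: D_def b_def)
        moreover have "\<not> b (Suc i) \<omega> - b i \<omega> > \<epsilon>" using \<open>\<omega> \<in> ?Q\<close> sp that by blast
        ultimately show ?thesis by simp
      qed
      from reflection_lower[OF r \<epsilon> u this] show ?thesis
        using hit[of \<omega>] bS[of n \<omega>] sp by (simp add: not_less)
    qed
    have sub: "?S u \<union> ?Q \<subseteq> ?A"
    proof
      fix \<omega> assume "\<omega> \<in> ?S u \<union> ?Q"
      then show "\<omega> \<in> ?A" using Q[of \<omega>] by blast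
    qed
    have disj: "?S u \<inter> ?Q = {}" using Q by blast
    have "measure M (?S u) + measure M ?Q = measure M (?S u \<union> ?Q)"
      using Ss Rs Is disj by (intro B1.finite_measure_Union[symmetric] sets.Diff)
    also have "\<dots> \<le> measure M ?A" by (rule B1.finite_measure_mono[OF sub An])
    finally have 1: "measure M (?S u) + measure M ?Q \<le> measure M ?A" .
    have "measure M (?R (u + 2 * \<epsilon>)) \<le> measure M (?Q \<union> ?I)"
      using Rs Is by (intro B1.finite_measure_mono sets.Un sets.Diff) auto
    also have "\<dots> \<le> measure M ?Q + measure M ?I"
      using Rs Is by (intro measure_Un_le sets.Diff)
    finally show ?thesis using 1 by (simp add: PS PR)
  qed
qed

text \<open>The shift is written as 1/k with k tending to infinity so that
  \<open>tendsto_prob_at_top\<close> applies.\<close>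

lemma normal_tail_right_limit: "((\<lambda>k. normal_tail (u + 2 * (1 / k))) \<longlongrightarrow> normal_tail u) at_top"
proof -
  interpret N: prob_space "density lborel (normal_density 0 1)" by (rule prob_space_normal_density) simp
  show ?thesis
  proof (rule N.tendsto_prob_at_top)
    show "AE y in density lborel (normal_density 0 1). \<forall>\<^sub>F k in at_top. y \<in> {u + 2 * (1 / k)<..} \<longleftrightarrow> y \<in> {u<..}"
    proof (rule AE_I2)
      fix y :: real
      show "\<forall>\<^sub>F k in at_top. y \<in> {u + 2 * (1 / k)<..} \<longleftrightarrow> y \<in> {u<..}"
      proof (cases "y > u")
        case True
        have "((\<lambda>k::real. u + 2 * (1 / k)) \<longlongrightarrow> u) at_top" by real_asymp
        from order_tendstoD(2)[OF this True] show ?thesis by eventually_elim (use True in simp)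
      next
        case False
        show ?thesis using eventually_gt_at_top[of 0]
        proof eventually_elim
          case (elim k)
          then have "u \<le> u + 2 * (1 / k)" by simp
          then have "\<not> u + 2 * (1 / k) < y" using False by linarith
          then show ?case using False by (simp only: greaterThan_iff)
        qed
      qed
    qed
  qed auto
qed

lemma nat_fraction_in_unit: "j \<le> n \<Longrightarrow> real j / real n \<in> {0..1}" for j n :: nat
  by (cases "n = 0") (auto simp: divide_le_eq)

lemma eventually_nat_ceiling: "\<forall>\<^sub>F x in at_top. nat \<lceil>x::real\<rceil> > 0 \<and> 1 / real (nat \<lceil>x\<rceil>) < d" if "d > 0"
  using eventually_gt_at_top[of "max 0 (1 / d)"]
proof eventually_elim
  case (elim x)
  then have x: "0 < x" "1 / d < x" by auto
  have "x \<le> real (nat \<lceil>x\<rceil>)" by linarith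
  then have n: "0 < real (nat \<lceil>x\<rceil>)" "1 / d < real (nat \<lceil>x\<rceil>)" using x by linarith+
  then show ?case using that by (simp add: field_simps)
qed

text \<open>Along finer grids the passage events converge pointwise by continuity of paths, and
  large increments disappear by uniform continuity. This leaves the bounds with u and u +
  2\<epsilon>, and \<epsilon> then tends to 0.\<close>

lemma reflection_principle:
  assumes u: "u \<ge> 0"
  shows "measure M {\<omega>\<in>space M. \<exists>t\<in>{0..1}. B1 t \<omega> > u} = 2 * normal_tail u"
proof -
  define b where "b t \<omega> = B1 t \<omega> - B1 0 \<omega>" for t \<omega>
  \<comment> \<open>The grid size is a function of a real parameter in order to match the filter of
    \<open>tendsto_prob_at_top\<close>.\<close>
  let ?n = "\<lambda>x::real. nat \<lceil>x\<rceil>"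
  let ?A = "\<lambda>x. {\<omega>\<in>space M. \<exists>j\<in>{..?n x}. b (real j / real (?n x)) \<omega> > u}"
  let ?I = "\<lambda>\<epsilon> x. {\<omega>\<in>space M. \<exists>i\<in>{..<?n x}. b (real (Suc i) / real (?n x)) \<omega> - b (real i / real (?n x)) \<omega> > \<epsilon>}"
  let ?L = "{\<omega>\<in>space M. \<exists>t\<in>{0..1}. b t \<omega> > u}"
  have bm: "b t \<in> borel_measurable M" if "t \<ge> 0" for t
    unfolding b_def using that by (intro borel_measurable_diff B1.random_variable) auto
  have bc: "continuous_on {0..1} (\<lambda>t. b t \<omega>)" if "\<omega> \<in> space M" for \<omega>
    unfolding b_def by (intro continuous_intros continuous_on_subset[OF B1.continuous_paths[OF that]]) auto
  have As: "?A x \<in> sets M" for x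
  proof -
    have "{\<omega>\<in>space M. \<exists>j\<in>{..?n x}. b (real j / real (?n x)) \<omega> \<in> {u<..}} \<in> sets M" using bm by (intro sets_Collect_bex_countable) auto
    then show ?thesis by (simp only: greaterThan_iff)
  qed
  have Is: "?I \<epsilon> x \<in> sets M" for \<epsilon> x
  proof -
    have "{\<omega>\<in>space M. \<exists>i\<in>{..<?n x}. b (real (Suc i) / real (?n x)) \<omega> - b (real i / real (?n x)) \<omega> \<in> {\<epsilon><..}} \<in> sets M"
      using bm by (intro sets_Collect_bex_countable borel_measurable_diff) auto
    then show ?thesis by (simp only: greaterThan_iff)
  qed
  have rat: "(\<exists>t\<in>{0..1}. b t \<omega> > u) \<longleftrightarrow> (\<exists>t\<in>\<rat> \<inter> {0..1}. b t \<omega> > u)" if "\<omega> \<in> space M" for \<omega>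
    using ex_rational_in_open[OF bc[OF that] open_greaterThan[of u] closure_rational_atLeastAtMost] by (simp only: greaterThan_iff zero_less_one)
  have Ls: "?L \<in> sets M"
  proof -
    have "{\<omega>\<in>space M. \<exists>t\<in>\<rat> \<inter> {0..1}. b t \<omega> \<in> {u<..}} \<in> sets M"
      using bm by (intro sets_Collect_bex_countable countable_Rats_Int) auto
    moreover have "?L = {\<omega>\<in>space M. \<exists>t\<in>\<rat> \<inter> {0..1}. b t \<omega> > u}" using rat by blast
    ultimately show ?thesis by (simp only: greaterThan_iff)
  qed
  have limA: "((\<lambda>x. measure M (?A x)) \<longlongrightarrow> measure M ?L) at_top"
  proof (rule B1.tendsto_prob_at_top[OF As Ls], rule AE_I2)
    fix \<omega> assume \<omega>: "\<omega> \<in> space M"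
    show "\<forall>\<^sub>F x in at_top. \<omega> \<in> ?A x \<longleftrightarrow> \<omega> \<in> ?L"
    proof (cases "\<omega> \<in> ?L")
      case True
      then obtain t where t: "t \<in> {0..1}" "b t \<omega> > u" by blast
      \<comment> \<open>A strict excess at t persists in a neighbourhood, which contains the grid
        point just left of t as soon as the mesh is fine.\<close>
      have "b t \<omega> - u > 0" using t by simp
      then obtain d where d: "d > 0" "\<And>s. s \<in> {0..1} \<Longrightarrow> dist s t < d \<Longrightarrow> dist (b s \<omega>) (b t \<omega>) < b t \<omega> - u"
        using bc[OF \<omega>] t(1) unfolding continuous_on_iff by blast
      show ?thesis using eventually_nat_ceiling[OF d(1)]
      proof eventually_elim
        case (elim x)
        let ?N = "real (?n x)"
        define j where "j = nat \<lfloor>t * ?N\<rfloor>"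
        have N: "?N > 0" using elim by simp
        have j: "real j \<le> t * ?N" "t * ?N < real j + 1" using t N by (auto simp: j_def)
        have "t * ?N \<le> ?N" using t N by simp
        then have jn: "j \<le> ?n x" using j(1) by linarith
        have "real j / ?N \<le> t" using j(1) N by (simp add: field_simps)
        moreover have "t - real j / ?N < 1 / ?N"
        proof -
          have "t < (real j + 1) / ?N" using j(2) N by (simp only: pos_less_divide_eq)
          then show ?thesis by (simp only: add_divide_distrib diff_less_eq add.commute)
        qed
        moreover have "dist (real j / ?N) t = t - real j / ?N"
          using \<open>real j / ?N \<le> t\<close> unfolding dist_real_def
          by (subst abs_of_nonpos) (simp_all only: diff_le_0_iff_le minus_diff_eq)
        ultimately have "dist (real j / ?N) t < d" using elim by (metis less_trans)
        moreover have "real j / ?N \<in> {0..1}" using \<open>real j / ?N \<le> t\<close> t by auto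
        ultimately have "b (real j / ?N) \<omega> > u" using d(2)[of "real j / ?N"] by (simp add: dist_real_def abs_less_iff)
        then show ?case using jn \<omega> True by blast
      qed
    next
      case False
      have "\<omega> \<notin> ?A x" for x
      proof
        assume "\<omega> \<in> ?A x"
        then obtain j where j: "j \<le> ?n x" "b (real j / real (?n x)) \<omega> > u" by blast
        then have "real j / real (?n x) \<in> {0..1}" by (intro nat_fraction_in_unit)
        then show False using False j \<omega> by blast
      qed
      then show ?thesis using False by (intro always_eventually allI) blast
    qed
  qed
  have limI: "((\<lambda>x. measure M (?I \<epsilon> x)) \<longlongrightarrow> 0) at_top" if \<epsilon>: "\<epsilon> > 0" for \<epsilon>
  proof -
    have "((\<lambda>x. measure M (?I \<epsilon> x)) \<longlongrightarrow> measure M {}) at_top"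
    proof (rule B1.tendsto_prob_at_top[OF Is sets.empty_sets], rule AE_I2)
      fix \<omega> assume \<omega>: "\<omega> \<in> space M"
      have "uniformly_continuous_on {0..1} (\<lambda>t. b t \<omega>)"
        by (rule compact_uniformly_continuous[OF bc[OF \<omega>]]) simp
      then obtain d where d: "d > 0" "\<And>s t. s \<in> {0..1} \<Longrightarrow> t \<in> {0..1} \<Longrightarrow> dist t s < d \<Longrightarrow> dist (b t \<omega>) (b s \<omega>) < \<epsilon>"
        using \<epsilon> unfolding uniformly_continuous_on_def by meson
      show "\<forall>\<^sub>F x in at_top. \<omega> \<in> ?I \<epsilon> x \<longleftrightarrow> \<omega> \<in> {}"
        using eventually_nat_ceiling[OF d(1)]
      proof eventually_elim
        case (elim x)
        have "\<omega> \<notin> ?I \<epsilon> x"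
        proof
          assume "\<omega> \<in> ?I \<epsilon> x"
          then obtain i where i: "i < ?n x" "b (real (Suc i) / real (?n x)) \<omega> - b (real i / real (?n x)) \<omega> > \<epsilon>" by blast
          have "real (Suc i) / real (?n x) - real i / real (?n x) = 1 / real (?n x)" by (simp add: diff_divide_distrib[symmetric])
          then have "dist (real (Suc i) / real (?n x)) (real i / real (?n x)) = 1 / real (?n x)"
            by (simp only: dist_real_def abs_of_nonneg zero_le_divide_1_iff of_nat_0_le_iff)
          then have "dist (real (Suc i) / real (?n x)) (real i / real (?n x)) < d" using elim by (simp only:)
          moreover have "real (Suc i) / real (?n x) \<in> {0..1}" "real i / real (?n x) \<in> {0..1}"
            using i(1) by (auto intro!: nat_fraction_in_unit simp del: of_nat_Suc atLeastAtMost_iff)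
          ultimately have "dist (b (real (Suc i) / real (?n x)) \<omega>) (b (real i / real (?n x)) \<omega>) < \<epsilon>" by (intro d(2))
          then show False using i(2) by (simp add: dist_real_def abs_less_iff)
        qed
        then show ?case by blast
      qed
    qed
    then show ?thesis by simp
  qed
  have pos: "\<forall>\<^sub>F x in at_top. ?n x > 0" using eventually_nat_ceiling[of 1] by (auto elim: eventually_mono)
  have upper: "measure M ?L \<le> 2 * normal_tail u"
  proof (rule tendsto_upperbound[OF limA])
    show "\<forall>\<^sub>F x in at_top. measure M (?A x) \<le> 2 * normal_tail u"
      using pos by eventually_elim (unfold b_def, rule reflection_grid(1))
  qed simp
  have lower: "normal_tail u + normal_tail (u + 2 * \<epsilon>) \<le> measure M ?L" if \<epsilon>: "\<epsilon> > 0" for \<epsilon>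
  proof (rule tendsto_le[OF _ limA])
    show "((\<lambda>x. normal_tail u + normal_tail (u + 2 * \<epsilon>) - measure M (?I \<epsilon> x)) \<longlongrightarrow> normal_tail u + normal_tail (u + 2 * \<epsilon>)) at_top"
      using tendsto_diff[OF tendsto_const limI[OF \<epsilon>]] by simp
    show "\<forall>\<^sub>F x in at_top. normal_tail u + normal_tail (u + 2 * \<epsilon>) - measure M (?I \<epsilon> x) \<le> measure M (?A x)"
      using pos by eventually_elim (unfold b_def, rule reflection_grid(2)[OF _ u \<epsilon>])
  qed simp
  have "normal_tail u + normal_tail u \<le> measure M ?L"
  proof (rule tendsto_upperbound[OF tendsto_add[OF tendsto_const normal_tail_right_limit]])
    show "\<forall>\<^sub>F k in at_top. normal_tail u + normal_tail (u + 2 * (1 / k)) \<le> measure M ?L"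
      using eventually_gt_at_top[of 0] by eventually_elim (intro lower, simp)
  qed simp
  moreover have "measure M {\<omega>\<in>space M. \<exists>t\<in>{0..1}. B1 t \<omega> > u} = measure M ?L"
  proof (rule measure_eq_AE)
    show "AE \<omega> in M. \<omega> \<in> {\<omega>\<in>space M. \<exists>t\<in>{0..1}. B1 t \<omega> > u} \<longleftrightarrow> \<omega> \<in> ?L"
      using B1.start by eventually_elim (simp add: b_def)
    show "{\<omega>\<in>space M. \<exists>t\<in>{0..1}. B1 t \<omega> > u} \<in> sets M" using first_exit_sets[of 0 1 u 0] by simp
  qed (rule Ls)
  ultimately show ?thesis using upper by simp
qed

end

section \<open>Exit of one component across a linear barrier\<close>

context planar_brownian_motion
begin

definition first_exit :: "real \<Rightarrow> real set \<Rightarrow> real \<Rightarrow> real" where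
  "first_exit c I u = measure M {\<omega>\<in>space M. \<exists>t\<in>I. B1 t \<omega> - c * t > u}"

text \<open>The half-plane instance of \<open>early_exit_bound\<close>: b = (u, 0), drift (c, 0),
  hence corner (u + c, 0), and c there becomes (u^2 - c^2)/2.\<close>

lemma first_exit_early:
  assumes \<delta>: "0 \<le> \<delta>" "\<delta> < 1" and u: "\<bar>c\<bar> \<le> u"
  shows "first_exit c {0..1-\<delta>} u \<le> exp (- (u + c)\<^sup>2 / 2 - \<delta> * ((u\<^sup>2 - c\<^sup>2) / 2))"
proof -
  let ?\<theta> = "(u + c, 0) :: real \<times> real"
  have "(norm ?\<theta>)\<^sup>2 = (u + c)\<^sup>2" by (simp add: norm_Pair)
  then have c: "(u\<^sup>2 - c\<^sup>2) / 2 = (norm ?\<theta>)\<^sup>2 / 2 - ?\<theta> \<bullet> (c, 0)"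
    by (simp add: power2_eq_square field_simps)
  have "\<bar>c\<bar>\<^sup>2 \<le> u\<^sup>2" using u by (intro power_mono) auto
  then have c0: "0 \<le> (u\<^sup>2 - c\<^sup>2) / 2" by simp
  have op: "open {k :: real \<times> real. 0 < fst k}" by (intro open_Collect_less continuous_intros)
  have "measure M {\<omega>\<in>space M. \<exists>t\<in>{0..1-\<delta>}. B t \<omega> - t *\<^sub>R (c, 0) - (u, 0) \<in> {k. 0 < fst k}}
     \<le> exp (- (norm ?\<theta>)\<^sup>2 / 2 - \<delta> * ((u\<^sup>2 - c\<^sup>2) / 2))"
    using u by (intro early_exit_bound \<delta> c c0 op) (auto intro!: mult_nonneg_nonneg)
  moreover have "B t \<omega> - t *\<^sub>R (c, 0) - (u, 0) \<in> {k. 0 < fst k} \<longleftrightarrow> B1 t \<omega> - c * t > u" for t \<omega>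
    by (auto simp: B_def mult.commute)
  ultimately show ?thesis by (simp add: first_exit_def norm_Pair)
qed

lemma first_exit_split:
  assumes "0 < \<delta>" "\<delta> < 1"
  shows "first_exit c {0..1} u \<le> first_exit c {0..1-\<delta>} u + first_exit c {1-\<delta>..1} u"
proof -
  let ?E = "\<lambda>I. {\<omega>\<in>space M. \<exists>t\<in>I. B1 t \<omega> - c * t > u}"
  have I: "{0..1::real} \<subseteq> {0..1-\<delta>} \<union> {1-\<delta>..1}" by auto
  have sub: "?E {0..1} \<subseteq> ?E {0..1-\<delta>} \<union> ?E {1-\<delta>..1}"
  proof
    fix \<omega> assume "\<omega> \<in> ?E {0..1}"
    then obtain t where "\<omega> \<in> space M" "t \<in> {0..1}" "B1 t \<omega> - c * t > u" by blast
    then show "\<omega> \<in> ?E {0..1-\<delta>} \<union> ?E {1-\<delta>..1}" using I by blast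
  qed
  have s: "?E {0..1-\<delta>} \<in> sets M" "?E {1-\<delta>..1} \<in> sets M" using assms by (auto intro!: first_exit_sets)
  show ?thesis unfolding first_exit_def
    by (rule order_trans[OF B1.finite_measure_mono[OF sub sets.Un[OF s]] measure_Un_le[OF s]])
qed

text \<open>On the last stretch of length \<delta> the linear barrier differs from its value at time
  1 by at most |c| \<delta>, which turns it into a constant level at a controlled error.\<close>

lemma first_exit_shift:
  assumes "0 < \<delta>" "\<delta> < 1"
  shows "first_exit c {1-\<delta>..1} u \<le> first_exit 0 {0..1} (u + c - \<bar>c\<bar> * \<delta>)"
    and "first_exit 0 {1-\<delta>..1} (u + c + \<bar>c\<bar> * \<delta>) \<le> first_exit c {0..1} u"
proof -
  have ct: "\<bar>c * t - c\<bar> \<le> \<bar>c\<bar> * \<delta>" if "t \<in> {1-\<delta>..1}" for t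
  proof -
    have "\<bar>c * t - c\<bar> = \<bar>c\<bar> * \<bar>t - 1\<bar>" by (simp add: abs_mult[symmetric] right_diff_distrib)
    also have "\<dots> \<le> \<bar>c\<bar> * \<delta>" using that by (intro mult_left_mono) auto
    finally show ?thesis .
  qed
  have sub: "{1-\<delta>..1} \<subseteq> {0..1}" using assms by auto
  have "{\<omega>\<in>space M. \<exists>t\<in>{1-\<delta>..1}. B1 t \<omega> - c * t > u} \<subseteq> {\<omega>\<in>space M. \<exists>t\<in>{0..1}. B1 t \<omega> - 0 * t > u + c - \<bar>c\<bar> * \<delta>}"
  proof
    fix \<omega> assume "\<omega> \<in> {\<omega>\<in>space M. \<exists>t\<in>{1-\<delta>..1}. B1 t \<omega> - c * t > u}"
    then obtain t where t: "\<omega> \<in> space M" "t \<in> {1-\<delta>..1}" "B1 t \<omega> - c * t > u" by blast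
    have "B1 t \<omega> - 0 * t > u + c - \<bar>c\<bar> * \<delta>" using ct[OF t(2)] t(3) by linarith
    then show "\<omega> \<in> {\<omega>\<in>space M. \<exists>t\<in>{0..1}. B1 t \<omega> - 0 * t > u + c - \<bar>c\<bar> * \<delta>}" using t sub by blast
  qed
  then show "first_exit c {1-\<delta>..1} u \<le> first_exit 0 {0..1} (u + c - \<bar>c\<bar> * \<delta>)"
    unfolding first_exit_def by (rule B1.finite_measure_mono) (rule first_exit_sets, simp_all)
  have "{\<omega>\<in>space M. \<exists>t\<in>{1-\<delta>..1}. B1 t \<omega> - 0 * t > u + c + \<bar>c\<bar> * \<delta>} \<subseteq> {\<omega>\<in>space M. \<exists>t\<in>{0..1}. B1 t \<omega> - c * t > u}"
  proof
    fix \<omega> assume "\<omega> \<in> {\<omega>\<in>space M. \<exists>t\<in>{1-\<delta>..1}. B1 t \<omega> - 0 * t > u + c + \<bar>c\<bar> * \<delta>}"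
    then obtain t where t: "\<omega> \<in> space M" "t \<in> {1-\<delta>..1}" "B1 t \<omega> - 0 * t > u + c + \<bar>c\<bar> * \<delta>" by blast
    have "B1 t \<omega> - c * t > u" using ct[OF t(2)] t(3) by linarith
    then show "\<omega> \<in> {\<omega>\<in>space M. \<exists>t\<in>{0..1}. B1 t \<omega> - c * t > u}" using t sub by blast
  qed
  then show "first_exit 0 {1-\<delta>..1} (u + c + \<bar>c\<bar> * \<delta>) \<le> first_exit c {0..1} u"
    unfolding first_exit_def by (rule B1.finite_measure_mono) (rule first_exit_sets, simp_all)
qed

lemma first_exit_zero: "u \<ge> 0 \<Longrightarrow> first_exit 0 {0..1} u = 2 * normal_tail u"
  using reflection_principle[of u] by (simp add: first_exit_def)

text \<open>The second hypothesis says precisely that moving the level from u + c to x(u) is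
  invisible to the leading order of the Gaussian tail.\<close>

lemma normal_tail_shift:
  assumes x: "filterlim x at_top at_top"
    and e: "((\<lambda>u. u / x u * exp ((u + c)\<^sup>2 / 2 - (x u)\<^sup>2 / 2)) \<longlongrightarrow> 1) at_top"
  shows "((\<lambda>u. 2 * normal_tail (x u) * (u * exp ((u + c)\<^sup>2 / 2))) \<longlongrightarrow> 2 / sqrt (2 * pi)) at_top"
proof -
  have "((\<lambda>u. 2 * (normal_tail (x u) * (x u * exp ((x u)\<^sup>2 / 2))) * (u / x u * exp ((u + c)\<^sup>2 / 2 - (x u)\<^sup>2 / 2)))
     \<longlongrightarrow> 2 * (1 / sqrt (2 * pi)) * 1) at_top"
    by (intro tendsto_mult tendsto_const e filterlim_compose[OF normal_tail_asymp x])
  moreover have "\<forall>\<^sub>F u in at_top. 2 * (normal_tail (x u) * (x u * exp ((x u)\<^sup>2 / 2))) * (u / x u * exp ((u + c)\<^sup>2 / 2 - (x u)\<^sup>2 / 2))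
     = 2 * normal_tail (x u) * (u * exp ((u + c)\<^sup>2 / 2))"
    using filterlim_at_top_dense[THEN iffD1, OF x, rule_format, of 0]
  proof eventually_elim
    case (elim u)
    have "exp ((x u)\<^sup>2 / 2) * exp ((u + c)\<^sup>2 / 2 - (x u)\<^sup>2 / 2) = exp ((u + c)\<^sup>2 / 2)"
      unfolding exp_add[symmetric] by simp
    then show ?case using elim by (simp add: field_simps)
  qed
  ultimately have "((\<lambda>u. 2 * normal_tail (x u) * (u * exp ((u + c)\<^sup>2 / 2))) \<longlongrightarrow> 2 * (1 / sqrt (2 * pi)) * 1) at_top"
    by (rule Lim_transform_eventually)
  then show ?thesis by simp
qed

text \<open>Near time 1 the barrier is nearly constant at u + c, where the reflection principle is
  exact; everything earlier is an exponentially small error after normalisation.\<close>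

lemma first_exit_asymp:
  "((\<lambda>u. first_exit c {0..1} u * (u * exp ((u + c)\<^sup>2 / 2))) \<longlongrightarrow> 2 / sqrt (2 * pi)) at_top"
proof -
  \<comment> \<open>Two demands meet: u \<delta> must tend to 0, so that shifting the level by |c|
    \<delta> keeps the tail, and u^2 \<delta> must grow fast enough for the early exits to vanish.
    The power -3/2 gives u^(-1/2) and u^(1/2).\<close>
  define \<delta> where "\<delta> u = 1 / (u * sqrt u)" for u :: real
  define N where "N u = u * exp ((u + c)\<^sup>2 / 2)" for u
  define xp where "xp u = u + c + \<bar>c\<bar> * \<delta> u" for u
  define xm where "xm u = u + c - \<bar>c\<bar> * \<delta> u" for u
  have xp: "filterlim xp at_top at_top" unfolding xp_def[abs_def] \<delta>_def by real_asymp
  have xm: "filterlim xm at_top at_top" unfolding xm_def[abs_def] \<delta>_def by real_asymp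
  have ep: "((\<lambda>u. u / xp u * exp ((u + c)\<^sup>2 / 2 - (xp u)\<^sup>2 / 2)) \<longlongrightarrow> 1) at_top"
    unfolding xp_def \<delta>_def by real_asymp
  have em: "((\<lambda>u. u / xm u * exp ((u + c)\<^sup>2 / 2 - (xm u)\<^sup>2 / 2)) \<longlongrightarrow> 1) at_top"
    unfolding xm_def \<delta>_def by real_asymp
  have e1: "((\<lambda>u. exp (- \<delta> u * ((u\<^sup>2 - c\<^sup>2) / 2)) * u) \<longlongrightarrow> 0) at_top"
    unfolding \<delta>_def by real_asymp
  have e2: "((\<lambda>u. exp (- (xp u)\<^sup>2 / 2 - \<delta> u * ((xp u)\<^sup>2 / 2) + (u + c)\<^sup>2 / 2) * u) \<longlongrightarrow> 0) at_top"
    unfolding \<delta>_def xp_def by real_asymp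
  have ev: "\<forall>\<^sub>F u in at_top. u > 1 \<and> \<bar>c\<bar> \<le> u \<and> xp u > 0 \<and> xm u > 0"
    using xp xm
    by (intro eventually_conj eventually_gt_at_top eventually_ge_at_top) (auto simp: filterlim_at_top_dense)
  have N0: "N u \<ge> 0" if "u > 1" for u using that by (simp add: N_def)
  have \<delta>: "0 < \<delta> u" "\<delta> u < 1" if "u > 1" for u
  proof -
    have "1 < sqrt u" using that by simp
    then have "1 < u * sqrt u" using that less_1_mult by blast
    then show "0 < \<delta> u" "\<delta> u < 1" by (auto simp: \<delta>_def)
  qed
  have upper: "\<forall>\<^sub>F u in at_top. first_exit c {0..1} u * N u \<le> 2 * normal_tail (xm u) * N u + exp (- \<delta> u * ((u\<^sup>2 - c\<^sup>2) / 2)) * u"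
    using ev
  proof eventually_elim
    case (elim u)
    then have u: "u > 1" "\<bar>c\<bar> \<le> u" "xm u > 0" by auto
    have "first_exit c {0..1} u \<le> exp (- (u + c)\<^sup>2 / 2 - \<delta> u * ((u\<^sup>2 - c\<^sup>2) / 2)) + 2 * normal_tail (xm u)"
      using first_exit_split[OF \<delta>[OF u(1)], of c u] first_exit_early[of "\<delta> u" c u] first_exit_shift(1)[OF \<delta>[OF u(1)], of c u]
        first_exit_zero[of "xm u"] u \<delta>[OF u(1)] by (simp add: xm_def)
    then have "first_exit c {0..1} u * N u \<le> (exp (- (u + c)\<^sup>2 / 2 - \<delta> u * ((u\<^sup>2 - c\<^sup>2) / 2)) + 2 * normal_tail (xm u)) * N u"
      by (rule mult_right_mono[OF _ N0[OF u(1)]])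
    also have "\<dots> = exp (- (u + c)\<^sup>2 / 2 - \<delta> u * ((u\<^sup>2 - c\<^sup>2) / 2)) * exp ((u + c)\<^sup>2 / 2) * u + 2 * normal_tail (xm u) * N u"
      by (simp add: N_def algebra_simps)
    also have "exp (- (u + c)\<^sup>2 / 2 - \<delta> u * ((u\<^sup>2 - c\<^sup>2) / 2)) * exp ((u + c)\<^sup>2 / 2) = exp (- \<delta> u * ((u\<^sup>2 - c\<^sup>2) / 2))"
      unfolding exp_add[symmetric] by simp
    finally show ?case by simp
  qed
  have lower: "\<forall>\<^sub>F u in at_top. 2 * normal_tail (xp u) * N u - exp (- (xp u)\<^sup>2 / 2 - \<delta> u * ((xp u)\<^sup>2 / 2) + (u + c)\<^sup>2 / 2) * u \<le> first_exit c {0..1} u * N u"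
    using ev
  proof eventually_elim
    case (elim u)
    then have u: "u > 1" "xp u > 0" by auto
    \<comment> \<open>The reflection principle concerns all of [0,1], so the driftless motion at
      level \<open>xp u\<close> is split as well and its early exits are subtracted.\<close>
    have "2 * normal_tail (xp u) \<le> exp (- (xp u)\<^sup>2 / 2 - \<delta> u * ((xp u)\<^sup>2 / 2)) + first_exit c {0..1} u"
      using first_exit_split[OF \<delta>[OF u(1)], of 0 "xp u"] first_exit_early[of "\<delta> u" 0 "xp u"] first_exit_shift(2)[OF \<delta>[OF u(1)], where c = c and u = u]
        first_exit_zero[of "xp u"] u \<delta>[OF u(1)] by (simp add: xp_def)
    then have "2 * normal_tail (xp u) * N u \<le> (exp (- (xp u)\<^sup>2 / 2 - \<delta> u * ((xp u)\<^sup>2 / 2)) + first_exit c {0..1} u) * N u"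
      by (rule mult_right_mono[OF _ N0[OF u(1)]])
    also have "\<dots> = exp (- (xp u)\<^sup>2 / 2 - \<delta> u * ((xp u)\<^sup>2 / 2)) * exp ((u + c)\<^sup>2 / 2) * u + first_exit c {0..1} u * N u"
      by (simp add: N_def algebra_simps)
    finally show ?case unfolding exp_add[symmetric] by simp
  qed
  have lu: "((\<lambda>u. 2 * normal_tail (xm u) * N u + exp (- \<delta> u * ((u\<^sup>2 - c\<^sup>2) / 2)) * u) \<longlongrightarrow> 2 / sqrt (2 * pi)) at_top"
    using tendsto_add[OF normal_tail_shift[OF xm em] e1] by (simp add: N_def)
  have ll: "((\<lambda>u. 2 * normal_tail (xp u) * N u - exp (- (xp u)\<^sup>2 / 2 - \<delta> u * ((xp u)\<^sup>2 / 2) + (u + c)\<^sup>2 / 2) * u) \<longlongrightarrow> 2 / sqrt (2 * pi)) at_top"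
    using tendsto_diff[OF normal_tail_shift[OF xp ep] e2] by (simp add: N_def)
  show ?thesis using tendsto_sandwich[OF lower upper ll lu] by (simp add: N_def)
qed

end

section \<open>The second component at a late exit of the first\<close>

context standard_brownian_motion
begin

lemma AE_one_neq: "AE \<omega> in M. B 1 \<omega> \<noteq> x"
proof -
  have m: "(\<lambda>\<omega>. B 1 \<omega> - B 0 \<omega>) \<in> M \<rightarrow>\<^sub>M lborel" using increment_one by (rule distributed_measurable)
  have "AE y in density lborel (normal_density 0 1). y \<noteq> x"
    using AE_lborel_singleton[of x] by (subst AE_density) auto
  then have "AE y in distr M lborel (\<lambda>\<omega>. B 1 \<omega> - B 0 \<omega>). y \<noteq> x"
    unfolding distributed_distr_eq_density[OF increment_one] .
  from AE_distrD[OF m this] start show ?thesis by eventually_elim simp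
qed

lemma prob_one: "prob {\<omega>\<in>space M. B 1 \<omega> > x} = normal_tail x"
proof -
  have [measurable]: "B 1 \<in> borel_measurable M" "B 0 \<in> borel_measurable M" by (simp_all add: random_variable)
  have "prob {\<omega>\<in>space M. B 1 \<omega> > x} = prob {\<omega>\<in>space M. B 1 \<omega> - B 0 \<omega> > x}"
  proof (rule measure_eq_AE)
    show "AE \<omega> in M. \<omega> \<in> {\<omega>\<in>space M. B 1 \<omega> > x} \<longleftrightarrow> \<omega> \<in> {\<omega>\<in>space M. B 1 \<omega> - B 0 \<omega> > x}"
      using start by eventually_elim simp
  qed measurable
  then show ?thesis using prob_increment_one by simp
qed

end

lemma path_space_exit_sets:
  assumes "countable D" "D \<subseteq> {0..}" "G \<in> sets borel"
  shows "{x\<in>space path_space. \<exists>t\<in>D. \<alpha> * x t - \<beta> * t \<in> G} \<in> sets (path_space :: (real \<Rightarrow> real) measure)"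
proof (intro sets_Collect_bex_countable assms(1,3))
  fix t assume "t \<in> D"
  then have [measurable]: "(\<lambda>x. x t) \<in> borel_measurable (path_space :: (real \<Rightarrow> real) measure)"
    using assms(2) unfolding path_space_def by (intro measurable_component_singleton) auto
  show "(\<lambda>x. \<alpha> * x t - \<beta> * t) \<in> borel_measurable (path_space :: (real \<Rightarrow> real) measure)" by measurable
qed

lemma path_in_space: "path X \<omega> \<in> space (path_space :: (real \<Rightarrow> 'b::topological_space) measure)"
  by (simp add: path_space_def path_def space_PiM)

lemma path_apply: "t \<ge> 0 \<Longrightarrow> path X \<omega> t = X t \<omega>"
  by (simp add: path_def)

context planar_brownian_motion
begin

text \<open>The two existential times are separate, so each event depends on one path only and the
  product rule applies.\<close>

lemma indep_exits:
  assumes D: "countable D" "D \<subseteq> {0..}" "countable D'" "D' \<subseteq> {0..}" and G: "G \<in> sets borel" "H \<in> sets borel"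
  shows "measure M ({\<omega>\<in>space M. \<exists>t\<in>D. \<alpha> * B1 t \<omega> - c * t \<in> G} \<inter> {\<omega>\<in>space M. \<exists>t\<in>D'. \<beta> * B2 t \<omega> - k * t \<in> H})
    = measure M {\<omega>\<in>space M. \<exists>t\<in>D. \<alpha> * B1 t \<omega> - c * t \<in> G} * measure M {\<omega>\<in>space M. \<exists>t\<in>D'. \<beta> * B2 t \<omega> - k * t \<in> H}"
proof -
  let ?X = "{x\<in>space path_space. \<exists>t\<in>D. \<alpha> * x t - c * t \<in> G}"
  let ?Y = "{x\<in>space path_space. \<exists>t\<in>D'. \<beta> * x t - k * t \<in> H}"
  have X: "path B1 -` ?X \<inter> space M = {\<omega>\<in>space M. \<exists>t\<in>D. \<alpha> * B1 t \<omega> - c * t \<in> G}"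
  proof -
    have "path B1 \<omega> t = B1 t \<omega>" if "t \<in> D" for t \<omega> using that D(2) by (intro path_apply) auto
    then show ?thesis using path_in_space[of B1] by auto
  qed
  have Y: "path B2 -` ?Y \<inter> space M = {\<omega>\<in>space M. \<exists>t\<in>D'. \<beta> * B2 t \<omega> - k * t \<in> H}"
  proof -
    have "path B2 \<omega> t = B2 t \<omega>" if "t \<in> D'" for t \<omega> using that D(4) by (intro path_apply) auto
    then show ?thesis using path_in_space[of B2] by auto
  qed
  have "(\<lambda>\<omega>. (path B1 \<omega>, path B2 \<omega>)) -` (?X \<times> ?Y) \<inter> space M = (path B1 -` ?X \<inter> space M) \<inter> (path B2 -` ?Y \<inter> space M)"
    by auto
  then show ?thesis
    using B1.indep_varD[OF indep[unfolded independent_processes_def] path_space_exit_sets[OF D(1,2) G(1), of \<alpha> c] path_space_exit_sets[OF D(3,4) G(2), of \<beta> k]]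
    unfolding X Y by simp
qed

lemma second_exit_sets:
  assumes "countable D" "D \<subseteq> {0..}" "H \<in> sets borel"
  shows "{\<omega>\<in>space M. \<exists>t\<in>D. \<beta> * B2 t \<omega> - k * t \<in> H} \<in> sets M"
  using assms by (intro sets_Collect_bex_countable borel_measurable_diff borel_measurable_times B2.random_variable) auto

section \<open>The case a <= \<rho>: the second constraint near time 1\<close>

context
  fixes \<rho> r a c1 c2 k :: real and \<epsilon> :: "real \<Rightarrow> real" and D :: "real \<Rightarrow> real set" and Z :: "real \<Rightarrow> 'a \<Rightarrow> real"
  assumes r: "r > 0" and a: "a \<le> \<rho>" and k: "k = c2 - \<rho> * c1"
    and \<epsilon>: "\<And>u. \<epsilon> u = 1 / sqrt u" and D: "\<And>u. D u = \<rat> \<inter> {max 0 (1 - \<epsilon> u)..1}"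
    and Z: "\<And>t \<omega>. Z t \<omega> = r * B2 t \<omega> - k * t"
begin

text \<open>Two events of the independent part alone. Apart from atypical exits of the first
  component, \<open>late_some\<close> is necessary for the second constraint at the exit time, and
  the complement of \<open>late_fail\<close> is sufficient; quantifying over all late times removes
  the unknown exit time, and the margin |\<rho>| \<epsilon> covers the overshoot.\<close>

definition "late_some u = {\<omega>\<in>space M. \<exists>t\<in>D u. Z t \<omega> \<in> {- (\<bar>\<rho>\<bar> * \<epsilon> u) - (\<rho> - a) * u<..}}"
definition "late_fail u = {\<omega>\<in>space M. \<exists>t\<in>D u. Z t \<omega> \<in> {..\<bar>\<rho>\<bar> * \<epsilon> u - (\<rho> - a) * u}}"
definition "limit_event = (if a < \<rho> then space M else {\<omega>\<in>space M. Z 1 \<omega> > 0})"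

lemma countable_D: "countable (D u)" "D u \<subseteq> {0..}" "D u \<subseteq> {0..1}"
  by (auto simp: D intro: countable_Rats_Int)

lemma late_sets: "late_some u \<in> sets M" "late_fail u \<in> sets M"
  unfolding late_some_def late_fail_def Z by (intro second_exit_sets countable_D; simp)+

lemma limit_event_sets: "limit_event \<in> sets M"
proof -
  have [measurable]: "Z 1 \<in> borel_measurable M"
    unfolding Z[abs_def] using B2.random_variable[of 1] by measurable
  show ?thesis unfolding limit_event_def by simp
qed

lemma continuous_Z: "\<omega> \<in> space M \<Longrightarrow> continuous_on {0..1} (\<lambda>t. Z t \<omega>)"
  unfolding Z by (intro continuous_intros continuous_on_subset[OF B2.continuous_paths]) auto

lemma eps_limit: "((\<lambda>u. x * \<epsilon> u) \<longlongrightarrow> 0) at_top"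
  unfolding \<epsilon> by real_asymp

text \<open>If a < \<rho>, the threshold tends to minus infinity and passes below the bound of the
  path. If a = \<rho>, the threshold tends to 0 and the window shrinks to time 1, so continuity lets
  the sign of Z(1) decide, provided that Z(1) is not 0.\<close>

lemma late_pointwise:
  assumes \<omega>: "\<omega> \<in> space M" and nz: "Z 1 \<omega> \<noteq> 0"
  shows "\<forall>\<^sub>F u in at_top. (\<omega> \<in> late_some u \<longleftrightarrow> \<omega> \<in> limit_event) \<and> (\<omega> \<in> space M - late_fail u \<longleftrightarrow> \<omega> \<in> limit_event)"
proof (cases "a < \<rho>")
  case True
  have "bounded ((\<lambda>t. Z t \<omega>) ` {0..1})"
    by (intro compact_imp_bounded compact_continuous_image continuous_Z \<omega>) simp
  then obtain C where "\<forall>t\<in>{0..1}. \<bar>Z t \<omega>\<bar> \<le> C" unfolding bounded_iff by auto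
  then have C: "\<And>t. t \<in> {0..1} \<Longrightarrow> \<bar>Z t \<omega>\<bar> \<le> C" by blast
  have pos: "\<rho> - a > 0" using True by simp
  have "filterlim (\<lambda>u. \<bar>\<rho>\<bar> * \<epsilon> u - (\<rho> - a) * u) at_bot at_top"
    unfolding \<epsilon> using pos by real_asymp
  then have 1: "\<forall>\<^sub>F u in at_top. \<bar>\<rho>\<bar> * \<epsilon> u - (\<rho> - a) * u < - C" by (auto simp: filterlim_at_bot_dense)
  show ?thesis using 1 eventually_gt_at_top[of 0]
  proof eventually_elim
    case (elim u)
    have e: "0 < \<epsilon> u" using elim by (simp add: \<epsilon>)
    have D1: "1 \<in> D u" using e by (simp add: D)
    have "\<bar>\<rho>\<bar> * \<epsilon> u \<ge> 0" using e by simp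
    then have "Z 1 \<omega> \<in> {- (\<bar>\<rho>\<bar> * \<epsilon> u) - (\<rho> - a) * u<..}" using C[of 1] elim(1) by (simp add: abs_le_iff)
    then have "\<omega> \<in> late_some u" using D1 \<omega> unfolding late_some_def by blast
    moreover have "\<omega> \<notin> late_fail u"
    proof
      assume "\<omega> \<in> late_fail u"
      then obtain t where t: "t \<in> D u" "Z t \<omega> \<le> \<bar>\<rho>\<bar> * \<epsilon> u - (\<rho> - a) * u" unfolding late_fail_def by auto
      have "t \<in> {0..1}" using t(1) countable_D(3) by blast
      then show False using C[of t] t(2) elim(1) by (simp add: abs_le_iff)
    qed
    ultimately show ?case using True \<omega> by (simp add: limit_event_def)
  qed
next
  case False
  then have eqa: "a = \<rho>" using a by simp
  have na: "\<not> a < \<rho>" by fact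
  have "\<bar>Z 1 \<omega>\<bar> / 2 > 0" using nz by simp
  then obtain d where d: "d > 0" "\<And>t. t \<in> {0..1} \<Longrightarrow> dist t 1 < d \<Longrightarrow> dist (Z t \<omega>) (Z 1 \<omega>) < \<bar>Z 1 \<omega>\<bar> / 2"
    using continuous_Z[OF \<omega>] unfolding continuous_on_iff by (metis atLeastAtMost_iff order.refl zero_le_one)
  have 1: "\<forall>\<^sub>F u in at_top. \<bar>\<rho>\<bar> * \<epsilon> u < \<bar>Z 1 \<omega>\<bar> / 2" using order_tendstoD(2)[OF eps_limit] \<open>\<bar>Z 1 \<omega>\<bar> / 2 > 0\<close> by blast
  have 2: "\<forall>\<^sub>F u in at_top. \<epsilon> u < d" using order_tendstoD(2)[OF eps_limit[of 1] d(1)] by simp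
  show ?thesis using 1 2 eventually_gt_at_top[of 0]
  proof eventually_elim
    case (elim u)
    have e: "0 < \<epsilon> u" using elim by (simp add: \<epsilon>)
    have D1: "1 \<in> D u" using e by (simp add: D)
    have re: "\<bar>\<rho>\<bar> * \<epsilon> u \<ge> 0" using e by simp
    have near: "\<bar>Z t \<omega> - Z 1 \<omega>\<bar> < \<bar>Z 1 \<omega>\<bar> / 2" if "t \<in> D u" for t
    proof -
      have "t \<in> {0..1}" "1 - \<epsilon> u \<le> t" using that by (auto simp: D)
      then have "dist t 1 < d" using elim by (auto simp: dist_real_def)
      from d(2)[OF \<open>t \<in> {0..1}\<close> this] show ?thesis by (simp add: dist_real_def)
    qed
    show ?case
    proof (cases "Z 1 \<omega> > 0")
      case True
      have "Z 1 \<omega> \<in> {- (\<bar>\<rho>\<bar> * \<epsilon> u) - (\<rho> - a) * u<..}" using True re by (simp add: eqa del: zero_le_mult_iff)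
      then have "\<omega> \<in> late_some u" using D1 \<omega> unfolding late_some_def by blast
      moreover have "\<omega> \<notin> late_fail u"
      proof
        assume "\<omega> \<in> late_fail u"
        then obtain t where t: "t \<in> D u" "Z t \<omega> \<le> \<bar>\<rho>\<bar> * \<epsilon> u" unfolding late_fail_def by (auto simp: eqa)
        then show False using near[OF t(1)] elim(1) True by linarith
      qed
      ultimately show ?thesis using True \<omega> na by (simp add: limit_event_def)
    next
      case neg: False
      then have "Z 1 \<omega> < 0" using nz by simp
      then have "Z 1 \<omega> \<in> {..\<bar>\<rho>\<bar> * \<epsilon> u - (\<rho> - a) * u}" using re by (simp add: eqa del: zero_le_mult_iff)
      then have "\<omega> \<in> late_fail u" using D1 \<omega> unfolding late_fail_def by blast
      moreover have "\<omega> \<notin> late_some u"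
      proof
        assume "\<omega> \<in> late_some u"
        then obtain t where t: "t \<in> D u" "Z t \<omega> > - (\<bar>\<rho>\<bar> * \<epsilon> u)" unfolding late_some_def by (auto simp: eqa)
        then show False using near[OF t(1)] elim(1) \<open>Z 1 \<omega> < 0\<close> by linarith
      qed
      ultimately show ?thesis using neg na by (simp add: limit_event_def)
    qed
  qed
qed

lemma AE_Z_one: "AE \<omega> in M. Z 1 \<omega> \<noteq> 0"
  using B2.AE_one_neq[of "k / r"]
proof eventually_elim
  case (elim \<omega>)
  then show ?case using r by (simp add: Z field_simps)
qed

lemma tendsto_late:
  "((\<lambda>u. measure M (late_some u)) \<longlongrightarrow> measure M limit_event) at_top"
  "((\<lambda>u. measure M (space M - late_fail u)) \<longlongrightarrow> measure M limit_event) at_top"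
proof -
  have ae: "AE \<omega> in M. \<forall>\<^sub>F u in at_top. (\<omega> \<in> late_some u \<longleftrightarrow> \<omega> \<in> limit_event) \<and> (\<omega> \<in> space M - late_fail u \<longleftrightarrow> \<omega> \<in> limit_event)"
    using AE_Z_one AE_space by eventually_elim (rule late_pointwise)
  show "((\<lambda>u. measure M (late_some u)) \<longlongrightarrow> measure M limit_event) at_top"
  proof (rule B1.tendsto_prob_at_top[OF late_sets(1) limit_event_sets])
    show "AE \<omega> in M. \<forall>\<^sub>F u in at_top. \<omega> \<in> late_some u \<longleftrightarrow> \<omega> \<in> limit_event"
      using ae by eventually_elim (auto elim: eventually_mono)
  qed
  show "((\<lambda>u. measure M (space M - late_fail u)) \<longlongrightarrow> measure M limit_event) at_top"
  proof (rule B1.tendsto_prob_at_top[OF sets.compl_sets[OF late_sets(2)] limit_event_sets])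
    show "AE \<omega> in M. \<forall>\<^sub>F u in at_top. \<omega> \<in> space M - late_fail u \<longleftrightarrow> \<omega> \<in> limit_event"
      using ae by eventually_elim (auto elim: eventually_mono)
  qed
qed

lemma prob_limit_event: "measure M limit_event = (if a < \<rho> then 1 else normal_tail (k / r))"
proof -
  have "Z 1 \<omega> > 0 \<longleftrightarrow> B2 1 \<omega> > k / r" for \<omega> using r by (simp add: Z field_simps)
  then show ?thesis using B2.prob_one[of "k / r"] by (simp add: limit_event_def B1.prob_space)
qed

definition "both u = {\<omega>\<in>space M. \<exists>t\<in>\<rat> \<inter> {0..1}. B1 t \<omega> - c1 * t > u \<and> \<rho> * B1 t \<omega> + r * B2 t \<omega> - c2 * t > a * u}"

abbreviation "exits I u \<equiv> {\<omega>\<in>space M. \<exists>t\<in>I. B1 t \<omega> - c1 * t > u}"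

lemma both_sets: "both u \<in> sets M"
proof -
  have op: "open {p :: real \<times> real. fst p > u \<and> snd p > a * u}" by (intro open_Collect_conj open_Collect_less continuous_intros)
  have "{\<omega>\<in>space M. \<exists>t\<in>\<rat> \<inter> {0..1}. (B1 t \<omega> - c1 * t, \<rho> * B1 t \<omega> + r * B2 t \<omega> - c2 * t) \<in> {p. fst p > u \<and> snd p > a * u}} \<in> sets M"
    using op
    by (intro sets_Collect_bex_countable countable_Rats_Int borel_measurable_Pair borel_measurable_diff
        borel_measurable_add borel_measurable_times B1.random_variable B2.random_variable) auto
  then show ?thesis by (simp add: both_def)
qed

lemma exits_rational: "exits {0..1} u = exits (\<rat> \<inter> {0..1}) u"
  using first_exit_rational[of _ 0 1] by (intro Collect_cong conj_cong) auto

text \<open>The first component is between u and u + \<epsilon>, so up to |\<rho>| \<epsilon> its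
  contribution to the second component is \<rho> u. What remains is Z plus the deterministic slack
  (\<rho> - a) u.\<close>

lemma late_position:
  assumes "1 < u" "t \<in> \<rat> \<inter> {0..1}" "\<omega> \<in> space M" "\<omega> \<notin> exits {0..1 - \<epsilon> u} u" "B1 t \<omega> - c1 * t > u" "\<omega> \<notin> exits {0..1} (u + \<epsilon> u)"
  shows "t \<in> D u" "\<bar>\<rho> * (B1 t \<omega> - c1 * t - u)\<bar> \<le> \<bar>\<rho>\<bar> * \<epsilon> u"
    "\<rho> * B1 t \<omega> + r * B2 t \<omega> - c2 * t - a * u = \<rho> * (B1 t \<omega> - c1 * t - u) + Z t \<omega> + (\<rho> - a) * u"
proof -
  have "t \<notin> {0..1 - \<epsilon> u}" using assms by blast
  then show "t \<in> D u" using assms(2) by (auto simp: D)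
  have "\<not> B1 t \<omega> - c1 * t > u + \<epsilon> u" using assms by blast
  then have "\<bar>B1 t \<omega> - c1 * t - u\<bar> \<le> \<epsilon> u" using assms(5) by simp
  then show "\<bar>\<rho> * (B1 t \<omega> - c1 * t - u)\<bar> \<le> \<bar>\<rho>\<bar> * \<epsilon> u" unfolding abs_mult by (intro mult_left_mono) auto
  show "\<rho> * B1 t \<omega> + r * B2 t \<omega> - c2 * t - a * u = \<rho> * (B1 t \<omega> - c1 * t - u) + Z t \<omega> + (\<rho> - a) * u"
    by (simp add: Z k algebra_simps)
qed

lemma both_upper:
  assumes u: "1 < u"
  shows "both u \<subseteq> (exits {0..1} (u + \<epsilon> u) \<union> exits {0..1 - \<epsilon> u} u) \<union> (exits (\<rat> \<inter> {0..1}) u \<inter> late_some u)"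
proof
  fix \<omega> assume "\<omega> \<in> both u"
  then obtain t where t: "\<omega> \<in> space M" "t \<in> \<rat> \<inter> {0..1}" "B1 t \<omega> - c1 * t > u" "\<rho> * B1 t \<omega> + r * B2 t \<omega> - c2 * t > a * u"
    unfolding both_def by blast
  show "\<omega> \<in> (exits {0..1} (u + \<epsilon> u) \<union> exits {0..1 - \<epsilon> u} u) \<union> (exits (\<rat> \<inter> {0..1}) u \<inter> late_some u)"
  proof (cases "\<omega> \<in> exits {0..1} (u + \<epsilon> u) \<or> \<omega> \<in> exits {0..1 - \<epsilon> u} u")
    case False
    then have n: "\<omega> \<notin> exits {0..1 - \<epsilon> u} u" "\<omega> \<notin> exits {0..1} (u + \<epsilon> u)" by blast+
    note L = late_position[OF u t(2,1) n(1) t(3) n(2)]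
    have "Z t \<omega> > - (\<bar>\<rho>\<bar> * \<epsilon> u) - (\<rho> - a) * u" using L(2,3) t(4) by linarith
    then have "\<omega> \<in> late_some u" using L(1) t(1) unfolding late_some_def greaterThan_iff by blast
    then show ?thesis using t by blast
  qed blast
qed

lemma both_lower:
  assumes u: "1 < u"
  shows "exits (\<rat> \<inter> {0..1}) u - late_fail u \<subseteq> (exits {0..1} (u + \<epsilon> u) \<union> exits {0..1 - \<epsilon> u} u) \<union> both u"
proof
  fix \<omega> assume w: "\<omega> \<in> exits (\<rat> \<inter> {0..1}) u - late_fail u"
  then obtain t where t: "\<omega> \<in> space M" "t \<in> \<rat> \<inter> {0..1}" "B1 t \<omega> - c1 * t > u" by blast
  show "\<omega> \<in> (exits {0..1} (u + \<epsilon> u) \<union> exits {0..1 - \<epsilon> u} u) \<union> both u"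
  proof (cases "\<omega> \<in> exits {0..1} (u + \<epsilon> u) \<or> \<omega> \<in> exits {0..1 - \<epsilon> u} u")
    case False
    then have n: "\<omega> \<notin> exits {0..1 - \<epsilon> u} u" "\<omega> \<notin> exits {0..1} (u + \<epsilon> u)" by blast+
    note L = late_position[OF u t(2,1) n(1) t(3) n(2)]
    have "\<not> Z t \<omega> \<le> \<bar>\<rho>\<bar> * \<epsilon> u - (\<rho> - a) * u" using w L(1) t(1) unfolding late_fail_def atMost_iff by blast
    then have "\<rho> * B1 t \<omega> + r * B2 t \<omega> - c2 * t > a * u" using L(2,3) by linarith
    then have "\<omega> \<in> both u" using t unfolding both_def by blast
    then show ?thesis by blast
  qed blast
qed

text \<open>Up to errors, the joint event lies between the first exit intersected with two events of
  B2. Independence makes both probabilities products, and both second factors have the same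
  limit.\<close>

lemma tendsto_both:
  "((\<lambda>u. measure M (both u) * (u * exp ((u + c1)\<^sup>2 / 2))) \<longlongrightarrow> 2 / sqrt (2 * pi) * (if a < \<rho> then 1 else normal_tail (k / r))) at_top"
proof -
  define N where "N u = u * exp ((u + c1)\<^sup>2 / 2)" for u
  define F where "F u = first_exit c1 {0..1} u" for u
  \<comment> \<open>Large overshoot and early exit, normalised. With \<epsilon> = u^(-1/2) the first
    carries about exp(-u \<epsilon>) = exp(-u^(1/2)) and the second exp(-u^2 \<epsilon> / 2), while
    \<epsilon> still tends to 0.\<close>
  define err where "err u = F (u + \<epsilon> u) * N u + exp (- \<epsilon> u * ((u\<^sup>2 - c1\<^sup>2) / 2)) * u" for u
  have FN: "((\<lambda>u. F u * N u) \<longlongrightarrow> 2 / sqrt (2 * pi)) at_top" using first_exit_asymp by (simp add: F_def N_def)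
  have err: "(err \<longlongrightarrow> 0) at_top"
  proof -
    have x: "filterlim (\<lambda>u. u + \<epsilon> u) at_top at_top" unfolding \<epsilon> by real_asymp
    have q: "((\<lambda>u. u / (u + \<epsilon> u) * exp ((u + c1)\<^sup>2 / 2 - (u + \<epsilon> u + c1)\<^sup>2 / 2)) \<longlongrightarrow> 0) at_top" unfolding \<epsilon> by real_asymp
    have "((\<lambda>u. F (u + \<epsilon> u) * N (u + \<epsilon> u) * (u / (u + \<epsilon> u) * exp ((u + c1)\<^sup>2 / 2 - (u + \<epsilon> u + c1)\<^sup>2 / 2))) \<longlongrightarrow> 2 / sqrt (2 * pi) * 0) at_top"
      by (intro tendsto_mult q filterlim_compose[OF FN x])
    moreover have "\<forall>\<^sub>F u in at_top. F (u + \<epsilon> u) * N (u + \<epsilon> u) * (u / (u + \<epsilon> u) * exp ((u + c1)\<^sup>2 / 2 - (u + \<epsilon> u + c1)\<^sup>2 / 2)) = F (u + \<epsilon> u) * N u"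
      using filterlim_at_top_dense[THEN iffD1, OF x, rule_format, of 0]
    proof eventually_elim
      case (elim u)
      define y where "y = u + \<epsilon> u"
      have y: "y > 0" using elim by (simp add: y_def)
      have "exp ((y + c1)\<^sup>2 / 2) * exp ((u + c1)\<^sup>2 / 2 - (y + c1)\<^sup>2 / 2) = exp ((u + c1)\<^sup>2 / 2)"
        unfolding exp_add[symmetric] by simp
      then have "N y * (u / y * exp ((u + c1)\<^sup>2 / 2 - (y + c1)\<^sup>2 / 2)) = N u"
        using y unfolding N_def by simp
      then show ?case unfolding y_def[symmetric] by (simp only: mult.assoc[of "F y" "N y"])
    qed
    ultimately have 1: "((\<lambda>u. F (u + \<epsilon> u) * N u) \<longlongrightarrow> 2 / sqrt (2 * pi) * 0) at_top" by (rule Lim_transform_eventually)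
    have 2: "((\<lambda>u. exp (- \<epsilon> u * ((u\<^sup>2 - c1\<^sup>2) / 2)) * u) \<longlongrightarrow> 0) at_top" unfolding \<epsilon> by real_asymp
    show ?thesis unfolding err_def[abs_def] using tendsto_add[OF 1 2] by simp
  qed
  have ev: "\<forall>\<^sub>F u in at_top. u > 1 \<and> \<bar>c1\<bar> \<le> u" by (intro eventually_conj eventually_gt_at_top eventually_ge_at_top)
  have basics: "0 < \<epsilon> u \<and> \<epsilon> u < 1 \<and> 0 \<le> N u \<and>
      measure M (exits {0..1} (u + \<epsilon> u) \<union> exits {0..1 - \<epsilon> u} u) * N u \<le> err u \<and>
      exits {0..1} (u + \<epsilon> u) \<union> exits {0..1 - \<epsilon> u} u \<in> sets M \<and> exits (\<rat> \<inter> {0..1}) u \<in> sets M \<and> measure M (exits (\<rat> \<inter> {0..1}) u) = F u"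
    if u: "u > 1" "\<bar>c1\<bar> \<le> u" for u
  proof -
    have "1 < sqrt u" using u by simp
    then have e: "0 < \<epsilon> u" "\<epsilon> u < 1" by (auto simp: \<epsilon>)
    have N0: "0 \<le> N u" using u by (simp add: N_def)
    have s: "exits {0..1} (u + \<epsilon> u) \<in> sets M" "exits {0..1 - \<epsilon> u} u \<in> sets M" using e by (auto intro!: first_exit_sets)
    have "measure M (exits {0..1} (u + \<epsilon> u) \<union> exits {0..1 - \<epsilon> u} u) \<le> F (u + \<epsilon> u) + exp (- (u + c1)\<^sup>2 / 2 - \<epsilon> u * ((u\<^sup>2 - c1\<^sup>2) / 2))"
      using measure_Un_le[OF s] first_exit_early[of "\<epsilon> u" c1 u] e u by (simp add: F_def first_exit_def)
    then have "measure M (exits {0..1} (u + \<epsilon> u) \<union> exits {0..1 - \<epsilon> u} u) * N u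
        \<le> (F (u + \<epsilon> u) + exp (- (u + c1)\<^sup>2 / 2 - \<epsilon> u * ((u\<^sup>2 - c1\<^sup>2) / 2))) * N u"
      by (rule mult_right_mono[OF _ N0])
    also have "\<dots> = F (u + \<epsilon> u) * N u + exp (- (u + c1)\<^sup>2 / 2 - \<epsilon> u * ((u\<^sup>2 - c1\<^sup>2) / 2)) * exp ((u + c1)\<^sup>2 / 2) * u"
      by (simp add: N_def algebra_simps)
    also have "\<dots> = err u" unfolding exp_add[symmetric] err_def by simp
    finally show ?thesis using e N0 s exits_rational[of u] by (auto simp: F_def first_exit_def intro: sets_first_exit countable_Rats_Int)
  qed
  have D01: "\<rat> \<inter> {0..1} \<subseteq> {0::real..}" by auto
  \<comment> \<open>The B1 event ranges over all rational times of [0,1] and not over the window, so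
    its probability is exactly the first exit probability.\<close>
  have prod_some: "measure M (exits (\<rat> \<inter> {0..1}) u \<inter> late_some u) = measure M (exits (\<rat> \<inter> {0..1}) u) * measure M (late_some u)" for u
    using indep_exits[OF countable_Rats_Int D01 countable_D(1,2), of "{u<..}" "{- (\<bar>\<rho>\<bar> * \<epsilon> u) - (\<rho> - a) * u<..}" 1 c1 u r k]
    unfolding late_some_def Z by simp
  have prod_fail: "measure M (exits (\<rat> \<inter> {0..1}) u \<inter> late_fail u) = measure M (exits (\<rat> \<inter> {0..1}) u) * measure M (late_fail u)" for u
    using indep_exits[OF countable_Rats_Int D01 countable_D(1,2), of "{u<..}" "{..\<bar>\<rho>\<bar> * \<epsilon> u - (\<rho> - a) * u}" 1 c1 u r k]
    unfolding late_fail_def Z by simp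
  have upper: "\<forall>\<^sub>F u in at_top. measure M (both u) * N u \<le> F u * N u * measure M (late_some u) + err u"
    using ev
  proof eventually_elim
    case (elim u)
    note b = basics[of u]
    have s: "exits (\<rat> \<inter> {0..1}) u \<inter> late_some u \<in> sets M" using b elim late_sets(1)[of u] by blast
    have bad: "exits {0..1} (u + \<epsilon> u) \<union> exits {0..1 - \<epsilon> u} u \<in> sets M" using b elim by blast
    have "measure M (both u) \<le> measure M (exits {0..1} (u + \<epsilon> u) \<union> exits {0..1 - \<epsilon> u} u) + measure M (exits (\<rat> \<inter> {0..1}) u \<inter> late_some u)"
      using elim by (intro order_trans[OF B1.finite_measure_mono[OF both_upper sets.Un[OF bad s]] measure_Un_le[OF bad s]]) auto
    then have "measure M (both u) * N u \<le> (measure M (exits {0..1} (u + \<epsilon> u) \<union> exits {0..1 - \<epsilon> u} u) + measure M (exits (\<rat> \<inter> {0..1}) u \<inter> late_some u)) * N u"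
      using b elim by (intro mult_right_mono) auto
    also have "\<dots> \<le> err u + F u * measure M (late_some u) * N u"
      using b elim prod_some[of u] by (simp only: distrib_right) simp
    finally show ?case by (simp add: mult_ac add.commute)
  qed
  have lower: "\<forall>\<^sub>F u in at_top. F u * N u * measure M (space M - late_fail u) - err u \<le> measure M (both u) * N u"
    using ev
  proof eventually_elim
    case (elim u)
    note b = basics[of u]
    have Xs: "exits (\<rat> \<inter> {0..1}) u \<in> sets M" using b elim by blast
    have bad: "exits {0..1} (u + \<epsilon> u) \<union> exits {0..1 - \<epsilon> u} u \<in> sets M" using b elim by blast
    have "measure M (exits (\<rat> \<inter> {0..1}) u - late_fail u) = measure M (exits (\<rat> \<inter> {0..1}) u) - measure M (exits (\<rat> \<inter> {0..1}) u \<inter> late_fail u)"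
      by (rule B1.finite_measure_Diff'[OF Xs late_sets(2)])
    also have "\<dots> = F u * measure M (space M - late_fail u)"
      unfolding prod_fail B1.prob_compl[OF late_sets(2)] using b elim by (simp add: right_diff_distrib)
    finally have d: "measure M (exits (\<rat> \<inter> {0..1}) u - late_fail u) = F u * measure M (space M - late_fail u)" .
    have "measure M (exits (\<rat> \<inter> {0..1}) u - late_fail u) \<le> measure M (exits {0..1} (u + \<epsilon> u) \<union> exits {0..1 - \<epsilon> u} u) + measure M (both u)"
      using elim by (intro order_trans[OF B1.finite_measure_mono[OF both_lower sets.Un[OF bad both_sets]] measure_Un_le[OF bad both_sets]]) auto
    then have "F u * measure M (space M - late_fail u) * N u \<le> (measure M (exits {0..1} (u + \<epsilon> u) \<union> exits {0..1 - \<epsilon> u} u) + measure M (both u)) * N u"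
      unfolding d using b elim by (intro mult_right_mono) auto
    also have "\<dots> \<le> err u + measure M (both u) * N u"
      using b elim by (simp only: distrib_right) simp
    finally show ?case by (simp add: mult_ac)
  qed
  have lu: "((\<lambda>u. F u * N u * measure M (late_some u) + err u) \<longlongrightarrow> 2 / sqrt (2 * pi) * measure M limit_event + 0) at_top"
    by (intro tendsto_add tendsto_mult FN err tendsto_late)
  have ll: "((\<lambda>u. F u * N u * measure M (space M - late_fail u) - err u) \<longlongrightarrow> 2 / sqrt (2 * pi) * measure M limit_event - 0) at_top"
    by (intro tendsto_diff tendsto_mult FN err tendsto_late)
  show ?thesis using tendsto_sandwich[OF lower upper] ll lu unfolding prob_limit_event N_def by simp
qed

end

end

section \<open>Correlated pairs\<close>

text \<open>Countably many times make the event one of the product sigma-algebra, hence a function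
  of the law of the process.\<close>

lemma measure_process_law_exit:
  fixes X :: "real \<Rightarrow> 'a \<Rightarrow> 'c::topological_space" and f :: "real \<Rightarrow> 'c \<Rightarrow> 'd::topological_space"
  assumes X: "\<And>t. t \<ge> 0 \<Longrightarrow> X t \<in> borel_measurable M"
    and D: "countable D" "D \<subseteq> {0..}" and f: "\<And>t. t \<in> D \<Longrightarrow> f t \<in> borel_measurable borel" and G: "G \<in> sets borel"
  shows "measure (process_law M X) {x\<in>space path_space. \<exists>t\<in>D. f t (x t) \<in> G} = measure M {\<omega>\<in>space M. \<exists>t\<in>D. f t (X t \<omega>) \<in> G}"
proof -
  let ?S = "{x\<in>space path_space. \<exists>t\<in>D. f t (x t) \<in> G}"
  have S: "?S \<in> sets path_space"
  proof (intro sets_Collect_bex_countable D G)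
    fix t assume t: "t \<in> D"
    then have "(\<lambda>x. x t) \<in> borel_measurable path_space"
      using D(2) unfolding path_space_def by (intro measurable_component_singleton) auto
    then show "(\<lambda>x. f t (x t)) \<in> borel_measurable path_space" by (rule measurable_compose[OF _ f[OF t]])
  qed
  have pm: "path X \<in> M \<rightarrow>\<^sub>M path_space"
    unfolding path_space_def path_def[abs_def] using X by (intro measurable_restrict) auto
  have "path X \<omega> t = X t \<omega>" if "t \<in> D" for t \<omega> using that D(2) by (intro path_apply) auto
  then have "path X -` ?S \<inter> space M = {\<omega>\<in>space M. \<exists>t\<in>D. f t (X t \<omega>) \<in> G}"
    using path_in_space[of X] by auto
  then show ?thesis unfolding process_law_def measure_distr[OF pm S] by simp
qed

text \<open>The linear map from the independent pair to the correlated pair has determinant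
  r.\<close>

lemma nn_integral_shear:
  fixes f :: "real \<times> real \<Rightarrow> ennreal"
  assumes f: "f \<in> borel_measurable borel" and r: "r > 0"
  shows "(\<integral>\<^sup>+z. f z \<partial>lborel) = ennreal r * (\<integral>\<^sup>+w. f (fst w, \<rho> * fst w + r * snd w) \<partial>lborel)"
proof -
  have f': "f \<in> borel_measurable (lborel \<Otimes>\<^sub>M lborel)" using f by (simp add: lborel_prod)
  have "(\<lambda>w. (fst w, \<rho> * fst w + r * snd w)) \<in> borel \<rightarrow>\<^sub>M (borel :: (real \<times> real) measure)"
    by (intro borel_measurable_continuous_onI continuous_intros)
  from measurable_compose[OF this f]
  have g: "(\<lambda>w. f (fst w, \<rho> * fst w + r * snd w)) \<in> borel_measurable (lborel \<Otimes>\<^sub>M lborel)" by (simp add: lborel_prod)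
  have "(\<integral>\<^sup>+z. f z \<partial>lborel) = (\<integral>\<^sup>+x. \<integral>\<^sup>+y. f (x, y) \<partial>lborel \<partial>lborel)"
    using lborel.nn_integral_fst[OF f'] by (simp add: lborel_prod)
  also have "\<dots> = (\<integral>\<^sup>+x. ennreal r * (\<integral>\<^sup>+y. f (x, \<rho> * x + r * y) \<partial>lborel) \<partial>lborel)"
  proof (rule nn_integral_cong)
    fix x :: real
    have "(\<lambda>y. (x, y)) \<in> borel \<rightarrow>\<^sub>M (borel :: (real \<times> real) measure)"
      by (intro borel_measurable_continuous_onI continuous_intros)
    from measurable_compose[OF this f]
    show "(\<integral>\<^sup>+y. f (x, y) \<partial>lborel) = ennreal r * (\<integral>\<^sup>+y. f (x, \<rho> * x + r * y) \<partial>lborel)"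
      using r by (subst nn_integral_real_affine[where c = r and t = "\<rho> * x"]) auto
  qed
  also have "\<dots> = ennreal r * (\<integral>\<^sup>+x. \<integral>\<^sup>+y. f (x, \<rho> * x + r * y) \<partial>lborel \<partial>lborel)"
  proof (rule nn_integral_cmult)
    show "(\<lambda>x. \<integral>\<^sup>+y. f (x, \<rho> * x + r * y) \<partial>lborel) \<in> borel_measurable lborel"
      using lborel.borel_measurable_nn_integral_fst[OF g] by simp
  qed
  also have "(\<integral>\<^sup>+x. \<integral>\<^sup>+y. f (x, \<rho> * x + r * y) \<partial>lborel \<partial>lborel) = (\<integral>\<^sup>+w. f (fst w, \<rho> * fst w + r * snd w) \<partial>lborel)"
    using lborel.nn_integral_fst[OF g] by (simp add: lborel_prod)
  finally show ?thesis .
qed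

text \<open>A density is determined only up to null sets; continuity fixes its values at the single
  points where the asymptotics evaluate it.\<close>

lemma continuous_AE_eq_imp_eq:
  fixes f g :: "'a::euclidean_space \<Rightarrow> real"
  assumes "continuous_on UNIV f" "continuous_on UNIV g" "AE z in lborel. f z = g z"
  shows "f = g"
proof (rule ext, rule ccontr)
  fix z assume z: "f z \<noteq> g z"
  have op: "open {z. f z \<noteq> g z}" using assms by (intro open_Collect_neq)
  have "AE z in lborel. z \<notin> {z. f z \<noteq> g z}" using assms(3) by simp
  then have "{z. f z \<noteq> g z} \<in> null_sets lborel" using op by (subst (asm) AE_iff_null_sets[symmetric]) auto
  then have "negligible {z. f z \<noteq> g z}" using null_sets_completionI negligible_iff_null_sets by blast
  moreover have "{z. f z \<noteq> g z} \<noteq> {}" using z by blast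
  ultimately show False using open_not_negligible[OF op] by blast
qed

text \<open>The asymptotic relation makes the tail positive far out, and the tail decreases.
  Positivity keeps the limiting constant away from 0 when a = \<rho>.\<close>

lemma normal_tail_pos: "normal_tail x > 0"
proof -
  interpret N: prob_space "density lborel (normal_density 0 1)" by (rule prob_space_normal_density) simp
  have "\<forall>\<^sub>F y in at_top. 0 < normal_tail y * (y * exp (y\<^sup>2 / 2))"
    by (rule order_tendstoD(1)[OF normal_tail_asymp]) simp
  then have "\<forall>\<^sub>F y in at_top. 0 < normal_tail y * (y * exp (y\<^sup>2 / 2)) \<and> y > x"
    by (intro eventually_conj eventually_gt_at_top)
  then obtain y where y: "0 < normal_tail y * (y * exp (y\<^sup>2 / 2))" "y > x"
    by (metis (no_types, lifting) eventually_at_top_linorder order_refl)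
  then have "normal_tail y \<noteq> 0" by (intro notI) simp
  then have "0 < normal_tail y" by (simp add: zero_less_measure_iff)
  also have "\<dots> \<le> normal_tail x" using y(2) by (intro N.finite_measure_mono) auto
  finally show ?thesis .
qed

lemma normal_tail_minus: "normal_tail (- x) = 1 - normal_tail x"
proof -
  let ?N = "density lborel (normal_density 0 1)"
  interpret N: prob_space ?N by (rule prob_space_normal_density) simp
  have lg: "linear_gauss 1 = ?N" by (simp add: linear_gauss_def)
  have "emeasure ?N {..<x} = (\<integral>\<^sup>+y. indicator {..<x} y \<partial>?N)" by simp
  also have "\<dots> = (\<integral>\<^sup>+y. indicator {- x<..} (- y) \<partial>?N)"
    by (rule nn_integral_cong) (simp only: indicator_def lessThan_iff greaterThan_iff neg_less_iff_less)
  also have "\<dots> = (\<integral>\<^sup>+y. indicator {- x<..} y \<partial>?N)"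
    using linear_gauss_symmetric[of 1 "indicator {- x<..}"] unfolding lg by simp
  also have "\<dots> = emeasure ?N {- x<..}" by simp
  finally have 1: "normal_tail (- x) = measure ?N {..<x}" by (simp add: measure_def)
  have ae: "AE y in ?N. y \<noteq> x" using AE_lborel_singleton[of x] by (subst AE_density) auto
  have "measure ?N {..<x} = measure ?N (space ?N - {x<..})"
  proof (rule measure_eq_AE)
    show "AE y in ?N. y \<in> {..<x} \<longleftrightarrow> y \<in> space ?N - {x<..}"
      using ae by eventually_elim auto
  qed auto
  also have "\<dots> = 1 - normal_tail x" by (rule N.prob_compl) simp
  finally show ?thesis using 1 by simp
qed

section \<open>Transfer from the independent pair to the correlated pair\<close>

locale correlated_pair = planar_brownian_motion M B1 B2
  for M :: "'a measure" and B1 B2 +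
  fixes N :: "'b measure" and W1 W2 :: "real \<Rightarrow> 'b \<Rightarrow> real" and \<rho> r :: real
  assumes prob_N: "prob_space N"
    and W1: "\<And>t. t \<ge> 0 \<Longrightarrow> W1 t \<in> borel_measurable N" and W2: "\<And>t. t \<ge> 0 \<Longrightarrow> W2 t \<in> borel_measurable N"
    and cont1: "\<And>\<omega>. \<omega> \<in> space N \<Longrightarrow> continuous_on {0..} (\<lambda>t. W1 t \<omega>)"
    and cont2: "\<And>\<omega>. \<omega> \<in> space N \<Longrightarrow> continuous_on {0..} (\<lambda>t. W2 t \<omega>)"
    and law: "process_law N (\<lambda>t \<omega>. (W1 t \<omega>, W2 t \<omega>)) = process_law M (\<lambda>t \<omega>. (B1 t \<omega>, \<rho> * B1 t \<omega> + r * B2 t \<omega>))"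
    and rho: "-1 < \<rho>" "\<rho> < 1" and r: "r = sqrt (1 - \<rho>\<^sup>2)"
begin

lemma r_pos: "r > 0" and r_sq: "r\<^sup>2 = 1 - \<rho>\<^sup>2" and rho_sq: "\<rho>\<^sup>2 < 1"
proof -
  show *: "\<rho>\<^sup>2 < 1" using rho by (simp add: abs_square_less_1 abs_less_iff)
  then show "r > 0" "r\<^sup>2 = 1 - \<rho>\<^sup>2" by (simp_all add: r)
qed

lemma transfer:
  fixes f :: "real \<Rightarrow> real \<times> real \<Rightarrow> 'd::topological_space"
  assumes "countable D" "D \<subseteq> {0..}" "\<And>t. t \<in> D \<Longrightarrow> f t \<in> borel_measurable borel" "G \<in> sets borel"
  shows "measure N {\<omega>\<in>space N. \<exists>t\<in>D. f t (W1 t \<omega>, W2 t \<omega>) \<in> G}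
    = measure M {\<omega>\<in>space M. \<exists>t\<in>D. f t (B1 t \<omega>, \<rho> * B1 t \<omega> + r * B2 t \<omega>) \<in> G}"
proof -
  have 1: "(\<lambda>\<omega>. (W1 t \<omega>, W2 t \<omega>)) \<in> borel_measurable N" if "t \<ge> 0" for t
    using W1[OF that] W2[OF that] by (intro borel_measurable_Pair)
  have 2: "(\<lambda>\<omega>. (B1 t \<omega>, \<rho> * B1 t \<omega> + r * B2 t \<omega>)) \<in> borel_measurable M" if "t \<ge> 0" for t
    using B1.random_variable[OF that] B2.random_variable[OF that]
    by (intro borel_measurable_Pair borel_measurable_add borel_measurable_times) auto
  let ?S = "{x\<in>space path_space. \<exists>t\<in>D. f t (x t) \<in> G}"
  have "measure (process_law N (\<lambda>t \<omega>. (W1 t \<omega>, W2 t \<omega>))) ?S = measure N {\<omega>\<in>space N. \<exists>t\<in>D. f t (W1 t \<omega>, W2 t \<omega>) \<in> G}"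
    by (rule measure_process_law_exit) (fact 1 assms)+
  moreover have "measure (process_law M (\<lambda>t \<omega>. (B1 t \<omega>, \<rho> * B1 t \<omega> + r * B2 t \<omega>))) ?S
    = measure M {\<omega>\<in>space M. \<exists>t\<in>D. f t (B1 t \<omega>, \<rho> * B1 t \<omega> + r * B2 t \<omega>) \<in> G}"
    by (rule measure_process_law_exit) (fact 2 assms)+
  ultimately show ?thesis by (simp only: law)
qed

text \<open>Continuity of W with an open quadrant reduces to rational times on the left, which is
  what allows the law to be used; the right-hand side stays on rational times.\<close>

lemma drift_exit:
  assumes S: "S \<subseteq> closure (\<rat> \<inter> S)" "S \<subseteq> {0..}"
  shows "measure N {\<omega>\<in>space N. \<exists>t\<in>S. W1 t \<omega> - d1 * t > x \<and> W2 t \<omega> - d2 * t > y}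
    = measure M {\<omega>\<in>space M. \<exists>t\<in>\<rat> \<inter> S. B1 t \<omega> - d1 * t > x \<and> \<rho> * B1 t \<omega> + r * B2 t \<omega> - d2 * t > y}"
proof -
  let ?G = "{p :: real \<times> real. fst p > x \<and> snd p > y}"
  have op: "open ?G" by (intro open_Collect_conj open_Collect_less continuous_intros)
  have rat: "(\<exists>t\<in>S. (W1 t \<omega> - d1 * t, W2 t \<omega> - d2 * t) \<in> ?G) \<longleftrightarrow> (\<exists>t\<in>\<rat> \<inter> S. (W1 t \<omega> - d1 * t, W2 t \<omega> - d2 * t) \<in> ?G)"
    if "\<omega> \<in> space N" for \<omega>
    using S op
    by (intro ex_rational_in_open continuous_intros continuous_on_subset[OF cont1[OF that]] continuous_on_subset[OF cont2[OF that]]) auto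
  have "measure N {\<omega>\<in>space N. \<exists>t\<in>S. W1 t \<omega> - d1 * t > x \<and> W2 t \<omega> - d2 * t > y}
    = measure N {\<omega>\<in>space N. \<exists>t\<in>\<rat> \<inter> S. (\<lambda>p. (fst p - d1 * t, snd p - d2 * t)) (W1 t \<omega>, W2 t \<omega>) \<in> ?G}"
    using rat by (intro arg_cong[of _ _ "measure N"] Collect_cong conj_cong) auto
  also have "\<dots> = measure M {\<omega>\<in>space M. \<exists>t\<in>\<rat> \<inter> S. (\<lambda>p. (fst p - d1 * t, snd p - d2 * t)) (B1 t \<omega>, \<rho> * B1 t \<omega> + r * B2 t \<omega>) \<in> ?G}"
    using S op by (intro transfer countable_Rats_Int borel_measurable_continuous_onI continuous_intros) auto
  finally show ?thesis by simp
qed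

lemma psi_eq:
  "psi N W1 W2 c1 c2 u v = measure M {\<omega>\<in>space M. \<exists>t\<in>\<rat> \<inter> {0..1}. B1 t \<omega> - c1 * t > u \<and> \<rho> * B1 t \<omega> + r * B2 t \<omega> - c2 * t > v}"
  unfolding psi_def by (rule drift_exit[OF closure_rational_atLeastAtMost]) auto

text \<open>Inverse of the map (x, y) to (x, \<rho> x + r y), i.e. the coordinates of the
  independent pair.\<close>

definition unshear :: "real \<times> real \<Rightarrow> real \<times> real" where
  "unshear z = (fst z, (snd z - \<rho> * fst z) / r)"

lemma continuous_unshear: "continuous_on UNIV unshear"
  unfolding unshear_def[abs_def] using r_pos by (intro continuous_intros) auto

lemma measurable_unshear [measurable]: "unshear \<in> borel \<rightarrow>\<^sub>M borel"
  by (intro borel_measurable_continuous_onI continuous_unshear)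

lemma unshear_shear [simp]: "unshear (fst w, \<rho> * fst w + r * snd w) = w"
  using r_pos by (simp add: unshear_def)

text \<open>The pair at time 1 is the sheared standard planar Gaussian, so its density is the
  Gaussian one in unsheared coordinates divided by the determinant; continuity upgrades equality
  almost everywhere.\<close>

lemma joint_density:
  assumes pdf: "joint_pdf N (W1 1) (W2 1) \<phi>" and cont: "continuous_on UNIV \<phi>"
  shows "\<phi> z = planar_density 1 (unshear z) / r"
proof -
  define g where "g z = planar_density 1 (unshear z) / r" for z
  have g0: "0 \<le> g z" for z using r_pos by (simp add: g_def planar_density_nonneg)
  have gm[measurable]: "g \<in> borel_measurable borel" unfolding g_def[abs_def] by measurable
  have pd: "continuous_on UNIV (planar_density 1)"
    unfolding planar_density_def[abs_def] by (intro continuous_intros) auto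
  have gc: "continuous_on UNIV g"
    unfolding g_def[abs_def] using r_pos
    by (intro continuous_intros continuous_on_compose2[OF pd continuous_unshear]) auto
  have \<phi>0: "0 \<le> \<phi> z" for z using pdf unfolding joint_pdf_def by blast
  have \<phi>m: "\<phi> \<in> borel_measurable borel" by (rule borel_measurable_continuous_onI[OF cont])
  have dist: "distributed N (lborel \<Otimes>\<^sub>M lborel) (\<lambda>\<omega>. (W1 1 \<omega>, W2 1 \<omega>)) (\<lambda>z. ennreal (\<phi> z))"
    using pdf by (simp add: joint_pdf_def)
  let ?W = "\<lambda>\<omega>. (W1 1 \<omega>, W2 1 \<omega>)"
  have Wm: "?W \<in> borel_measurable N" using W1[of 1] W2[of 1] by (intro borel_measurable_Pair) auto
  interpret N: prob_space N by (rule prob_N)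
  have "density lborel (\<lambda>z. ennreal (\<phi> z)) = density lborel (\<lambda>z. ennreal (g z))"
  proof (rule measure_eqI)
    fix G assume "G \<in> sets (density lborel (\<lambda>z. ennreal (\<phi> z)))"
    then have G[measurable]: "G \<in> sets borel" by simp
    have "emeasure (density lborel (\<lambda>z. ennreal (\<phi> z))) G = emeasure (distr N (lborel \<Otimes>\<^sub>M lborel) ?W) G"
      unfolding distributed_distr_eq_density[OF dist] by (simp add: lborel_prod)
    also have "\<dots> = emeasure N {\<omega>\<in>space N. ?W \<omega> \<in> G}"
      unfolding lborel_prod using Wm by (subst emeasure_distr) (auto simp: vimage_def Int_def conj_commute)
    \<comment> \<open>A one-element set of times casts the event in the form required by
      \<open>transfer\<close>.\<close>
    also have "\<dots> = ennreal (measure N {\<omega>\<in>space N. \<exists>t\<in>{1}. id (W1 t \<omega>, W2 t \<omega>) \<in> G})"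
      by (simp add: N.emeasure_eq_measure)
    also have "\<dots> = ennreal (measure M {\<omega>\<in>space M. \<exists>t\<in>{1}. id (B1 t \<omega>, \<rho> * B1 t \<omega> + r * B2 t \<omega>) \<in> G})"
      by (subst transfer[where f = "\<lambda>_. id"]) auto
    also have "\<dots> = emeasure M {\<omega>\<in>space M. B 1 \<omega> \<in> {w. (fst w, \<rho> * fst w + r * snd w) \<in> G}}"
      by (simp add: B1.emeasure_eq_measure B_def)
    also have "\<dots> = emeasure (planar_gauss 1) {w. (fst w, \<rho> * fst w + r * snd w) \<in> G}"
    proof -
      have [measurable]: "(\<lambda>w. (fst w, \<rho> * fst w + r * snd w)) \<in> borel \<rightarrow>\<^sub>M (borel :: (real \<times> real) measure)"
        by (intro borel_measurable_continuous_onI continuous_intros)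
      have "{w. (fst w, \<rho> * fst w + r * snd w) \<in> G} \<in> sets borel" by measurable
      from emeasure_B[of 0, OF _ _ this] show ?thesis by simp
    qed
    also have "\<dots> = (\<integral>\<^sup>+w. ennreal (planar_density 1 w) * indicator G (fst w, \<rho> * fst w + r * snd w) \<partial>lborel)"
    proof -
      have [measurable]: "(\<lambda>w. (fst w, \<rho> * fst w + r * snd w)) \<in> borel \<rightarrow>\<^sub>M (borel :: (real \<times> real) measure)"
        by (intro borel_measurable_continuous_onI continuous_intros)
      have s: "{w. (fst w, \<rho> * fst w + r * snd w) \<in> G} \<in> sets borel" by measurable
      then have "emeasure (planar_gauss 1) {w. (fst w, \<rho> * fst w + r * snd w) \<in> G}
        = (\<integral>\<^sup>+w. ennreal (planar_density 1 w) * indicator {w. (fst w, \<rho> * fst w + r * snd w) \<in> G} w \<partial>lborel)"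
        unfolding planar_gauss_def by (simp add: emeasure_density)
      then show ?thesis by (simp add: indicator_def)
    qed
    also have "\<dots> = (\<integral>\<^sup>+w. ennreal r * (ennreal (g (fst w, \<rho> * fst w + r * snd w)) * indicator G (fst w, \<rho> * fst w + r * snd w)) \<partial>lborel)"
    proof (rule nn_integral_cong)
      fix w :: "real \<times> real"
      have "planar_density 1 w = r * g (fst w, \<rho> * fst w + r * snd w)" using r_pos by (simp add: g_def)
      then show "ennreal (planar_density 1 w) * indicator G (fst w, \<rho> * fst w + r * snd w)
         = ennreal r * (ennreal (g (fst w, \<rho> * fst w + r * snd w)) * indicator G (fst w, \<rho> * fst w + r * snd w))"
        using r_pos g0 by (simp only: ennreal_mult mult.assoc less_imp_le)
    qed
    also have "\<dots> = ennreal r * (\<integral>\<^sup>+w. ennreal (g (fst w, \<rho> * fst w + r * snd w)) * indicator G (fst w, \<rho> * fst w + r * snd w) \<partial>lborel)"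
    proof (rule nn_integral_cmult)
      have sm: "(\<lambda>w. (fst w, \<rho> * fst w + r * snd w)) \<in> borel \<rightarrow>\<^sub>M (borel :: (real \<times> real) measure)"
        by (intro borel_measurable_continuous_onI continuous_intros)
      have "(\<lambda>z. ennreal (g z) * indicator G z) \<in> borel_measurable borel" by measurable
      from measurable_compose[OF sm this]
      show "(\<lambda>w. ennreal (g (fst w, \<rho> * fst w + r * snd w)) * indicator G (fst w, \<rho> * fst w + r * snd w)) \<in> borel_measurable lborel" by simp
    qed
    also have "\<dots> = (\<integral>\<^sup>+z. ennreal (g z) * indicator G z \<partial>lborel)"
      by (rule nn_integral_shear[OF _ r_pos, symmetric]) measurable
    also have "\<dots> = emeasure (density lborel (\<lambda>z. ennreal (g z))) G"
      by (simp add: emeasure_density)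
    finally show "emeasure (density lborel (\<lambda>z. ennreal (\<phi> z))) G = emeasure (density lborel (\<lambda>z. ennreal (g z))) G" .
  qed simp
  then have "AE z in lborel. ennreal (\<phi> z) = ennreal (g z)"
    using \<phi>m gm by (intro sigma_finite_measure.density_unique[OF lborel.sigma_finite_measure_axioms]) auto
  then have "AE z in lborel. \<phi> z = g z"
    using \<phi>0 g0 by (simp add: ennreal_inj)
  then have "\<phi> = g" by (rule continuous_AE_eq_imp_eq[OF cont gc])
  then show ?thesis by (simp add: g_def)
qed

end

context correlated_pair
begin

lemma unshear_point: "unshear (u + c1, a * u + c2) = u *\<^sub>R (1, (a - \<rho>) / r) + (c1, (c2 - \<rho> * c1) / r)"
  using r_pos by (simp add: unshear_def field_simps)

text \<open>The quadrant becomes a cone in independent coordinates, and drifts are unsheared. It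
  serves twice: with drift (c1, c2) for the exit probability and with drift (1, a) for the
  constant.\<close>

lemma exit_cone_iff:
  "B t \<omega> - t *\<^sub>R (d1, (d2 - \<rho> * d1) / r) - w \<in> {k. fst k > 0 \<and> \<rho> * fst k + r * snd k > 0} \<longleftrightarrow>
     B1 t \<omega> - d1 * t > fst w \<and> \<rho> * B1 t \<omega> + r * B2 t \<omega> - d2 * t > \<rho> * fst w + r * snd w"
proof -
  have "r * (t * ((d2 - \<rho> * d1) / r)) = t * (d2 - \<rho> * d1)" using r_pos by simp
  then have "\<rho> * (B1 t \<omega> - t * d1 - fst w) + r * (B2 t \<omega> - t * ((d2 - \<rho> * d1) / r) - snd w)
    = \<rho> * B1 t \<omega> + r * B2 t \<omega> - d2 * t - (\<rho> * fst w + r * snd w)"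
    by (simp add: algebra_simps)
  then show ?thesis by (auto simp: B_def mult.commute)
qed

lemma lambda_pos:
  assumes "\<rho> < a" "a \<le> 1"
  shows "lambda1 a \<rho> > 0" "lambda2 a \<rho> > 0"
proof -
  have "\<bar>a * \<rho>\<bar> \<le> \<bar>\<rho>\<bar>" using assms rho by (simp add: abs_mult mult_left_le_one_le)
  also have "\<dots> < 1" using rho by (simp add: abs_less_iff)
  finally show "lambda1 a \<rho> > 0" using rho_sq by (simp add: lambda1_def)
  show "lambda2 a \<rho> > 0" using rho_sq assms by (simp add: lambda2_def)
qed

text \<open>With A the shear, the covariance is A A^T and \<lambda> is its inverse applied to (1,
  a), while m = A^(-1) (1, a). Hence \<lambda> . (A w) = m . w.\<close>

lemma lambda_inner: "lambda1 a \<rho> * fst w + lambda2 a \<rho> * (\<rho> * fst w + r * snd w) = (1, (a - \<rho>) / r) \<bullet> w"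
proof -
  have s: "1 - \<rho>\<^sup>2 \<noteq> 0" using rho_sq by simp
  have "lambda1 a \<rho> + lambda2 a \<rho> * \<rho> = (1 - \<rho>\<^sup>2) / (1 - \<rho>\<^sup>2)"
    unfolding lambda1_def lambda2_def by (simp add: add_divide_distrib[symmetric] algebra_simps power2_eq_square)
  then have 1: "lambda1 a \<rho> + lambda2 a \<rho> * \<rho> = 1" using s by simp
  have 2: "lambda2 a \<rho> * r = (a - \<rho>) / r"
    unfolding lambda2_def r_sq[symmetric] using r_pos by (simp add: power2_eq_square)
  have "lambda1 a \<rho> * fst w + lambda2 a \<rho> * (\<rho> * fst w + r * snd w)
    = (lambda1 a \<rho> + lambda2 a \<rho> * \<rho>) * fst w + (lambda2 a \<rho> * r) * snd w" by (simp add: algebra_simps)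
  then show ?thesis unfolding 1 2 by (cases w) simp
qed

text \<open>On the cone both sheared coordinates are positive, so this bounds the norm by their sum;
  it converts positivity of the \<lambda>'s into a margin for m.\<close>

lemma norm_le_shear:
  "norm k \<le> (1 + 1 / r) * (\<bar>fst k\<bar> + \<bar>\<rho> * fst k + r * snd k\<bar>)"
proof -
  define z where "z = \<rho> * fst k + r * snd k"
  have "snd k = (z - \<rho> * fst k) / r" using r_pos by (simp add: z_def)
  then have "\<bar>snd k\<bar> = \<bar>z - \<rho> * fst k\<bar> / r" using r_pos by simp
  also have "\<dots> \<le> (\<bar>z\<bar> + \<bar>fst k\<bar>) / r"
  proof (rule divide_right_mono)
    have "\<bar>\<rho> * fst k\<bar> \<le> \<bar>fst k\<bar>" using rho by (simp add: abs_mult mult_left_le_one_le)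
    then show "\<bar>z - \<rho> * fst k\<bar> \<le> \<bar>z\<bar> + \<bar>fst k\<bar>" by linarith
  qed (use r_pos in simp)
  finally have "\<bar>snd k\<bar> \<le> (\<bar>z\<bar> + \<bar>fst k\<bar>) / r" .
  moreover have "norm k \<le> \<bar>fst k\<bar> + \<bar>snd k\<bar>" using norm_Pair_le[of "fst k" "snd k"] by simp
  ultimately have "norm k \<le> \<bar>fst k\<bar> + (\<bar>z\<bar> + \<bar>fst k\<bar>) / r" by linarith
  also have "\<dots> \<le> (1 + 1 / r) * (\<bar>fst k\<bar> + \<bar>z\<bar>)" by (simp add: distrib_right add.commute)
  finally show ?thesis by (simp add: z_def)
qed

lemma strong_case:
  assumes a: "\<rho> < a" "a \<le> 1" and pdf: "joint_pdf N (W1 1) (W2 1) \<phi>" "continuous_on UNIV \<phi>"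
  shows "integrable (lborel \<Otimes>\<^sub>M lborel) (C_integrand N W1 W2 a \<rho>)" "C_const N W1 W2 a \<rho> > 0"
    "(\<lambda>u. psi N W1 W2 c1 c2 u (a * u)) \<sim>[at_top]
            (\<lambda>u. C_const N W1 W2 a \<rho> * u powi (-2) * \<phi> (u + c1, a * u + c2))"
proof -
  define m :: "real \<times> real" where "m = (1, (a - \<rho>) / r)"
  define \<gamma> :: "real \<times> real" where "\<gamma> = (c1, (c2 - \<rho> * c1) / r)"
  define K :: "(real \<times> real) set" where "K = {k. fst k > 0 \<and> \<rho> * fst k + r * snd k > 0}"
  \<comment> \<open>On K, m . k is a combination of the two positive sheared coordinates with
    coefficients \<lambda>1, \<lambda>2, hence at least their minimum times the sum; dividing by the
    constant of \<open>norm_le_shear\<close> gives the margin.\<close>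
  define \<kappa> where "\<kappa> = min (lambda1 a \<rho>) (lambda2 a \<rho>) / (1 + 1 / r)"
  define \<epsilon> where "\<epsilon> = min \<kappa> (norm m)"
  note lpos = lambda_pos[OF a]
  have r1: "1 + 1 / r > 0" using r_pos by (simp add: add_pos_pos)
  have \<kappa>0: "\<kappa> > 0" using lpos r1 by (simp add: \<kappa>_def)
  interpret cone: planar_cone_problem M B1 B2 K m \<gamma> \<epsilon>
  proof unfold_locales
    show "open K" unfolding K_def by (intro open_Collect_conj open_Collect_less continuous_intros)
    have "(1, (1 - \<rho>) / r) \<in> K" using r_pos by (simp add: K_def)
    then show "K \<noteq> {}" by blast
    show "c *\<^sub>R x \<in> K \<longleftrightarrow> x \<in> K" if "c > 0" for c x
    proof -
      have "\<rho> * (c * fst x) + r * (c * snd x) = c * (\<rho> * fst x + r * snd x)" by (simp add: algebra_simps)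
      then show ?thesis using that by (simp add: K_def zero_less_mult_iff)
    qed
    have "norm m > 0" by (simp add: m_def zero_prod_def)
    then show "0 < \<epsilon>" using \<kappa>0 by (simp add: \<epsilon>_def)
    show "\<epsilon> \<le> norm m" by (simp add: \<epsilon>_def)
    fix k assume k: "k \<in> K"
    define z1 z2 where "z1 = fst k" and "z2 = \<rho> * fst k + r * snd k"
    have z: "z1 > 0" "z2 > 0" using k by (auto simp: K_def z1_def z2_def)
    have "\<epsilon> * norm k \<le> \<kappa> * norm k" by (intro mult_right_mono) (simp_all add: \<epsilon>_def)
    also have "\<dots> \<le> \<kappa> * ((1 + 1 / r) * (z1 + z2))"
      using norm_le_shear[of k] z \<kappa>0 by (intro mult_left_mono) (simp_all add: z1_def z2_def)
    also have "\<dots> = min (lambda1 a \<rho>) (lambda2 a \<rho>) * z1 + min (lambda1 a \<rho>) (lambda2 a \<rho>) * z2"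
      using r1 by (simp add: \<kappa>_def distrib_left)
    also have "\<dots> \<le> lambda1 a \<rho> * z1 + lambda2 a \<rho> * z2"
      using z by (intro add_mono mult_right_mono) auto
    also have "\<dots> = m \<bullet> k" unfolding z1_def z2_def lambda_inner m_def ..
    finally show "\<epsilon> * norm k \<le> m \<bullet> k" .
  qed
  define I where "I = (\<integral>w. exp (m \<bullet> w) * cone.hitting_prob w \<partial>lborel)"
  define H where "H w = exp (m \<bullet> w) * cone.hitting_prob w" for w
  have H0: "0 \<le> H w" for w by (simp add: H_def cone.hitting_prob_nonneg)
  have Hm: "H \<in> borel_measurable borel" unfolding H_def[abs_def] by measurable
  have I0: "I > 0" unfolding I_def by (rule cone.integral_hitting_pos)
  have psi: "psi N W1 W2 c1 c2 u (a * u) = cone.exit_prob {0..1} u" for u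
  proof -
    have ex: "B t \<omega> - t *\<^sub>R \<gamma> - u *\<^sub>R m \<in> K \<longleftrightarrow> B1 t \<omega> - c1 * t > u \<and> \<rho> * B1 t \<omega> + r * B2 t \<omega> - c2 * t > a * u" for t \<omega>
    proof -
      have "r * (u * ((a - \<rho>) / r)) = u * (a - \<rho>)" using r_pos by simp
      then have eqs: "\<rho> * fst (u *\<^sub>R m) + r * snd (u *\<^sub>R m) = a * u" "fst (u *\<^sub>R m) = u"
        by (simp_all add: m_def) (simp add: algebra_simps)
      show ?thesis unfolding K_def \<gamma>_def using exit_cone_iff[of t \<omega> c1 c2 "u *\<^sub>R m"] unfolding eqs(1) unfolding eqs(2) .
    qed
    have rat: "(\<exists>t\<in>{0..1}. B t \<omega> - t *\<^sub>R \<gamma> - u *\<^sub>R m \<in> K) \<longleftrightarrow> (\<exists>t\<in>\<rat> \<inter> {0..1}. B t \<omega> - t *\<^sub>R \<gamma> - u *\<^sub>R m \<in> K)"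
      if "\<omega> \<in> space M" for \<omega>
      by (intro ex_rational_in_open cone.open_K closure_rational_atLeastAtMost continuous_intros
          continuous_on_subset[OF continuous_B[OF that]]) auto
    show ?thesis
      unfolding psi_eq cone.exit_prob_def using rat
      by (intro arg_cong[of _ _ "measure M"] Collect_cong conj_cong) (auto simp: ex)
  qed
  \<comment> \<open>In sheared coordinates the integrand of the constant is the limiting integrand
    of the cone problem.\<close>
  have CH: "C_integrand N W1 W2 a \<rho> (fst w, \<rho> * fst w + r * snd w) = H w" for w
  proof -
    have hex: "B t \<omega> - t *\<^sub>R m - w \<in> K \<longleftrightarrow> B1 t \<omega> - 1 * t > fst w \<and> \<rho> * B1 t \<omega> + r * B2 t \<omega> - a * t > \<rho> * fst w + r * snd w" for t \<omega>
      unfolding K_def m_def using exit_cone_iff[of t \<omega> 1 a w] by (simp only: mult_1_right)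
    have "measure N {\<omega>\<in>space N. \<exists>t\<in>{0..}. W1 t \<omega> - 1 * t > fst w \<and> W2 t \<omega> - a * t > \<rho> * fst w + r * snd w}
      = measure M {\<omega>\<in>space M. \<exists>t\<in>\<rat> \<inter> {0..}. B1 t \<omega> - 1 * t > fst w \<and> \<rho> * B1 t \<omega> + r * B2 t \<omega> - a * t > \<rho> * fst w + r * snd w}"
      by (rule drift_exit[OF closure_rational_atLeast]) simp
    also have "\<dots> = cone.hitting_prob w"
      unfolding cone.hitting_prob_def hitting_def hex ..
    finally have p: "measure N {\<omega>\<in>space N. \<exists>t\<ge>0. W1 t \<omega> - t > fst w \<and> W2 t \<omega> - a * t > \<rho> * fst w + r * snd w} = cone.hitting_prob w"
      by (simp add: Bex_def)
    show ?thesis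
      unfolding C_integrand_def case_prod_conv p lambda_inner H_def m_def by (rule mult.commute)
  qed
  have CU: "C_integrand N W1 W2 a \<rho> z = H (unshear z)" for z
  proof -
    have "z = (fst (unshear z), \<rho> * fst (unshear z) + r * snd (unshear z))"
      using r_pos by (simp add: unshear_def)
    then show ?thesis using CH[of "unshear z"] by simp
  qed
  have Cm: "C_integrand N W1 W2 a \<rho> \<in> borel_measurable (lborel \<Otimes>\<^sub>M lborel)"
    unfolding CU[abs_def] lborel_prod using measurable_compose[OF measurable_unshear Hm] by simp
  have C0: "0 \<le> C_integrand N W1 W2 a \<rho> z" for z unfolding CU by (rule H0)
  have "(\<integral>\<^sup>+z. ennreal (C_integrand N W1 W2 a \<rho> z) \<partial>(lborel \<Otimes>\<^sub>M lborel)) = ennreal r * (\<integral>\<^sup>+w. ennreal (H w) \<partial>lborel)"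
  proof -
    have m: "(\<lambda>z. ennreal (C_integrand N W1 W2 a \<rho> z)) \<in> borel_measurable borel"
      using Cm by (simp add: lborel_prod)
    show ?thesis unfolding lborel_prod nn_integral_shear[OF m r_pos, of \<rho>] CH ..
  qed
  also have "(\<integral>\<^sup>+w. ennreal (H w) \<partial>lborel) = ennreal I"
    unfolding I_def H_def[symmetric] using cone.integrable_hitting H0
    by (intro nn_integral_eq_integral) (simp_all add: H_def)
  finally have nn: "(\<integral>\<^sup>+z. ennreal (C_integrand N W1 W2 a \<rho> z) \<partial>(lborel \<Otimes>\<^sub>M lborel)) = ennreal (r * I)"
    using r_pos I0 by (simp add: ennreal_mult)
  show "integrable (lborel \<Otimes>\<^sub>M lborel) (C_integrand N W1 W2 a \<rho>)"
    by (rule integrableI_nn_integral_finite[OF Cm _ nn]) (simp add: C0)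
  \<comment> \<open>The factor r is the Jacobian of the shear; it cancels against the 1/r in the
    joint density.\<close>
  have C: "C_const N W1 W2 a \<rho> = r * I"
    unfolding C_const_def using integral_eq_nn_integral[OF Cm] C0 nn r_pos I0 by simp
  show "C_const N W1 W2 a \<rho> > 0" unfolding C using r_pos I0 by simp
  define E where "E u = 2 * pi * u\<^sup>2 * exp ((norm (u *\<^sub>R m + \<gamma>))\<^sup>2 / 2)" for u
  have rhs: "C_const N W1 W2 a \<rho> * u powi (-2) * \<phi> (u + c1, a * u + c2) = I / E u" if "u > 0" for u
  proof -
    have "\<phi> (u + c1, a * u + c2) = exp (- ((norm (u *\<^sub>R m + \<gamma>))\<^sup>2 / 2)) / (2 * pi) / r"
      unfolding joint_density[OF pdf] unshear_point m_def[symmetric] \<gamma>_def[symmetric] planar_density_def by simp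
    then show ?thesis
      using that r_pos unfolding C E_def by (simp add: power_int_def exp_minus field_simps)
  qed
  have "((\<lambda>u. cone.exit_prob {0..1} u * E u / I) \<longlongrightarrow> I / I) at_top"
    using I0 cone.tendsto_exit_prob unfolding E_def I_def by (intro tendsto_divide tendsto_const) auto
  then have "((\<lambda>u. cone.exit_prob {0..1} u * E u / I) \<longlongrightarrow> 1) at_top" using I0 by simp
  moreover have "\<forall>\<^sub>F u in at_top. cone.exit_prob {0..1} u * E u / I
     = psi N W1 W2 c1 c2 u (a * u) / (C_const N W1 W2 a \<rho> * u powi (-2) * \<phi> (u + c1, a * u + c2))"
    using eventually_gt_at_top[of 0] by eventually_elim (simp add: psi rhs)
  ultimately show "(\<lambda>u. psi N W1 W2 c1 c2 u (a * u)) \<sim>[at_top]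
            (\<lambda>u. C_const N W1 W2 a \<rho> * u powi (-2) * \<phi> (u + c1, a * u + c2))"
    by (intro asymp_equivI') (rule Lim_transform_eventually)
qed

text \<open>For a = \<rho> the limiting event is r B2(1) > c2 - \<rho> c1. The first component of W
  has the same Gaussian marginal as B2, and symmetry turns this upper tail into the distribution
  function at the negated point.\<close>

lemma Phi_star_eq:
  "Phi_star N W1 a \<rho> (c1 * \<rho> - c2) = (if a < \<rho> then 1 else normal_tail ((c2 - \<rho> * c1) / r))"
proof (cases "a < \<rho>")
  case False
  let ?x = "(c2 - \<rho> * c1) / r"
  have Wm: "(\<lambda>\<omega>. sqrt (1 - \<rho>\<^sup>2) * W1 1 \<omega>) \<in> borel_measurable N" using W1[of 1] by simp
  have "cdf (distr N borel (\<lambda>\<omega>. sqrt (1 - \<rho>\<^sup>2) * W1 1 \<omega>)) (c1 * \<rho> - c2)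
    = measure N {\<omega>\<in>space N. \<exists>t\<in>{1}. (\<lambda>p. r * fst p) (W1 t \<omega>, W2 t \<omega>) \<in> {..c1 * \<rho> - c2}}"
    unfolding cdf_def measure_distr[OF Wm atMost_borel] by (rule arg_cong[of _ _ "measure N"]) (auto simp: r)
  also have "\<dots> = measure M {\<omega>\<in>space M. \<exists>t\<in>{1}. (\<lambda>p. r * fst p) (B1 t \<omega>, \<rho> * B1 t \<omega> + r * B2 t \<omega>) \<in> {..c1 * \<rho> - c2}}"
    by (intro transfer borel_measurable_continuous_onI continuous_intros) auto
  also have "\<dots> = measure M (space M - {\<omega>\<in>space M. B1 1 \<omega> > - ?x})"
  proof (rule arg_cong[of _ _ "measure M"])
    have "r * B1 1 \<omega> \<le> c1 * \<rho> - c2 \<longleftrightarrow> \<not> B1 1 \<omega> > - ?x" for \<omega>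
    proof -
      have "- ?x = (c1 * \<rho> - c2) / r" by (simp add: minus_divide_left mult.commute)
      then show ?thesis using r_pos by (simp add: not_less pos_le_divide_eq mult.commute)
    qed
    then show "{\<omega>\<in>space M. \<exists>t\<in>{1}. (\<lambda>p. r * fst p) (B1 t \<omega>, \<rho> * B1 t \<omega> + r * B2 t \<omega>) \<in> {..c1 * \<rho> - c2}}
       = space M - {\<omega>\<in>space M. B1 1 \<omega> > - ?x}" by auto
  qed
  also have "\<dots> = 1 - normal_tail (- ?x)"
  proof -
    have [measurable]: "B1 1 \<in> borel_measurable M" by (simp add: B1.random_variable)
    show ?thesis by (subst B1.prob_compl) (simp_all add: B1.prob_one)
  qed
  also have "\<dots> = normal_tail ?x" by (simp only: normal_tail_minus)
  finally show ?thesis using False by (simp add: Phi_star_def)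
qed (simp add: Phi_star_def)

text \<open>The limit involves only exp((u + c1)^2/2). At the evaluation point the joint density has
  the additional factor exp(-k^2/(2 r^2)) / (2 pi r), and the explicit constants in the claim
  compensate exactly for it.\<close>

lemma weak_case:
  assumes a: "a \<le> \<rho>" and pdf: "joint_pdf N (W1 1) (W2 1) \<phi>" "continuous_on UNIV \<phi>"
  shows "(\<lambda>u. psi N W1 W2 c1 c2 u (a * u)) \<sim>[at_top]
            (\<lambda>u. 2 * sqrt (2 * pi * (1 - \<rho>\<^sup>2)) * Phi_star N W1 a \<rho> (c1 * \<rho> - c2)
                 * exp ((c2 - \<rho> * c1)\<^sup>2 / (2 * (1 - \<rho>\<^sup>2)))
                 * u powi (-1) * \<phi> (u + c1, \<rho> * u + c2))"
proof -
  define k where "k = c2 - \<rho> * c1"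
  define P where "P = Phi_star N W1 a \<rho> (c1 * \<rho> - c2)"
  have P: "P = (if a < \<rho> then 1 else normal_tail (k / r))" unfolding P_def k_def by (rule Phi_star_eq)
  have P0: "P > 0" unfolding P using normal_tail_pos by simp
  define L where "L = 2 / sqrt (2 * pi) * P"
  have L0: "L > 0" using P0 by (simp add: L_def)
  define E where "E u = u * exp ((u + c1)\<^sup>2 / 2)" for u
  have psi: "psi N W1 W2 c1 c2 u (a * u) = measure M (both \<rho> r a c1 c2 u)" for u
    unfolding psi_eq
    \<comment> \<open>The abstract window, time sets and residual process of the case a <= \<rho>
      receive their concrete values.\<close>
    by (rule arg_cong[of _ _ "measure M"], rule both_def[OF r_pos a k_def, of "\<lambda>u. 1 / sqrt u"
        "\<lambda>u. \<rat> \<inter> {max 0 (1 - 1 / sqrt u)..1}" "\<lambda>t \<omega>. r * B2 t \<omega> - k * t", symmetric]) simp_all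
  have lim: "((\<lambda>u. psi N W1 W2 c1 c2 u (a * u) * E u) \<longlongrightarrow> L) at_top"
    unfolding psi E_def L_def P
    by (rule tendsto_both[OF r_pos a k_def, of "\<lambda>u. 1 / sqrt u" "\<lambda>u. \<rat> \<inter> {max 0 (1 - 1 / sqrt u)..1}" "\<lambda>t \<omega>. r * B2 t \<omega> - k * t"]) simp_all
  have rhs: "2 * sqrt (2 * pi * (1 - \<rho>\<^sup>2)) * P * exp ((c2 - \<rho> * c1)\<^sup>2 / (2 * (1 - \<rho>\<^sup>2))) * u powi (-1) * \<phi> (u + c1, \<rho> * u + c2) = L / E u"
    if "u > 0" for u
  proof -
    have "unshear (u + c1, \<rho> * u + c2) = (u + c1, k / r)"
      by (simp add: unshear_def k_def algebra_simps)
    \<comment> \<open>Along the direction (1, \<rho>) the unsheared second coordinate is the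
      constant k / r: the conditional mean of the second component follows the first, so u drops
      out.\<close>
    then have "(norm (unshear (u + c1, \<rho> * u + c2)))\<^sup>2 = (u + c1)\<^sup>2 + k\<^sup>2 / r\<^sup>2"
      by (simp add: norm_Pair power_divide)
    then have phi: "\<phi> (u + c1, \<rho> * u + c2) = exp (- ((u + c1)\<^sup>2 / 2) - k\<^sup>2 / (2 * r\<^sup>2)) / (2 * pi * r)"
      unfolding joint_density[OF pdf] planar_density_def by (simp add: add_divide_distrib)
    define s where "s = sqrt (2 * pi)"
    have s: "s > 0" "s * s = 2 * pi" by (simp_all add: s_def)
    have sr: "sqrt (2 * pi * r\<^sup>2) = s * r" using r_pos by (simp add: s_def real_sqrt_mult)
    have e: "exp (k\<^sup>2 / (2 * r\<^sup>2)) * exp (- ((u + c1)\<^sup>2 / 2) - k\<^sup>2 / (2 * r\<^sup>2)) = inverse (exp ((u + c1)\<^sup>2 / 2))"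
      unfolding exp_add[symmetric] exp_minus[symmetric] by simp
    have alg: "2 * (s * r) * P * e1 * inverse u * (e2 / (s * s * r)) = 2 / s * P / u * (e1 * e2)" for e1 e2
      using s(1) r_pos that by (simp add: field_simps)
    have pw: "u powi (-1) = inverse u" by simp
    show ?thesis
      unfolding pw phi k_def[symmetric] r_sq[symmetric] sr
      unfolding s(2)[symmetric] unfolding alg e unfolding L_def E_def s_def[symmetric]
      using that by (simp add: field_simps)
  qed
  have "((\<lambda>u. psi N W1 W2 c1 c2 u (a * u) * E u / L) \<longlongrightarrow> L / L) at_top"
    using L0 by (intro tendsto_divide tendsto_const lim) auto
  then have "((\<lambda>u. psi N W1 W2 c1 c2 u (a * u) * E u / L) \<longlongrightarrow> 1) at_top" using L0 by simp
  moreover have "\<forall>\<^sub>F u in at_top. psi N W1 W2 c1 c2 u (a * u) * E u / L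
     = psi N W1 W2 c1 c2 u (a * u) / (2 * sqrt (2 * pi * (1 - \<rho>\<^sup>2)) * P * exp ((c2 - \<rho> * c1)\<^sup>2 / (2 * (1 - \<rho>\<^sup>2))) * u powi (-1) * \<phi> (u + c1, \<rho> * u + c2))"
    using eventually_gt_at_top[of 0] by eventually_elim (simp only: rhs, simp)
  ultimately show ?thesis
    unfolding P_def by (intro asymp_equivI') (rule Lim_transform_eventually)
qed

end

theorem theorem2p1:
  fixes M :: "'a measure" and B1 B2 :: "real \<Rightarrow> 'a \<Rightarrow> real"
    and N :: "'b measure" and W1 W2 :: "real \<Rightarrow> 'b \<Rightarrow> real"
    and \<phi> :: "real \<times> real \<Rightarrow> real"
    and c1 c2 a \<rho> :: real
  assumes "standard_brownian_motion M B1" and "standard_brownian_motion M B2"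
    and "independent_processes M B1 B2"
    and "prob_space N"
    and "\<And>t. t \<ge> 0 \<Longrightarrow> W1 t \<in> borel_measurable N"
    and "\<And>t. t \<ge> 0 \<Longrightarrow> W2 t \<in> borel_measurable N"
    and "\<And>\<omega>. \<omega> \<in> space N \<Longrightarrow> continuous_on {0..} (\<lambda>t. W1 t \<omega>)"
    and "\<And>\<omega>. \<omega> \<in> space N \<Longrightarrow> continuous_on {0..} (\<lambda>t. W2 t \<omega>)"
    and "process_law N (\<lambda>t \<omega>. (W1 t \<omega>, W2 t \<omega>)) =
         process_law M (\<lambda>t \<omega>. (B1 t \<omega>, \<rho> * B1 t \<omega> + sqrt (1 - \<rho>\<^sup>2) * B2 t \<omega>))"
    and "joint_pdf N (W1 1) (W2 1) \<phi>" and "continuous_on UNIV \<phi>"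
    and "\<rho> \<in> {-1<..<1}"
  shows "(a \<in> {\<rho><..1} \<longrightarrow>
            lambda1 a \<rho> > 0 \<and> lambda2 a \<rho> > 0 \<and>
            integrable (lborel \<Otimes>\<^sub>M lborel) (C_integrand N W1 W2 a \<rho>) \<and>
            C_const N W1 W2 a \<rho> > 0 \<and>
            (\<lambda>u. psi N W1 W2 c1 c2 u (a * u)) \<sim>[at_top]
            (\<lambda>u. C_const N W1 W2 a \<rho> * u powi (-2) * \<phi> (u + c1, a * u + c2))) \<and>
         (a \<le> \<rho> \<longrightarrow>
            (\<lambda>u. psi N W1 W2 c1 c2 u (a * u)) \<sim>[at_top]
            (\<lambda>u. 2 * sqrt (2 * pi * (1 - \<rho>\<^sup>2)) * Phi_star N W1 a \<rho> (c1 * \<rho> - c2)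
                 * exp ((c2 - \<rho> * c1)\<^sup>2 / (2 * (1 - \<rho>\<^sup>2)))
                 * u powi (-1) * \<phi> (u + c1, \<rho> * u + c2)))"
proof -
  have rho: "-1 < \<rho>" "\<rho> < 1" using assms(12) by auto
  interpret correlated_pair M B1 B2 N W1 W2 \<rho> "sqrt (1 - \<rho>\<^sup>2)"
    by (intro correlated_pair.intro planar_brownian_motion.intro planar_brownian_motion_axioms.intro
        correlated_pair_axioms.intro) (fact assms rho refl)+
  show ?thesis
  proof (intro conjI impI)
    assume "a \<in> {\<rho><..1}"
    then have a: "\<rho> < a" "a \<le> 1" by auto
    show "lambda1 a \<rho> > 0" "lambda2 a \<rho> > 0" by (rule lambda_pos[OF a])+
    show "integrable (lborel \<Otimes>\<^sub>M lborel) (C_integrand N W1 W2 a \<rho>)" "C_const N W1 W2 a \<rho> > 0"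
      "(\<lambda>u. psi N W1 W2 c1 c2 u (a * u)) \<sim>[at_top]
            (\<lambda>u. C_const N W1 W2 a \<rho> * u powi (-2) * \<phi> (u + c1, a * u + c2))"
      by (rule strong_case[OF a assms(10,11)])+
  next
    assume "a \<le> \<rho>"
    then show "(\<lambda>u. psi N W1 W2 c1 c2 u (a * u)) \<sim>[at_top]
            (\<lambda>u. 2 * sqrt (2 * pi * (1 - \<rho>\<^sup>2)) * Phi_star N W1 a \<rho> (c1 * \<rho> - c2)
                 * exp ((c2 - \<rho> * c1)\<^sup>2 / (2 * (1 - \<rho>\<^sup>2)))
                 * u powi (-1) * \<phi> (u + c1, \<rho> * u + c2))"
      by (rule weak_case[OF _ assms(10,11)])
  qed
qed

end
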